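(* Assume the Riemann hypothesis. For every fixed integer $\ell\ge1$ and every fixed $c\in\mathbb R$, $$\lim_{X\to\infty}\mathcal M_X\!\left[\frac{S_{\ell,c}(x)-\pi(x)}{q_\ell(x)}\right]=\frac1{\sqrt2}-c.$$ Consequently, $c_{\mathrm{th}}=\frac1{\sqrt2}$ is the unique fixed coefficient $c\in\mathbb R$ for which this limit (the asymptotic logarithmic-mean bias) is zero; equivalently, it is the unique minimizer over $c\in\mathbb R$ of the absolute limiting bias $\left|\frac1{\sqrt2}-c\right|$.
   Context: For an integer $\ell\ge1$ and $n\ge 1$ put $L_n^{(\ell)}=\frac{n(\ell(n-1)+2)}{2}$ and $h_n^{(\ell)}=L_{n+1}^{(\ell)}-L_n^{(\ell)}=1+\ell n$. For real $x$ let $\nu_\ell(x)=\frac{\sqrt{8\ell x+(\ell-2)^2}+\ell-2}{2\ell}$ and $n_x^{(\ell)}=\lceil \nu_\ell(x)\rceil$ (so with $n=n_x^{(\ell)}$ one has $L_{n-1}^{(\ell)}<x\le L_n^{(\ell)}$). For $j\ge1$ let $s_j^{(\ell)}=h_j^{(\ell)}/\log L_{j+1}^{(\ell)}$ and $\Sigma_n^{(\ell)}=\sum_{j=1}^{n-1}s_j^{(\ell)}$. For $x\ge 2$ define $$\widehat S_\ell(x)=\Sigma_{n_x^{(\ell)}}^{(\ell)}-\frac{L_{n_x^{(\ell)}}^{(\ell)}-x}{\log L_{n_x^{(\ell)}}^{(\ell)}},\qquad q_\ell(x)=\frac{h_{n_x^{(\ell)}-1}^{(\ell)}}{\sqrt{\ell}\,\log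 L_{n_x^{(\ell)}}^{(\ell)}},$$ and for $c\in\mathbb R$ let $S_{\ell,c}(x)=\widehat S_\ell(x)-c\,q_\ell(x)$. Here $\pi(x)$ is the number of primes $p\le x$. For a locally integrable function $f$ on $[2,\infty)$ and $X>2$, the logarithmic mean is $$\mathcal M_X[f]=\frac1{\log(X/2)}\int_2^X f(x)\,\frac{dx}{x}.$$ *)

theory Defs
  imports "HOL-Complex_Analysis.Complex_Analysis" "HOL-Computational_Algebra.Primes"
begin

(* The analytic continuation of the Dirichlet series; by the identity theorem these two
   conditions determine the values at every s other than 1, and the value at 1 is
   arbitrary. *)
definition riemann_zeta :: "complex \<Rightarrow> complex" where
  "riemann_zeta = (SOME f. f holomorphic_on (- {1}) \<and>
     (\<forall>s. Re s > 1 \<longrightarrow> (\<lambda>n. of_nat (Suc n) powr (- s)) sums f s))"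

(* The zeros at the negative even integers are the trivial ones; s = 1 is the pole. *)
definition riemann_hypothesis :: bool where
  "riemann_hypothesis \<longleftrightarrow>
     (\<forall>s. s \<noteq> 1 \<and> riemann_zeta s = 0 \<and> (\<nexists>k::nat. k \<ge> 1 \<and> s = - 2 * of_nat k)
        \<longrightarrow> Re s = 1 / 2)"

definition prime_count :: "real \<Rightarrow> nat" where
  "prime_count x = card {p::nat. prime p \<and> real p \<le> x}"

definition L_seq :: "nat \<Rightarrow> nat \<Rightarrow> real" where
  "L_seq l n = real n * (real l * (real n - 1) + 2) / 2"

definition h_step :: "nat \<Rightarrow> nat \<Rightarrow> real" where
  "h_step l n = L_seq l (n + 1) - L_seq l n"

lemma h_step_eq: "h_step l n = 1 + real l * real n"
  by (simp add: h_step_def L_seq_def field_simps)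

definition nu :: "nat \<Rightarrow> real \<Rightarrow> real" where
  "nu l x = (sqrt (8 * real l * x + (real l - 2)\<^sup>2) + real l - 2) / (2 * real l)"

(* For l >= 1 and x >= 2 the ceiling is at least 2, so the conversion to nat is harmless,
   and so is the subtraction in the definition of q_scale below. *)
definition level :: "nat \<Rightarrow> real \<Rightarrow> nat" where
  "level l x = nat \<lceil>nu l x\<rceil>"

definition s_term :: "nat \<Rightarrow> nat \<Rightarrow> real" where
  "s_term l j = h_step l j / ln (L_seq l (j + 1))"

definition Sigma_sum :: "nat \<Rightarrow> nat \<Rightarrow> real" where
  "Sigma_sum l n = (\<Sum>j\<in>{1..<n}. s_term l j)"

definition S_hat :: "nat \<Rightarrow> real \<Rightarrow> real" where
  "S_hat l x = Sigma_sum l (level l x) - (L_seq l (level l x) - x) / ln (L_seq l (level l x))"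

definition q_scale :: "nat \<Rightarrow> real \<Rightarrow> real" where
  "q_scale l x = h_step l (level l x - 1) / (sqrt (real l) * ln (L_seq l (level l x)))"

definition S_approx :: "nat \<Rightarrow> real \<Rightarrow> real \<Rightarrow> real" where
  "S_approx l c x = S_hat l x - c * q_scale l x"

(* Used with f bounded and Borel measurable on {2..X}, where the integral exists. *)
definition log_mean :: "real \<Rightarrow> (real \<Rightarrow> real) \<Rightarrow> real" where
  "log_mean X f = 1 / ln (X / 2) * (LBINT x:{2..X}. f x / x)"

definition mean_bias :: "nat \<Rightarrow> real \<Rightarrow> real \<Rightarrow> real" where
  "mean_bias l c X = log_mean X (\<lambda>x. (S_approx l c x - real (prime_count x)) / q_scale l x)"

definition limiting_bias :: "nat \<Rightarrow> real \<Rightarrow> real" where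
  "limiting_bias l c = Lim at_top (mean_bias l c)"

lemma level_bounds:
  assumes "l \<ge> 1" "x \<ge> 2"
  shows "level l x \<ge> 2" "L_seq l (level l x - 1) < x" "x \<le> L_seq l (level l x)"
proof -
  define v where "v = nu l x"
  have l: "real l \<ge> 1" using assms by simp
  define r where "r = sqrt (8 * real l * x + (real l - 2)\<^sup>2)"
  have lx: "real l * x > real l * 1"
    using l assms by (intro mult_strict_left_mono) auto
  have "8 * real l * x + (real l - 2)\<^sup>2 > (real l + 2)\<^sup>2"
    using lx by (simp add: power2_eq_square algebra_simps)
  then have r_gt: "r > real l + 2"
    unfolding r_def using l by (intro real_less_rsqrt) auto
  have r_sq: "r * r = 8 * real l * x + (real l - 2)\<^sup>2"
    unfolding r_def using l assms by simp
  have r_eq: "r = 2 * real l * v - (real l - 2)"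
    using l by (simp add: v_def nu_def r_def)
  have v_gt: "v > 1"
    using r_gt l unfolding r_eq by (simp add: algebra_simps)
  have "4 * real l * (v * (real l * (v - 1) + 2)) = 4 * real l * (2 * x)"
    using r_sq unfolding r_eq by (simp add: power2_eq_square algebra_simps)
  then have x_eq: "x = v * (real l * (v - 1) + 2) / 2"
    using l by simp
  have mono: "a * (real l * (a - 1) + 2) / 2 \<le> b * (real l * (b - 1) + 2) / 2
      \<and> (a < b \<longrightarrow> a * (real l * (a - 1) + 2) / 2 < b * (real l * (b - 1) + 2) / 2)"
    if "1 \<le> a" "a \<le> b" for a b :: real
  proof -
    have eq: "b * (real l * (b - 1) + 2) / 2 - a * (real l * (a - 1) + 2) / 2
        = (b - a) * ((real l * (a + b - 1) + 2) / 2)"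
      by (simp add: field_simps)
    have "real l * (a + b - 1) \<ge> 0" using that by simp
    then have pos: "(real l * (a + b - 1) + 2) / 2 > 0" by simp
    have "(b - a) * ((real l * (a + b - 1) + 2) / 2) \<ge> 0"
      using that pos by (intro mult_nonneg_nonneg) auto
    moreover have "(b - a) * ((real l * (a + b - 1) + 2) / 2) > 0" if "a < b"
      using that pos by (intro mult_pos_pos) auto
    ultimately show ?thesis using eq by force
  qed
  have ceil: "\<lceil>v\<rceil> \<ge> 2" using v_gt by linarith
  then show ge2: "level l x \<ge> 2" unfolding level_def v_def by linarith
  have n: "real (level l x) = of_int \<lceil>v\<rceil>"
    using ceil unfolding level_def v_def by simp
  have n1: "real (level l x - 1) = real (level l x) - 1" using ge2 by simp
  have "real (level l x - 1) \<ge> 1" "real (level l x - 1) < v" "v \<le> real (level l x)"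
    using ge2 n n1 by linarith+
  then show "L_seq l (level l x - 1) < x" "x \<le> L_seq l (level l x)"
    unfolding L_seq_def x_eq using mono v_gt by (meson less_imp_le)+
qed

end

(*
  Let psi be Chebyshev's function. Everything rests on the estimate
    int_1^X (psi t - t) t^(-3/2) dt = o(log X)          (RH).
  By Perron's formula this integral is a vertical integral of f'/f, f(s) = (s - 1) zeta(s),
  against X^(w - 1/2) / ((w - 1/2) w). Under RH the line can be moved to Re w = 1/2 + x with x = 1 / log X,
  so one needs x * int |f'/f(1/2 + x + it)| / ((1 + |t|) |x + it|) dt -> 0 as x -> 0.
  Since |f(s)| < M |s + 1|^2, the function Phi = log M + 2 log(s + 1) - log f has positive real part to the
  right of the critical line. The Schwarz lemma gives x |Phi'| <= 2 Re Phi, and a contour integral bounds the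
  mean of Re Phi over vertical unit segments by its value far to the right, uniformly in x; this controls
  large t. For bounded t, f'/f has at most simple poles on the line, so x |f'/f| is bounded and tends to 0
  off the zeros, and dominated convergence applies; at t = 0 one uses zeta(1/2) <> 0.
  The bias decomposes as (x - psi x) / sqrt(2 x) plus a term tending to 1 / sqrt 2 - c; the constant
  comes from the squares of primes. The first part has logarithmic mean 0 by the estimate above.
*)
theory Submission
  imports Defs "HOL-Number_Theory.Number_Theory" "HOL-Real_Asymp.Real_Asymp"
begin

text \<open>The contour integral is estimated by absolute values, so the zeros are controlled solely
  through the growth of \<open>zeta_reg\<close> and its non-vanishing to the right of the line. The
  weight t powr (-3/2) is that of the logarithmic mean of (psi t - t) / sqrt t; integrating t powr
  (w - 3/2) produces the factor 1 / (w - 1/2). On the shifted line the power of X has constant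
  modulus, and boundedness of the weighted integral alone would give O(log X). The gain to o(log X)
  is due to dominated convergence, the zeros on the line being a null set. A zero at 1/2 would meet
  the pole of 1 / (w - 1/2) and leave x / |x + it|^2, whose integral does not tend to 0. The
  constant: pi (sqrt x) / 2 is about sqrt x / log x, while L_n is about l n^2 / 2 and h_n about l n,
  so q is about sqrt (2 x) / log x. Since \<open>riemann_zeta\<close> is chosen by
  \<open>SOME\<close>, a continuation to the whole punctured plane must be exhibited before the
  hypothesis says anything about it; Euler's transformation of the alternating series supplies
  one.\<close>

text \<open>Local majorants make the convergence locally uniform. The third conclusion, termwise
  differentiation, later yields the Dirichlet series of the derivative of zeta in
  \<open>zeta_log_deriv\<close>.\<close>

lemma holomorphic_on_suminf:
  fixes u :: "nat \<Rightarrow> complex \<Rightarrow> complex"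
  assumes S: "open S"
    and hol: "\<And>n. u n holomorphic_on S"
    and bd: "\<And>x. x \<in> S \<Longrightarrow> \<exists>d h. 0 < d \<and> summable h \<and> (\<forall>n. \<forall>y\<in>ball x d \<inter> S. norm (u n y) \<le> h n)"
  shows "(\<lambda>s. \<Sum>n. u n s) holomorphic_on S"
    and "\<And>s. s \<in> S \<Longrightarrow> summable (\<lambda>n. u n s)"
    and "\<And>s. s \<in> S \<Longrightarrow> (\<lambda>n. deriv (u n) s) sums deriv (\<lambda>s. \<Sum>n. u n s) s"
proof -
  have "\<exists>g g'. \<forall>x \<in> S. ((\<lambda>n. u n x) sums g x) \<and> ((\<lambda>n. deriv (u n) x) sums g' x) \<and> (g has_field_derivative g' x) (at x)"
  proof (rule series_and_derivative_comparison_local [OF S])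
    show "(u n has_field_derivative deriv (u n) x) (at x)" if "x \<in> S" for n x
      using hol S that holomorphic_derivI by blast
    show "\<exists>d h. 0 < d \<and> summable h \<and> (\<forall>\<^sub>F n in sequentially. \<forall>y\<in>ball x d \<inter> S. norm (u n y) \<le> h n)"
      if xS: "x \<in> S" for x
    proof -
      obtain d h where "0 < d" "summable h" "\<forall>n. \<forall>y\<in>ball x d \<inter> S. norm (u n y) \<le> h n"
        using bd [OF xS] by blast
      then show ?thesis by (intro exI [of _ d] exI [of _ h] conjI always_eventually)
    qed
  qed
  then obtain g g' where g: "\<And>x. x \<in> S \<Longrightarrow> (\<lambda>n. u n x) sums g x"
    "\<And>x. x \<in> S \<Longrightarrow> (\<lambda>n. deriv (u n) x) sums g' x"
    "\<And>x. x \<in> S \<Longrightarrow> (g has_field_derivative g' x) (at x)" by blast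
  have eq: "(\<Sum>n. u n s) = g s" if "s \<in> S" for s
    using g(1)[OF that] by (simp add: sums_iff)
  have der: "((\<lambda>s. \<Sum>n. u n s) has_field_derivative g' s) (at s)" if "s \<in> S" for s
    by (rule has_field_derivative_transform_within_open [OF g(3)[OF that] S that]) (simp add: eq)
  show "(\<lambda>s. \<Sum>n. u n s) holomorphic_on S"
    using der S by (auto simp: holomorphic_on_open)
  show "summable (\<lambda>n. u n s)" if "s \<in> S" for s
    using g(1)[OF that] by (simp add: sums_iff)
  show "(\<lambda>n. deriv (u n) s) sums deriv (\<lambda>s. \<Sum>n. u n s) s" if "s \<in> S" for s
    using g(2)[OF that] DERIV_imp_deriv [OF der[OF that]] by simp
qed

lemmas HK_combine = Henstock_Kurzweil_Integration.integral_combine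

lemma continuous_on_Complex: "continuous_on S (\<lambda>t. Complex a t)" "continuous_on S (\<lambda>t. Complex t a)"
  by (auto simp: Complex_eq intro!: continuous_intros)

lemma continuous_on_vertical:
  assumes "f holomorphic_on {w. Re w > c}" "c < a"
  shows "continuous_on S (\<lambda>t. f (Complex a t))"
  by (rule continuous_on_compose2 [OF holomorphic_on_imp_continuous_on [OF assms(1)] continuous_on_Complex(1)])
     (use assms(2) in auto)

lemma has_integral_antiderivative:
  assumes "a \<le> b" "\<And>t. a \<le> t \<Longrightarrow> t \<le> b \<Longrightarrow> (F has_real_derivative f t) (at t)"
  shows "(f has_integral (F b - F a)) {a..b}"
  using assms by (intro fundamental_theorem_of_calculus)
    (auto simp flip: has_real_derivative_iff_has_vector_derivative intro: DERIV_subset)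

lemma summable_Suc_powr: "a > 1 \<Longrightarrow> summable (\<lambda>n. real (Suc n) powr (- a))"
  using summable_Suc_iff [of "\<lambda>n. real n powr (- a)"] by (simp add: summable_real_powr_iff del: of_nat_Suc)

subsection \<open>The zeta function to the right of the imaginary axis\<close>

definition zeta_term :: "nat \<Rightarrow> complex \<Rightarrow> complex" where
  "zeta_term n s = (s - 1) * of_nat (Suc n) powr (- s)
     + (of_nat (Suc (Suc n)) powr (1 - s) - of_nat (Suc n) powr (1 - s))"

text \<open>\<open>zeta_reg s = (s - 1) * \<zeta> s\<close>: the second bracket in \<open>zeta_term\<close> telescopes to \<open>-1\<close> when \<open>Re s > 1\<close>.\<close>

definition zeta_reg :: "complex \<Rightarrow> complex" where
  "zeta_reg s = 1 + (\<Sum>n. zeta_term n s)"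

lemma norm_of_nat_powr: "norm (of_nat (Suc n) powr s :: complex) = real (Suc n) powr Re s"
  by (subst norm_powr_real_powr) (auto simp del: of_nat_Suc)

text \<open>\<open>zeta_term n s\<close> is the remainder of the first-order Taylor expansion of z
  powr (1 - s) at n + 1, evaluated at n + 2. The second derivative is O(n powr (- Re s - 1)), which
  is why the series converges for Re s > 0.\<close>

lemma norm_zeta_term_le:
  assumes "Re s \<ge> -1"
  shows "norm (zeta_term n s) \<le> norm s * norm (s - 1) * real (Suc n) powr (- (Re s + 1))"
proof -
  define a :: complex where "a = of_nat (Suc n)"
  \<comment> \<open>\<open>f 0\<close>, \<open>f 1\<close>, \<open>f 2\<close> are z powr (1 - s)
    and its first two derivatives, in the form \<open>complex_Taylor\<close> expects.\<close>
  define f where "f i z = (if i = (0::nat) then z powr (1 - s) else if i = 1 then (1 - s) * z powr (- s)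
      else - s * (1 - s) * z powr (- s - 1))" for i and z :: complex
  have seg: "\<exists>r. z = of_real r \<and> real (Suc n) \<le> r" if zs: "z \<in> closed_segment a (a + 1)" for z
  proof -
    obtain u where "0 \<le> u" "z = (1 - u) *\<^sub>R a + u *\<^sub>R (a + 1)"
      using zs unfolding closed_segment_def by blast
    then show ?thesis
      by (intro exI [of _ "real (Suc n) + u"]) (auto simp: a_def scaleR_conv_of_real algebra_simps)
  qed
  have "norm (f 0 (a + 1) - (\<Sum>i\<le>1. f i a * (a + 1 - a) ^ i / (fact i)))
     \<le> (norm s * norm (s - 1) * real (Suc n) powr (- (Re s + 1))) * norm (a + 1 - a)^(Suc 1) / fact 1"
  proof (rule complex_Taylor [of "closed_segment a (a + 1)"])
    fix i :: nat and x :: complex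
    assume x: "x \<in> closed_segment a (a + 1)" and "i \<le> 1"
    obtain r where r: "x = of_real r" "real (Suc n) \<le> r" using seg x by blast
    then have xn: "x \<notin> \<real>\<^sub>\<le>\<^sub>0" by auto
    show "(f i has_field_derivative f (Suc i) x) (at x within closed_segment a (a + 1))"
    proof (cases "i = 0")
      case True
      have "((\<lambda>z. z powr (1 - s)) has_field_derivative (1 - s) * x powr (- s)) (at x)"
        using has_field_derivative_powr [OF xn, of "1 - s"] by simp
      then show ?thesis unfolding True f_def
        by (auto intro: has_field_derivative_at_within)
    next
      case False
      with \<open>i \<le> 1\<close> have i: "i = 1" by simp
      have "((\<lambda>z. (1 - s) * z powr (- s)) has_field_derivative (- s * (1 - s) * x powr (- s - 1))) (at x)"
        using DERIV_cmult [OF has_field_derivative_powr [OF xn, of "- s"], of "1 - s"] by (simp add: mult_ac)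
      then show ?thesis unfolding i f_def
        by (auto intro: has_field_derivative_at_within)
    qed
  next
    fix x assume x: "x \<in> closed_segment a (a + 1)"
    obtain r where r: "x = of_real r" "real (Suc n) \<le> r" using seg x by blast
    then have "norm (x powr (- s - 1)) = r powr (- (Re s + 1))"
      by (subst norm_powr_real_powr) auto
    also have "\<dots> \<le> real (Suc n) powr (- (Re s + 1))"
      using r assms by (intro powr_mono2') auto
    finally show "norm (f (Suc 1) x) \<le> norm s * norm (s - 1) * real (Suc n) powr (- (Re s + 1))"
      unfolding f_def by (simp add: norm_mult norm_minus_commute mult_left_mono)
  qed auto
  moreover have "f 0 (a + 1) - (\<Sum>i\<le>1. f i a * (a + 1 - a) ^ i / (fact i)) = zeta_term n s"
    by (simp add: f_def zeta_term_def a_def algebra_simps)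
  ultimately show ?thesis by simp
qed

lemma zeta_term_holomorphic: "zeta_term n holomorphic_on A"
proof -
  have "zeta_term n = (\<lambda>s. (s - 1) * exp (- s * of_real (ln (Suc n))) +
     (exp ((1 - s) * of_real (ln (Suc (Suc n)))) - exp ((1 - s) * of_real (ln (Suc n)))))"
    unfolding zeta_term_def by (auto simp: fun_eq_iff powr_def Ln_of_nat simp del: of_nat_Suc)
  then show ?thesis by (auto intro!: holomorphic_intros simp del: of_nat_Suc)
qed

lemma zeta_term_bound_local:
  assumes "Re x > 0"
  shows "\<exists>d h. 0 < d \<and> summable h \<and> (\<forall>n. \<forall>y\<in>ball x d \<inter> {s. Re s > 0}. norm (zeta_term n y) \<le> h n)"
proof (intro exI conjI allI ballI)
  show "0 < Re x / 2" using assms by simp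
  show "summable (\<lambda>n. (norm x + Re x) * (norm x + Re x + 1) * real (Suc n) powr (- (Re x / 2 + 1)))"
    using assms by (intro summable_mult summable_Suc_powr) auto
  fix n y assume y: "y \<in> ball x (Re x / 2) \<inter> {s. Re s > 0}"
  then have d: "norm (x - y) < Re x / 2" by (auto simp: dist_norm)
  have "norm y \<le> norm x + norm (x - y)" using norm_triangle_ineq4 [of x "x - y"] by simp
  then have ny: "norm y \<le> norm x + Re x" using d assms by linarith
  have nyy: "norm (y - 1) \<le> norm y + 1" using norm_triangle_ineq4 [of y 1] by simp
  have "Re (x - y) \<le> norm (x - y)" by (rule complex_Re_le_cmod)
  then have re: "Re y \<ge> Re x / 2" using d by simp
  have "norm (zeta_term n y) \<le> norm y * norm (y - 1) * real (Suc n) powr (- (Re y + 1))"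
    using y by (intro norm_zeta_term_le) auto
  also have "\<dots> \<le> (norm x + Re x) * (norm x + Re x + 1) * real (Suc n) powr (- (Re x / 2 + 1))"
    using ny nyy re assms by (intro mult_mono powr_mono) auto
  finally show "norm (zeta_term n y) \<le> (norm x + Re x) * (norm x + Re x + 1) * real (Suc n) powr (- (Re x / 2 + 1))" .
qed

lemma zeta_reg_holomorphic: "zeta_reg holomorphic_on {s. Re s > 0}"
  and zeta_term_summable: "Re s > 0 \<Longrightarrow> summable (\<lambda>n. zeta_term n s)"
proof -
  have o: "open {s. Re s > 0}" by (simp add: open_halfspace_Re_gt)
  show "zeta_reg holomorphic_on {s. Re s > 0}"
    unfolding zeta_reg_def
    by (intro holomorphic_intros holomorphic_on_suminf [OF o zeta_term_holomorphic] zeta_term_bound_local) auto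
  show "Re s > 0 \<Longrightarrow> summable (\<lambda>n. zeta_term n s)"
    by (intro holomorphic_on_suminf(2) [OF o zeta_term_holomorphic] zeta_term_bound_local) auto
qed

lemma zeta_summable:
  assumes "Re s > 1"
  shows "summable (\<lambda>n. of_nat (Suc n) powr (- s) :: complex)"
proof (rule summable_norm_cancel)
  show "summable (\<lambda>n. norm (of_nat (Suc n) powr (- s) :: complex))"
    using summable_Suc_powr [OF assms] by (simp add: norm_of_nat_powr del: of_nat_Suc)
qed

lemma zeta_reg_eq_sum:
  assumes s: "Re s > 1"
  shows "zeta_reg s = (s - 1) * (\<Sum>n. of_nat (Suc n) powr (- s))"
proof -
  have "(\<lambda>n. of_nat (Suc n) powr (1 - s) :: complex) \<longlonglongrightarrow> 0"
  proof (rule tendsto_norm_zero_cancel)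
    have "(\<lambda>n. real (Suc n) powr (1 - Re s)) \<longlonglongrightarrow> 0"
      using s by real_asymp
    then show "(\<lambda>n. norm (of_nat (Suc n) powr (1 - s) :: complex)) \<longlonglongrightarrow> 0"
      by (simp add: norm_of_nat_powr del: of_nat_Suc)
  qed
  from telescope_sums [OF this]
  have "(\<lambda>n. of_nat (Suc (Suc n)) powr (1 - s) - of_nat (Suc n) powr (1 - s) :: complex) sums (0 - 1)"
    by simp
  moreover have "(\<lambda>n. (s - 1) * of_nat (Suc n) powr (- s)) sums ((s - 1) * (\<Sum>n. of_nat (Suc n) powr (- s)))"
    by (intro sums_mult summable_sums zeta_summable s)
  ultimately have "(\<lambda>n. zeta_term n s) sums ((s - 1) * (\<Sum>n. of_nat (Suc n) powr (- s)) + (0 - 1))"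
    unfolding zeta_term_def by (intro sums_add)
  then show ?thesis by (simp add: zeta_reg_def sums_iff)
qed

text \<open>For Re s >= 1/2 the terms are at most |s| |s - 1| n powr (-3/2), so the growth is
  quadratic. The inequality is strict so that the real part built from it in
  \<open>zeta_positive_real_part\<close> is positive.\<close>

lemma norm_zeta_reg_le: "\<exists>M>0. \<forall>s. Re s \<ge> 1/2 \<longrightarrow> norm (zeta_reg s) < M * (norm (s + 1))^2"
proof -
  define Z where "Z = (\<Sum>n. real (Suc n) powr (- (3/2)))"
  have sm: "summable (\<lambda>n. real (Suc n) powr (- (3/2)))" by (rule summable_Suc_powr) simp
  have Z0: "Z \<ge> 0" unfolding Z_def using sm by (intro suminf_nonneg) auto
  show ?thesis
  proof (intro exI [of _ "2 + Z"] conjI allI impI)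
    show "2 + Z > 0" using Z0 by simp
    fix s assume s: "Re s \<ge> 1/2"
    have sq: "norm s \<le> norm (s + 1)" "norm (s - 1) \<le> norm (s + 1)"
      using s by (auto simp: norm_complex_def power2_eq_square algebra_simps)
    have one: "1 \<le> norm (s + 1)"
      using complex_Re_le_cmod [of "s + 1"] s by simp
    have b: "norm (zeta_term n s) \<le> norm s * norm (s - 1) * real (Suc n) powr (- (3/2))" for n
    proof -
      have "norm (zeta_term n s) \<le> norm s * norm (s - 1) * real (Suc n) powr (- (Re s + 1))"
        using s by (intro norm_zeta_term_le) auto
      also have "\<dots> \<le> norm s * norm (s - 1) * real (Suc n) powr (- (3/2))"
        using s by (intro mult_left_mono powr_mono) auto
      finally show ?thesis .
    qed
    have "norm (\<Sum>n. zeta_term n s) \<le> (\<Sum>n. norm s * norm (s - 1) * real (Suc n) powr (- (3/2)))"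
      by (intro norm_suminf_le b summable_mult sm)
    also have "\<dots> = norm s * norm (s - 1) * Z"
      unfolding Z_def by (intro suminf_mult sm)
    also have "\<dots> \<le> norm (s + 1) * norm (s + 1) * Z"
      using sq Z0 by (intro mult_mono) auto
    finally have "norm (zeta_reg s) \<le> 1 + norm (s + 1) * norm (s + 1) * Z"
      unfolding zeta_reg_def using norm_triangle_ineq [of 1 "\<Sum>n. zeta_term n s"] by simp
    moreover have "1 * 1 \<le> norm (s + 1) * norm (s + 1)" using one by (intro mult_mono) auto
    ultimately show "norm (zeta_reg s) < (2 + Z) * (norm (s + 1))^2"
      by (simp add: power2_eq_square algebra_simps)
  qed
qed

text \<open>At s = 1/2 the series is real. By sqrt (a + 1) - sqrt a >= 1 / (2 sqrt (a + 1)) its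
  terms dominate a telescoping series with sum -1/2, so the value is at least 1/2.\<close>

lemma zeta_reg_half: "zeta_reg (1/2) \<noteq> 0"
proof -
  define v where "v n = - (1/2) * real (Suc n) powr (- (1/2)) + real (Suc (Suc n)) powr (1/2) - real (Suc n) powr (1/2)" for n
  have v: "zeta_term n (1/2) = of_real (v n)" for n
  proof -
    have "complex_of_real (real m powr a) = of_nat m powr of_real a" for m a
      by (subst powr_of_real [symmetric]) auto
    from this[of "Suc n" "-(1/2)"] this[of "Suc n" "1/2"] this[of "Suc (Suc n)" "1/2"]
    show ?thesis unfolding zeta_term_def v_def by (simp del: of_nat_Suc)
  qed
  have lim: "(\<lambda>n. 1/2 * real (Suc n) powr (- (1/2))) \<longlonglongrightarrow> 0" by real_asymp
  have tel: "(\<lambda>n. 1/2 * real (Suc (Suc n)) powr (- (1/2)) - 1/2 * real (Suc n) powr (- (1/2))) sums (0 - 1/2)"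
    using telescope_sums [OF lim] by simp
  have ge: "1/2 * real (Suc (Suc n)) powr (- (1/2)) - 1/2 * real (Suc n) powr (- (1/2)) \<le> v n" for n
  proof -
    define a where "a = real (Suc n)"
    have a: "a > 0" by (simp add: a_def)
    have "sqrt (a + 1) - sqrt a \<ge> 1/2 * (1 / sqrt (a + 1))"
    proof -
      have "(sqrt (a + 1) - sqrt a) * (2 * sqrt (a + 1)) - 1 = (sqrt (a + 1) - sqrt a)^2"
        using a by (simp add: power2_diff) (simp add: algebra_simps)
      then have "(sqrt (a + 1) - sqrt a) * (2 * sqrt (a + 1)) \<ge> 1"
        by (smt (verit) zero_le_power2)
      then show ?thesis using a by (simp add: divide_simps mult_ac)
    qed
    moreover have "real (Suc (Suc n)) = a + 1" by (simp add: a_def)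
    ultimately show ?thesis using a unfolding v_def a_def [symmetric]
      by (simp add: powr_minus powr_half_sqrt inverse_eq_divide add.commute)
  qed
  have "summable v"
    using zeta_term_summable [of "1/2"] by (simp add: v summable_of_real_iff)
  then have "(\<Sum>n. v n) \<ge> 0 - 1/2"
    by (intro sums_le [OF ge tel] summable_sums)
  then have "1 + (\<Sum>n. v n) \<noteq> 0" by simp
  moreover have "zeta_reg (1/2) = of_real (1 + (\<Sum>n. v n))"
    unfolding zeta_reg_def v using \<open>summable v\<close> by (simp add: suminf_of_real)
  ultimately show ?thesis by (metis of_real_eq_0_iff)
qed

subsection \<open>The analytic continuation of the zeta function\<close>

text \<open>Up to the sign (-1)^m this is the m-th forward difference of z powr (- s) with step
  1.\<close>

fun alt_diff :: "nat \<Rightarrow> complex \<Rightarrow> complex \<Rightarrow> complex" where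
  "alt_diff 0 s z = z powr (- s)"
| "alt_diff (Suc m) s z = alt_diff m s z - alt_diff m s (z + 1)"

lemma alt_diff_deriv:
  "Re z > 0 \<Longrightarrow> (alt_diff m s has_field_derivative (- s * alt_diff m (s + 1) z)) (at z)"
proof (induction m arbitrary: z)
  case 0
  then have "z \<notin> \<real>\<^sub>\<le>\<^sub>0" by (auto simp: complex_nonpos_Reals_iff)
  from has_field_derivative_powr [OF this, of "- s"]
  have "((\<lambda>z. z powr (- s)) has_field_derivative (- s * alt_diff 0 (s + 1) z)) (at z)"
    by simp
  moreover have "alt_diff 0 s = (\<lambda>z. z powr (- s))" by (rule ext) simp
  ultimately show ?case by simp
next
  case (Suc m)
  have "((\<lambda>z. alt_diff m s (z + 1)) has_field_derivative (- s * alt_diff m (s + 1) (z + 1))) (at z)"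
    using Suc.IH [of "z + 1"] Suc.prems by (subst DERIV_shift [symmetric]) simp
  from DERIV_diff [OF Suc.IH [OF Suc.prems] this]
  have "((\<lambda>z. alt_diff m s z - alt_diff m s (z + 1)) has_field_derivative (- s * alt_diff (Suc m) (s + 1) z)) (at z)"
    by (simp add: algebra_simps)
  moreover have "alt_diff (Suc m) s = (\<lambda>z. alt_diff m s z - alt_diff m s (z + 1))" by (rule ext) simp
  ultimately show ?case by simp
qed

text \<open>A difference is bounded by a derivative through the mean value inequality, and the
  derivative is again an \<open>alt_diff\<close>, with \<open>s + 1\<close> for \<open>s\<close>.
  Hence the induction is over all \<open>s\<close>, and every difference gains one power of
  x.\<close>

lemma norm_alt_diff_le:
  "x \<ge> 1 \<Longrightarrow> Re s + real m \<ge> 0 \<Longrightarrow>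
     norm (alt_diff m s (of_real x)) \<le> (norm s + real m) ^ m * x powr (- (Re s + real m))"
proof (induction m arbitrary: s x)
  case 0
  then show ?case by (simp add: norm_powr_real_powr)
next
  case (Suc m)
  define S where "S = closed_segment (complex_of_real x) (of_real (x + 1))"
  define B where "B = norm s * ((norm (s + 1) + real m) ^ m * x powr (- (Re s + real (Suc m))))"
  have seg: "\<exists>r. z = of_real r \<and> x \<le> r" if "z \<in> S" for z
  proof -
    have "z \<in> complex_of_real ` closed_segment x (x + 1)"
      using that unfolding S_def closed_segment_of_real .
    then show ?thesis by (auto simp: closed_segment_eq_real_ivl)
  qed
  have "norm (alt_diff m s (of_real (x + 1)) - alt_diff m s (of_real x))
      \<le> B * norm (complex_of_real (x + 1) - of_real x)"
  proof (rule field_differentiable_bound [of S])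
    show "convex S" by (simp add: S_def)
    fix z assume z: "z \<in> S"
    obtain r where r: "z = of_real r" "x \<le> r" using seg z by blast
    then have "Re z > 0" using Suc.prems by simp
    then show "(alt_diff m s has_field_derivative (- s * alt_diff m (s + 1) z)) (at z within S)"
      by (rule has_field_derivative_at_within [OF alt_diff_deriv])
    have "norm (alt_diff m (s + 1) z) \<le> (norm (s + 1) + real m) ^ m * r powr (- (Re (s + 1) + real m))"
      unfolding r using Suc.prems r by (intro Suc.IH) auto
    also have "\<dots> \<le> (norm (s + 1) + real m) ^ m * x powr (- (Re (s + 1) + real m))"
      using r Suc.prems by (intro mult_left_mono powr_mono2') auto
    also have "Re (s + 1) + real m = Re s + real (Suc m)" by simp
    finally show "norm (- s * alt_diff m (s + 1) z) \<le> B"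
      unfolding B_def by (simp add: norm_mult mult_left_mono)
  qed (auto simp: S_def)
  also have "norm (complex_of_real (x + 1) - of_real x) = 1" by simp
  also have "B * 1 \<le> (norm s + real (Suc m)) ^ Suc m * x powr (- (Re s + real (Suc m)))"
  proof -
    have "norm (s + 1) \<le> norm s + 1" using norm_triangle_ineq [of s 1] by simp
    then have "(norm (s + 1) + real m) ^ m \<le> (norm s + real (Suc m)) ^ m" by (intro power_mono) auto
    then have "norm s * (norm (s + 1) + real m) ^ m \<le> (norm s + real (Suc m)) * (norm s + real (Suc m)) ^ m"
      by (intro mult_mono) auto
    from mult_right_mono [OF this, of "x powr (- (Re s + real (Suc m)))"]
    show ?thesis unfolding B_def by (simp add: mult_ac)
  qed
  finally show ?case by (simp add: norm_minus_commute)
qed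

lemma norm_alt_diff_nat_le:
  assumes "Re s + real m \<ge> 0"
  shows "norm (alt_diff m s (of_nat (Suc n))) \<le> (norm s + real m) ^ m * real (Suc n) powr (- (Re s + real m))"
  using norm_alt_diff_le [OF _ assms, of "real (Suc n)"] by (simp del: of_nat_Suc)

text \<open>Averaging the partial sums of the alternating series \<open>m\<close> times gains \<open>m\<close> powers of decay.\<close>

definition eta_avg :: "nat \<Rightarrow> complex \<Rightarrow> complex" where
  "eta_avg m s = (\<Sum>j<m. alt_diff j s 1 / 2 ^ Suc j) + (\<Sum>n. (-1) ^ n * alt_diff m s (of_nat (Suc n))) / 2 ^ m"

text \<open>The number of averagings grows with |s| so that \<open>Re s + m > 1\<close> and the
  remaining series converges; by \<open>eta_eq\<close> every larger number gives the same
  value.\<close>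

definition eta :: "complex \<Rightarrow> complex" where
  "eta s = eta_avg (nat \<lceil>norm s\<rceil> + 2) s"

lemma alt_diff_summable:
  assumes "Re s + real m > 1"
  shows "summable (\<lambda>n. (-1) ^ n * alt_diff m s (of_nat (Suc n)))"
proof (rule summable_comparison_test [OF exI])
  show "\<forall>n\<ge>0. norm ((-1) ^ n * alt_diff m s (of_nat (Suc n))) \<le> (norm s + real m) ^ m * real (Suc n) powr (- (Re s + real m))"
    using norm_alt_diff_nat_le [of s m] assms by (simp add: norm_mult norm_power del: of_nat_Suc)
  show "summable (\<lambda>n. (norm s + real m) ^ m * real (Suc n) powr (- (Re s + real m)))"
    using assms by (intro summable_mult summable_Suc_powr) auto
qed

text \<open>One step of Euler's transformation: if A is the alternating sum of the a_n, the
  alternating sum of a_n - a_(n+1) is 2 A - a_0, so A is a_0 / 2 plus half of the latter.\<close>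

lemma eta_avg_Suc:
  assumes "Re s + real m > 1"
  shows "eta_avg (Suc m) s = eta_avg m s"
proof -
  define a where "a n = alt_diff m s (of_nat (Suc n))" for n
  define A where "A = (\<Sum>n. (-1) ^ n * a n)"
  have sm: "(\<lambda>n. (-1) ^ n * a n) sums A"
    unfolding a_def A_def using alt_diff_summable [OF assms] by (intro summable_sums)
  then have "(\<lambda>n. (-1) ^ Suc n * a (Suc n)) sums (A - a 0)"
    by (subst sums_Suc_iff) simp
  from sums_add [OF sm this]
  have "(\<lambda>n. (-1) ^ n * alt_diff (Suc m) s (of_nat (Suc n))) sums (A + (A - a 0))"
    by (simp add: a_def algebra_simps)
  then have S2: "(\<Sum>n. (-1) ^ n * alt_diff (Suc m) s (of_nat (Suc n))) = A + (A - a 0)"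
    by (rule sums_unique [symmetric])
  have A': "(\<Sum>n. (-1) ^ n * alt_diff m s (of_nat (Suc n))) = A"
    by (simp add: A_def a_def)
  show ?thesis
    unfolding eta_avg_def S2 A' by (simp add: a_def field_simps)
qed

lemma eta_eq:
  assumes "real m \<ge> norm s + 2"
  shows "eta s = eta_avg m s"
proof -
  define k where "k = nat \<lceil>norm s\<rceil> + 2"
  have eq: "eta_avg (k + j) s = eta_avg k s" for j
  proof (induction j)
    case (Suc j)
    have "real (k + j) \<ge> norm s + 2" unfolding k_def by linarith
    then have "Re s + real (k + j) > 1"
      using abs_Re_le_cmod [of s] by linarith
    from eta_avg_Suc [OF this] Suc show ?case by simp
  qed simp
  have "\<lceil>norm s\<rceil> \<le> int m - 2" using assms by (simp add: ceiling_le_iff)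
  moreover have "real m \<ge> 2" using assms norm_ge_zero [of s] by linarith
  ultimately have "k \<le> m" unfolding k_def by linarith
  then have "eta_avg m s = eta_avg k s" using eq [of "m - k"] by simp
  then show ?thesis by (simp add: eta_def k_def)
qed

lemma alt_diff_holomorphic: "Re z > 0 \<Longrightarrow> (\<lambda>s. alt_diff m s z) holomorphic_on A"
proof (induction m arbitrary: z)
  case 0
  then have "z \<noteq> 0" by auto
  then have "(\<lambda>s. alt_diff 0 s z) = (\<lambda>s. exp (- s * ln z))" by (simp add: powr_def)
  then show ?case by (auto intro!: holomorphic_intros)
next
  case (Suc m)
  then show ?case by (auto intro!: holomorphic_intros)
qed

text \<open>The number of averagings in \<open>eta s\<close> jumps with |s|. On a ball one number
  serves all points, and \<open>eta_eq\<close> identifies the result with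
  \<open>eta\<close>.\<close>

lemma eta_holomorphic: "eta holomorphic_on UNIV"
proof -
  have "eta holomorphic_on ball 0 R" if "R > 0" for R
  proof -
    define M where "M = nat \<lceil>R\<rceil> + 2"
    have M: "real M \<ge> R + 2" unfolding M_def by linarith
    have "(\<lambda>s. \<Sum>n. (-1) ^ n * alt_diff M s (of_nat (Suc n))) holomorphic_on ball 0 R"
    proof (rule holomorphic_on_suminf(1))
      show "(\<lambda>s. (-1) ^ n * alt_diff M s (of_nat (Suc n))) holomorphic_on ball 0 R" for n
        by (intro holomorphic_intros alt_diff_holomorphic) auto
      fix x :: complex
      show "\<exists>d h. 0 < d \<and> summable h \<and>
          (\<forall>n. \<forall>y\<in>ball x d \<inter> ball 0 R. norm ((-1) ^ n * alt_diff M y (of_nat (Suc n))) \<le> h n)"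
      proof (intro exI conjI allI ballI)
        show "(0::real) < 1" by simp
        show "summable (\<lambda>n. (R + real M) ^ M * real (Suc n) powr (- 2))"
          by (intro summable_mult summable_Suc_powr) auto
        fix n y assume "y \<in> ball x 1 \<inter> ball 0 R"
        then have y: "norm y < R" by simp
        then have re: "Re y + real M \<ge> 2" using abs_Re_le_cmod [of y] M by linarith
        have "norm ((-1) ^ n * alt_diff M y (of_nat (Suc n))) = norm (alt_diff M y (of_nat (Suc n)))"
          by (simp add: norm_mult norm_power)
        also have "\<dots> \<le> (norm y + real M) ^ M * real (Suc n) powr (- (Re y + real M))"
          using re by (intro norm_alt_diff_nat_le) auto
        also have "\<dots> \<le> (R + real M) ^ M * real (Suc n) powr (- 2)"
          using re y that by (intro mult_mono power_mono powr_mono zero_le_power) auto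
        finally show "norm ((-1) ^ n * alt_diff M y (of_nat (Suc n))) \<le> (R + real M) ^ M * real (Suc n) powr (- 2)" .
      qed
    qed simp
    then have "eta_avg M holomorphic_on ball 0 R"
      unfolding eta_avg_def by (intro holomorphic_intros alt_diff_holomorphic) auto
    moreover have "eta_avg M s = eta s" if "s \<in> ball 0 R" for s
      using that M by (intro eta_eq [symmetric]) auto
    ultimately show ?thesis by (rule holomorphic_transform)
  qed
  then have "eta field_differentiable (at s)" for s
    by (rule holomorphic_on_imp_differentiable_at [of _ "ball 0 (norm s + 1)"])
       (auto simp: add_nonneg_pos)
  then show ?thesis
    by (simp add: holomorphic_on_def field_differentiable_at_within)
qed

text \<open>The full series minus the alternating one is twice the sum over the even integers, that
  is 2 powr (1 - s) times the full series. Grouping in pairs makes this a termwise identity; with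
  indices shifted by one, the even integers sit at odd indices.\<close>

lemma eta_eq_zeta:
  assumes s: "Re s > 1"
  shows "eta s = (1 - 2 powr (1 - s)) * (\<Sum>n. of_nat (Suc n) powr (- s))"
proof -
  define a :: "nat \<Rightarrow> complex" where "a n = of_nat (Suc n) powr (- s)" for n
  define Z where "Z = (\<Sum>n. a n)"
  have a: "a sums Z"
    unfolding a_def Z_def using zeta_summable [OF s] by (intro summable_sums)
  have eq: "eta_avg m s = eta_avg 0 s" for m
    by (induction m) (use s in \<open>auto simp: eta_avg_Suc\<close>)
  have "eta s = (\<Sum>n. (-1) ^ n * a n)"
    using eq [of "nat \<lceil>norm s\<rceil> + 2"] by (simp add: eta_def eta_avg_def a_def)
  have sA: "(\<lambda>n. (-1) ^ n * a n) sums eta s"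
  proof -
    have "summable (\<lambda>n. (-1) ^ n * a n)"
      using alt_diff_summable [of s 0] s by (simp add: a_def)
    then show ?thesis using \<open>eta s = _\<close> by (simp add: sums_iff)
  qed
  have e1: "{n * 2..<n * 2 + 2} = {2 * n, Suc (2 * n)}" for n :: nat by auto
  have "(\<lambda>n. (-1) ^ (2 * n) * a (2 * n) + (-1) ^ Suc (2 * n) * a (Suc (2 * n))) sums eta s"
    using sums_group [OF sA, of 2] unfolding e1 by simp
  moreover have "(\<lambda>n. a (2 * n) + a (Suc (2 * n))) sums Z"
    using sums_group [OF a, of 2] unfolding e1 by simp
  ultimately have "(\<lambda>n. (a (2 * n) + a (Suc (2 * n))) - ((-1) ^ (2 * n) * a (2 * n) + (-1) ^ Suc (2 * n) * a (Suc (2 * n)))) sums (Z - eta s)"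
    by (intro sums_diff)
  moreover have "(a (2 * n) + a (Suc (2 * n))) - ((-1) ^ (2 * n) * a (2 * n) + (-1) ^ Suc (2 * n) * a (Suc (2 * n)))
      = 2 powr (1 - s) * a n" for n
  proof -
    have "a (Suc (2 * n)) = of_real (2 * real (Suc n)) powr (- s)"
      unfolding a_def by (simp add: algebra_simps)
    also have "\<dots> = 2 powr (- s) * a n"
      unfolding a_def using powr_times_real_left [of 2 "of_nat (Suc n)" "- s"]
      by (simp del: of_nat_Suc)
    finally show ?thesis by (simp add: powr_diff powr_minus divide_simps)
  qed
  ultimately have "(\<lambda>n. 2 powr (1 - s) * a n) sums (Z - eta s)" by simp
  moreover have "(\<lambda>n. 2 powr (1 - s) * a n) sums (2 powr (1 - s) * Z)"
    by (intro sums_mult a)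
  ultimately have "Z - eta s = 2 powr (1 - s) * Z" by (rule sums_unique2)
  then show ?thesis unfolding Z_def [symmetric] a_def [symmetric] by (simp add: algebra_simps)
qed

lemma two_powr_neq_one:
  assumes "Re s < 1"
  shows "1 - 2 powr (1 - s) \<noteq> 0"
proof
  assume "1 - 2 powr (1 - s) = (0 :: complex)"
  then have "norm (2 powr (1 - s) :: complex) = 1" by simp
  moreover have "norm (2 powr (1 - s) :: complex) = 2 powr (1 - Re s)"
    by (subst norm_powr_real_powr) auto
  moreover have "2 powr (1 - Re s) > 2 powr (0 :: real)"
    using assms by (subst powr_less_cancel_iff) auto
  ultimately show False by simp
qed

lemma zeta_reg_eta:
  assumes "Re s > 0"
  shows "(1 - 2 powr (1 - s)) * zeta_reg s = (s - 1) * eta s"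
proof (rule analytic_continuation_open [of "{s. Re s > 1}" "{s. Re s > 0}" _ _ s])
  show "{s. Re s > 1} \<noteq> {}" by (auto intro: exI [of _ 2])
  show "connected {s. Re s > 0}" by (simp add: convex_connected convex_halfspace_Re_gt)
  have p: "(2 :: complex) powr (1 - s) = exp ((1 - s) * ln 2)" for s by (simp add: powr_def)
  show "(\<lambda>s. (1 - 2 powr (1 - s)) * zeta_reg s) holomorphic_on {s. 0 < Re s}"
    unfolding p by (intro holomorphic_intros zeta_reg_holomorphic)
  show "(\<lambda>s. (s - 1) * eta s) holomorphic_on {s. 0 < Re s}"
    by (intro holomorphic_intros holomorphic_on_subset [OF eta_holomorphic]) auto
  show "(1 - 2 powr (1 - z)) * zeta_reg z = (z - 1) * eta z" if "z \<in> {s. 1 < Re s}" for z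
    using that by (simp add: zeta_reg_eq_sum eta_eq_zeta)
qed (use assms in \<open>auto simp: open_halfspace_Re_gt\<close>)

text \<open>\<open>riemann_zeta\<close> meets its specification only once some function does. The
  quotient of \<open>zeta_reg\<close> serves for Re s > 0, that of \<open>eta\<close> for Re s < 1,
  where 1 - 2 powr (1 - s) has no zeros; they agree on the common strip and together cover all
  points except 1.\<close>

lemma riemann_zeta_props:
  "riemann_zeta holomorphic_on (- {1})"
  "Re s > 1 \<Longrightarrow> (\<lambda>n. of_nat (Suc n) powr (- s)) sums riemann_zeta s"
proof -
  define Z where "Z s = (if Re s > 0 then zeta_reg s / (s - 1) else eta s / (1 - 2 powr (1 - s)))" for s
  have Z2: "Z s = eta s / (1 - 2 powr (1 - s))" if "Re s < 1" for s
  proof (cases "Re s > 0")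
    case True
    have "s \<noteq> 1" using that by auto
    with two_powr_neq_one [OF that] zeta_reg_eta [OF True] show ?thesis
      by (simp add: Z_def True divide_simps mult_ac)
  qed (simp add: Z_def)
  have p: "(2 :: complex) powr (1 - s) = exp ((1 - s) * ln 2)" for s by (simp add: powr_def)
  have h1: "Z holomorphic_on {s. Re s > 0} - {1}"
  proof (rule holomorphic_transform)
    show "(\<lambda>s. zeta_reg s / (s - 1)) holomorphic_on {s. Re s > 0} - {1}"
      by (intro holomorphic_intros holomorphic_on_subset [OF zeta_reg_holomorphic]) auto
  qed (auto simp: Z_def)
  have h2: "Z holomorphic_on {s. Re s < 1}"
  proof (rule holomorphic_transform)
    show "(\<lambda>s. eta s / (1 - 2 powr (1 - s))) holomorphic_on {s. Re s < 1}"
      using two_powr_neq_one unfolding p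
      by (intro holomorphic_intros holomorphic_on_subset [OF eta_holomorphic]) auto
  qed (auto simp: Z2)
  have "Z holomorphic_on (({s. Re s > 0} - {1}) \<union> {s. Re s < 1})"
    using h1 h2 by (intro holomorphic_on_Un open_Diff) (auto simp: open_halfspace_Re_gt open_halfspace_Re_lt)
  moreover have "({s. Re s > 0} - {1}) \<union> {s. Re s < 1} = - {1}" by auto
  ultimately have "Z holomorphic_on (- {1})" by simp
  moreover have "(\<lambda>n. of_nat (Suc n) powr (- s)) sums Z s" if "Re s > 1" for s
  proof -
    have "s \<noteq> 1" using that by auto
    then have "Z s = (\<Sum>n. of_nat (Suc n) powr (- s))"
      using that by (simp add: Z_def zeta_reg_eq_sum)
    then show ?thesis using zeta_summable [OF that] by (simp add: sums_iff)
  qed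
  ultimately have "\<exists>f. f holomorphic_on (- {1}) \<and>
     (\<forall>s. Re s > 1 \<longrightarrow> (\<lambda>n. of_nat (Suc n) powr (- s)) sums f s)" by blast
  from someI_ex [OF this, folded riemann_zeta_def]
  show "riemann_zeta holomorphic_on (- {1})"
    "Re s > 1 \<Longrightarrow> (\<lambda>n. of_nat (Suc n) powr (- s)) sums riemann_zeta s" by auto
qed

lemma zeta_reg_eq:
  assumes "Re s > 0" "s \<noteq> 1"
  shows "zeta_reg s = (s - 1) * riemann_zeta s"
proof (rule analytic_continuation_open [of "{s. Re s > 1}" "{s. Re s > 0} - {1}" _ _ s])
  show "{s. Re s > 1} \<noteq> {}" by (auto intro: exI [of _ 2])
  show "connected ({s. Re s > 0} - {1 :: complex})"
    by (intro connected_open_delete open_halfspace_Re_gt convex_connected convex_halfspace_Re_gt) auto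
  show "zeta_reg holomorphic_on {s. Re s > 0} - {1}"
    by (rule holomorphic_on_subset [OF zeta_reg_holomorphic]) auto
  show "(\<lambda>s. (s - 1) * riemann_zeta s) holomorphic_on {s. Re s > 0} - {1}"
    by (intro holomorphic_intros holomorphic_on_subset [OF riemann_zeta_props(1)]) auto
  show "zeta_reg z = (z - 1) * riemann_zeta z" if "z \<in> {s. 1 < Re s}" for z
    using that riemann_zeta_props(2) [of z] by (simp add: zeta_reg_eq_sum sums_iff)
qed (use assms in \<open>auto simp: open_halfspace_Re_gt open_Diff\<close>)

lemma zeta_reg_1: "zeta_reg 1 = 1"
  by (simp add: zeta_reg_def zeta_term_def del: of_nat_Suc)

lemma zeta_reg_nonzero:
  assumes RH: riemann_hypothesis and s: "Re s > 1/2"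
  shows "zeta_reg s \<noteq> 0"
proof (cases "s = 1")
  case False
  have "\<nexists>k::nat. k \<ge> 1 \<and> s = - 2 * of_nat k" using s by auto
  with RH s False have "riemann_zeta s \<noteq> 0" unfolding riemann_hypothesis_def by fastforce
  with False s zeta_reg_eq [of s] show ?thesis by simp
qed (simp add: zeta_reg_1)

text \<open>The terms from n = 2 on sum to at most pi^2 / 6 - 1, which is below 3/4, and |s - 1| >=
  1. This bounds - ln |zeta_reg| far to the right of the critical line.\<close>

lemma norm_zeta_reg_ge:
  assumes s: "Re s \<ge> 2"
  shows "norm (zeta_reg s) \<ge> 1/4"
proof -
  define a :: "nat \<Rightarrow> complex" where "a n = of_nat (Suc n) powr (- s)" for n
  have sm: "summable a" unfolding a_def using s by (intro zeta_summable) auto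
  have sq: "(\<lambda>n. 1 / real (Suc n) ^ 2) sums (pi\<^sup>2 / 6)" using inverse_squares_sums by simp
  then have sq1: "(\<lambda>n. 1 / real (Suc (Suc n)) ^ 2) sums (pi\<^sup>2 / 6 - 1)"
    by (subst sums_Suc_iff) simp
  have le: "norm (a (Suc n)) \<le> 1 / real (Suc (Suc n)) ^ 2" for n
  proof -
    have "norm (a (Suc n)) = real (Suc (Suc n)) powr (- Re s)"
      unfolding a_def by (subst norm_of_nat_powr) simp
    also have "\<dots> \<le> real (Suc (Suc n)) powr (- 2)" using s by (intro powr_mono) auto
    finally show ?thesis by (simp add: powr_minus powr_numeral inverse_eq_divide del: of_nat_Suc)
  qed
  have "norm (\<Sum>n. a (Suc n)) \<le> (\<Sum>n. 1 / real (Suc (Suc n)) ^ 2)"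
    by (intro norm_suminf_le le sums_summable [OF sq1])
  also have "\<dots> = pi\<^sup>2 / 6 - 1" using sq1 by (simp add: sums_iff)
  also have "\<dots> \<le> 3/4"
  proof -
    have "pi \<le> 3.2" using pi_approx by simp
    then have "pi\<^sup>2 \<le> 3.2\<^sup>2" by (intro power_mono) auto
    then show ?thesis by (simp add: power2_eq_square)
  qed
  finally have t: "norm (\<Sum>n. a (Suc n)) \<le> 3/4" .
  have "suminf a = 1 + (\<Sum>n. a (Suc n))"
    using suminf_split_head [OF sm] by (simp add: a_def)
  then have "norm (suminf a) \<ge> 1/4"
    using t norm_triangle_ineq4 [of "suminf a" "\<Sum>n. a (Suc n)"] by simp
  moreover have "norm (s - 1) \<ge> 1" using complex_Re_le_cmod [of "s - 1"] s by simp
  ultimately have "1 * (1/4) \<le> norm (s - 1) * norm (suminf a)" by (intro mult_mono) auto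
  moreover have "zeta_reg s = (s - 1) * suminf a"
    unfolding a_def using s by (intro zeta_reg_eq_sum) auto
  ultimately show ?thesis by (simp add: norm_mult)
qed

subsection \<open>The logarithmic derivative\<close>

lemma ln_le_2_sqrt: "x > 0 \<Longrightarrow> ln x \<le> 2 * sqrt x"
  using ln_le_minus_one [of "sqrt x"] by (simp add: ln_sqrt)

lemma deriv_of_nat_powr:
  fixes s :: complex
  shows "deriv (\<lambda>s. of_nat (Suc n) powr (- s)) s = - of_real (ln (Suc n)) * of_nat (Suc n) powr (- s)"
proof (rule DERIV_imp_deriv)
  have "((\<lambda>s. exp (- s * of_real (ln (Suc n)))) has_field_derivative - of_real (ln (Suc n)) * exp (- s * of_real (ln (Suc n)))) (at s)"
    by (auto intro!: derivative_eq_intros)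
  then show "((\<lambda>s. of_nat (Suc n) powr (- s)) has_field_derivative - of_real (ln (Suc n)) * of_nat (Suc n) powr (- s)) (at s)"
    unfolding powr_def by (simp add: Ln_of_nat del: of_nat_Suc)
qed

text \<open>\<open>Re s >= 2\<close> leaves room for the crude bound ln n <= 2 sqrt n; the Perron
  integral starts on the line Re w = 2.\<close>

lemma mangoldt_powr_summable:
  assumes "Re s \<ge> 2"
  shows "summable (\<lambda>n. norm (mangoldt (Suc n) * of_nat (Suc n) powr (- s) :: complex))"
proof (rule summable_comparison_test [OF exI])
  show "summable (\<lambda>n. 2 * real (Suc n) powr (- (3/2)))"
    by (intro summable_mult summable_Suc_powr) auto
  show "\<forall>n\<ge>0. norm (norm (mangoldt (Suc n) * of_nat (Suc n) powr (- s) :: complex)) \<le> 2 * real (Suc n) powr (- (3/2))"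
  proof (intro allI impI)
    fix n
    have "mangoldt (Suc n) \<le> ln (real (Suc n))" by (rule mangoldt_le) simp
    also have "\<dots> \<le> 2 * sqrt (real (Suc n))" by (rule ln_le_2_sqrt) simp
    also have "\<dots> = 2 * real (Suc n) powr (1/2)" by (simp add: powr_half_sqrt)
    finally have *: "mangoldt (Suc n) \<le> 2 * real (Suc n) powr (1/2)" .
    have "norm (norm (mangoldt (Suc n) * of_nat (Suc n) powr (- s) :: complex)) = mangoldt (Suc n) * real (Suc n) powr (- Re s)"
      by (simp add: norm_mult norm_of_nat_powr abs_mult mangoldt_nonneg del: of_nat_Suc)
    also have "\<dots> \<le> (2 * real (Suc n) powr (1/2)) * real (Suc n) powr (- 2)"
      using * assms by (intro mult_mono powr_mono) auto
    also have "\<dots> = 2 * (real (Suc n) powr (1/2 + - 2))" unfolding powr_add by simp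
    finally show "norm (norm (mangoldt (Suc n) * of_nat (Suc n) powr (- s) :: complex)) \<le> 2 * real (Suc n) powr (- (3/2))"
      by simp
  qed
qed

text \<open>Dirichlet convolution \<open>\<Lambda> * 1 = log\<close>.\<close>

lemma mangoldt_mult_zeta:
  fixes s :: complex
  assumes s: "Re s \<ge> 2"
  shows "(\<lambda>n. of_real (ln (Suc n)) * of_nat (Suc n) powr (- s)) sums
     ((\<Sum>n. mangoldt (Suc n) * of_nat (Suc n) powr (- s)) * (\<Sum>n. of_nat (Suc n) powr (- s)))"
proof -
  define u :: "nat \<Rightarrow> complex" where "u n = of_nat n powr (- s)" for n
  define a where "a n = mangoldt (Suc n) * u (Suc n)" for n
  define b where "b n = u (Suc n)" for n
  have u_mult: "u (m * k) = u m * u k" for m k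
  proof -
    have "(of_nat m * of_nat k :: complex) powr (- s) = of_nat m powr (- s) * of_nat k powr (- s)"
      using powr_times_real_left [of "of_nat m" "of_nat k" "- s"] by simp
    then show ?thesis by (simp add: u_def)
  qed
  have na: "summable (\<lambda>n. norm (a n))" unfolding a_def u_def using mangoldt_powr_summable [OF s] .
  have nb: "summable (\<lambda>n. norm (b n))" unfolding b_def u_def
    using summable_Suc_powr [of "Re s"] s by (simp add: norm_of_nat_powr del: of_nat_Suc)
  have ha: "(a has_sum suminf a) UNIV"
    by (intro norm_summable_imp_has_sum na summable_sums summable_norm_cancel [OF na])
  have hb: "(b has_sum suminf b) UNIV"
    by (intro norm_summable_imp_has_sum nb summable_sums summable_norm_cancel [OF nb])
  have "(\<lambda>(i, j). norm (a i * b j)) summable_on (UNIV \<times> UNIV)"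
  proof (rule summable_on_SigmaI)
    show "((\<lambda>j. case (i, j) of (i, j) \<Rightarrow> norm (a i * b j)) has_sum (norm (a i) * (\<Sum>j. norm (b j)))) UNIV" for i
    proof -
      have "((\<lambda>j. norm (b j)) has_sum (\<Sum>j. norm (b j))) UNIV"
        using nb by (intro norm_summable_imp_has_sum summable_sums) auto
      then show ?thesis by (simp add: norm_mult has_sum_cmult_right)
    qed
    have "(\<lambda>i. norm (a i)) summable_on UNIV"
      using na by (intro norm_summable_imp_summable_on) auto
    then show "(\<lambda>i. norm (a i) * (\<Sum>j. norm (b j))) summable_on UNIV"
      by (rule summable_on_cmult_left)
  qed auto
  then have "(\<lambda>(i, j). a i * b j) summable_on (UNIV \<times> UNIV)"
    using abs_summable_summable [of "\<lambda>(i, j). a i * b j" "UNIV \<times> UNIV"] by (simp add: case_prod_unfold)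
  moreover have "((\<lambda>j. case (i, j) of (i, j) \<Rightarrow> a i * b j) has_sum (a i * suminf b)) UNIV" for i
    using has_sum_cmult_right [OF hb, of "a i"] by simp
  moreover have "((\<lambda>i. a i * suminf b) has_sum (suminf a * suminf b)) UNIV"
    using has_sum_cmult_left [OF ha] .
  ultimately have prod: "((\<lambda>(i, j). a i * b j) has_sum (suminf a * suminf b)) (UNIV \<times> UNIV)"
    by (intro has_sum_SigmaI)
  \<comment> \<open>The double series over pairs of factors is reindexed by the product and its
    first factor as a divisor. Since \<open>a\<close> and \<open>b\<close> start at 0, all indices
    are shifted by one.\<close>
  have "((\<lambda>(n, d). mangoldt d * u (Suc n)) has_sum (suminf a * suminf b)) (Sigma UNIV (\<lambda>n. {d. d dvd Suc n}))
    \<longleftrightarrow> ((\<lambda>(i, j). a i * b j) has_sum (suminf a * suminf b)) (UNIV \<times> UNIV)"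
  proof (rule has_sum_reindex_bij_witness
      [where j = "\<lambda>(n, d). (d - 1, Suc n div d - 1)" and i = "\<lambda>(i, j). (Suc i * Suc j - 1, Suc i)"])
    fix p assume "p \<in> Sigma UNIV (\<lambda>n. {d. d dvd Suc n})"
    then obtain n d where p: "p = (n, d)" "d dvd Suc n" by auto
    then obtain k where k: "Suc n = d * k" by auto
    then have d: "d > 0" "k > 0" by (auto intro: Nat.gr0I)
    have dk: "Suc n div d = k" using k d by simp
    show "(case case p of (n, d) \<Rightarrow> (d - 1, Suc n div d - 1) of (i, j) \<Rightarrow> (Suc i * Suc j - 1, Suc i)) = p"
      using d k by (simp add: p dk del: mult_Suc mult_Suc_right)
    show "(case case p of (n, d) \<Rightarrow> (d - 1, Suc n div d - 1) of (i, j) \<Rightarrow> a i * b j) = (case p of (n, d) \<Rightarrow> mangoldt d * u (Suc n))"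
      using d by (simp add: p dk a_def b_def) (simp add: k u_mult)
  next
    fix p :: "nat \<times> nat"
    obtain i j where p: "p = (i, j)" by fastforce
    show "(case case p of (i, j) \<Rightarrow> (Suc i * Suc j - 1, Suc i) of (n, d) \<Rightarrow> (d - 1, Suc n div d - 1)) = p"
      by (simp add: p del: mult_Suc mult_Suc_right)
    show "(case p of (i, j) \<Rightarrow> (Suc i * Suc j - 1, Suc i)) \<in> Sigma UNIV (\<lambda>n. {d. d dvd Suc n})"
      by (simp add: p del: mult_Suc mult_Suc_right)
  qed auto
  with prod have "((\<lambda>(n, d). mangoldt d * u (Suc n)) has_sum (suminf a * suminf b)) (Sigma UNIV (\<lambda>n. {d. d dvd Suc n}))"
    by simp
  then have "((\<lambda>n. of_real (ln (Suc n)) * u (Suc n)) has_sum (suminf a * suminf b)) UNIV"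
  proof (rule has_sum_Sigma')
    fix n
    have "((\<lambda>d. mangoldt d * u (Suc n)) has_sum (\<Sum>d | d dvd Suc n. mangoldt d * u (Suc n))) {d. d dvd Suc n}"
      by (rule has_sum_finite) simp
    also have "(\<Sum>d | d dvd Suc n. mangoldt d * u (Suc n)) = of_real (ln (Suc n)) * u (Suc n)"
      unfolding sum_distrib_right [symmetric] by (subst mangoldt_sum) auto
    finally show "((\<lambda>d. case (n, d) of (n, d) \<Rightarrow> mangoldt d * u (Suc n)) has_sum of_real (ln (Suc n)) * u (Suc n)) {d. d dvd Suc n}"
      by simp
  qed
  from has_sum_imp_sums [OF this] show ?thesis unfolding u_def a_def b_def .
qed

text \<open>\<open>zeta_reg\<close> is s - 1 times the Dirichlet series D, so its logarithmic
  derivative is 1 / (s - 1) + D' / D. The convolution identity says D' = - A D, where A is the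
  series with coefficients \<open>mangoldt\<close>.\<close>

lemma zeta_log_deriv:
  assumes s: "Re s \<ge> 2"
  shows "(\<lambda>n. mangoldt (Suc n) * of_nat (Suc n) powr (- s)) sums
     (1 / (s - 1) - deriv zeta_reg s / zeta_reg s)"
proof -
  define D where "D s = (\<Sum>n. of_nat (Suc n) powr (- s) :: complex)" for s
  define A where "A = (\<Sum>n. mangoldt (Suc n) * of_nat (Suc n) powr (- s) :: complex)"
  have o: "open {s. Re s > 1}" by (simp add: open_halfspace_Re_gt)
  have hol: "(\<lambda>s. of_nat (Suc n) powr (- s)) holomorphic_on {s. Re s > 1}" for n
    unfolding powr_def by (auto intro!: holomorphic_intros simp del: of_nat_Suc)
  have bd: "\<exists>d h. 0 < d \<and> summable h \<and> (\<forall>n. \<forall>y\<in>ball x d \<inter> {s. Re s > 1}. norm (of_nat (Suc n) powr (- y) :: complex) \<le> h n)"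
    if "x \<in> {s. Re s > 1}" for x
  proof (intro exI conjI allI ballI)
    show "0 < (Re x - 1) / 2" using that by simp
    show "summable (\<lambda>n. real (Suc n) powr (- ((Re x + 1) / 2)))"
      using that by (intro summable_Suc_powr) auto
    fix n y assume "y \<in> ball x ((Re x - 1) / 2) \<inter> {s. Re s > 1}"
    then have "norm (x - y) < (Re x - 1) / 2" by (auto simp: dist_norm)
    then have "Re y \<ge> (Re x + 1) / 2" using complex_Re_le_cmod [of "x - y"] by (simp add: field_simps)
    then show "norm (of_nat (Suc n) powr (- y) :: complex) \<le> real (Suc n) powr (- ((Re x + 1) / 2))"
      by (simp add: norm_of_nat_powr powr_mono del: of_nat_Suc)
  qed
  have s1: "s \<in> {s. Re s > 1}" using s by simp
  have Dhol: "D holomorphic_on {s. Re s > 1}"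
    unfolding D_def by (rule holomorphic_on_suminf(1) [OF o hol bd])
  have "(\<lambda>n. deriv (\<lambda>s. of_nat (Suc n) powr (- s)) s) sums deriv D s"
    unfolding D_def by (rule holomorphic_on_suminf(3) [OF o hol bd s1])
  then have d1: "(\<lambda>n. - (of_real (ln (Suc n)) * of_nat (Suc n) powr (- s))) sums deriv D s"
    unfolding deriv_of_nat_powr by simp
  have "(\<lambda>n. - (of_real (ln (Suc n)) * of_nat (Suc n) powr (- s))) sums (- (A * D s))"
    unfolding A_def D_def by (intro sums_minus mangoldt_mult_zeta s)
  with d1 have dD: "deriv D s = - (A * D s)" by (rule sums_unique2)
  have "(D has_field_derivative deriv D s) (at s)"
    using Dhol o s1 by (rule holomorphic_derivI)
  then have "((\<lambda>s. (s - 1) * D s) has_field_derivative (D s + (s - 1) * deriv D s)) (at s)"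
    by (auto intro!: derivative_eq_intros)
  then have "(zeta_reg has_field_derivative (D s + (s - 1) * deriv D s)) (at s)"
    by (rule has_field_derivative_transform_within_open [OF _ o s1]) (simp add: D_def zeta_reg_eq_sum)
  then have dz: "deriv zeta_reg s = D s + (s - 1) * deriv D s" by (rule DERIV_imp_deriv)
  have z: "zeta_reg s = (s - 1) * D s" unfolding D_def using s by (intro zeta_reg_eq_sum) auto
  have "zeta_reg s \<noteq> 0" using norm_zeta_reg_ge [OF s] by auto
  then have nz: "r * D s \<noteq> 0" if "r = s - 1" for r using that z by simp
  have "A = 1 / r - (D s + r * (- (A * D s))) / (r * D s)" if "r = s - 1" for r
    using nz [OF that] by (simp add: divide_simps)
  then have "A = 1 / (s - 1) - deriv zeta_reg s / zeta_reg s"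
    unfolding dz dD z by blast
  moreover have "(\<lambda>n. mangoldt (Suc n) * of_nat (Suc n) powr (- s)) sums A"
    unfolding A_def by (intro summable_sums summable_norm_cancel [OF mangoldt_powr_summable [OF s]])
  ultimately show ?thesis by simp
qed

subsection \<open>A truncated Perron formula\<close>

lemma has_contour_integral_linepath_same_Im_iff:
  assumes "a < b"
  shows "(f has_contour_integral I) (linepath (Complex a c) (Complex b c)) \<longleftrightarrow>
     ((\<lambda>x. f (Complex x c)) has_integral I) {a..b}"
proof -
  have lp: "linepath (Complex a c) (Complex b c) x = linepath (of_real a) (of_real b) x + \<i> * of_real c" for x
    by (auto simp: linepath_def complex_eq_iff algebra_simps)
  have "(f has_contour_integral I) (linepath (Complex a c) (Complex b c)) \<longleftrightarrow>
     ((\<lambda>z. f (z + \<i> * of_real c)) has_contour_integral I) (linepath (of_real a) (of_real b))"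
    unfolding has_contour_integral_linepath lp
    by (intro has_integral_cong arg_cong2 [of _ _ _ _ "(*)"] refl) (auto simp: complex_eq_iff)
  also have "\<dots> \<longleftrightarrow> ((\<lambda>x. f (of_real x + \<i> * of_real c)) has_integral I) {a..b}"
    using assms by (subst has_contour_integral_linepath_Reals_iff) auto
  finally show ?thesis by (simp add: Complex_eq)
qed

lemma contour_integral_linepath_same_Im:
  assumes "a < b"
  shows "contour_integral (linepath (Complex a c) (Complex b c)) f = integral {a..b} (\<lambda>x. f (Complex x c))"
  using has_contour_integral_linepath_same_Im_iff [OF assms, of f _ c]
  unfolding contour_integral_def integral_def contour_integrable_on_def integrable_on_def
  by auto

lemma contour_integral_rectpath:
  assumes ab: "a < b" "c < d" and f: "continuous_on (path_image (rectpath (Complex a c) (Complex b d))) f"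
  shows "contour_integral (rectpath (Complex a c) (Complex b d)) f =
      integral {a..b} (\<lambda>x. f (Complex x c)) + \<i> * integral {c..d} (\<lambda>y. f (Complex b y))
    - integral {a..b} (\<lambda>x. f (Complex x d)) - \<i> * integral {c..d} (\<lambda>y. f (Complex a y))"
proof -
  define p where "p = Complex a c"
  define q where "q = Complex b c"
  define r where "r = Complex b d"
  define s where "s = Complex a d"
  have rp: "rectpath (Complex a c) (Complex b d) = linepath p q +++ linepath q r +++ linepath r s +++ linepath s p"
    by (simp add: rectpath_def Let_def p_def q_def r_def s_def)
  have im: "path_image (rectpath (Complex a c) (Complex b d)) =
     closed_segment p q \<union> closed_segment q r \<union> closed_segment r s \<union> closed_segment s p"
    unfolding rp by (simp add: path_image_join Un_assoc)
  have ci: "f contour_integrable_on linepath p q" "f contour_integrable_on linepath q r"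
    "f contour_integrable_on linepath r s" "f contour_integrable_on linepath s p"
    using f unfolding im
    by (auto intro!: contour_integrable_continuous_linepath elim: continuous_on_subset)
  have "contour_integral (rectpath (Complex a c) (Complex b d)) f =
     contour_integral (linepath p q) f + (contour_integral (linepath q r) f +
     (contour_integral (linepath r s) f + contour_integral (linepath s p) f))"
    unfolding rp using ci by (simp add: contour_integral_join valid_path_join contour_integrable_joinI)
  also have "contour_integral (linepath p q) f = integral {a..b} (\<lambda>x. f (Complex x c))"
    unfolding p_def q_def using ab by (intro contour_integral_linepath_same_Im)
  also have "contour_integral (linepath q r) f = \<i> * integral {c..d} (\<lambda>y. f (Complex b y))"
    using ab by (subst contour_integral_linepath_same_Re [of _ b _ c d]) (auto simp: q_def r_def)
  also have "contour_integral (linepath r s) f = - contour_integral (linepath s r) f"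
    by (rule contour_integral_reverse_linepath)
       (use f in \<open>auto simp: im elim: continuous_on_subset\<close>)
  also have "contour_integral (linepath s r) f = integral {a..b} (\<lambda>x. f (Complex x d))"
    unfolding r_def s_def using ab by (intro contour_integral_linepath_same_Im)
  also have "contour_integral (linepath s p) f = - contour_integral (linepath p s) f"
    by (rule contour_integral_reverse_linepath)
       (use f in \<open>auto simp: im elim: continuous_on_subset\<close>)
  also have "contour_integral (linepath p s) f = \<i> * integral {c..d} (\<lambda>y. f (Complex a y))"
    using ab by (subst contour_integral_linepath_same_Re [of _ a _ c d]) (auto simp: p_def s_def)
  finally show ?thesis by simp
qed

lemma rectangle_integrals_eq:
  assumes ab: "a < b" "c < d" and f: "f holomorphic_on cbox (Complex a c) (Complex b d)"
  shows "integral {a..b} (\<lambda>x. f (Complex x c)) + \<i> * integral {c..d} (\<lambda>y. f (Complex b y))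
    - integral {a..b} (\<lambda>x. f (Complex x d)) - \<i> * integral {c..d} (\<lambda>y. f (Complex a y)) = 0"
proof -
  have sub: "path_image (rectpath (Complex a c) (Complex b d)) \<subseteq> cbox (Complex a c) (Complex b d)"
    using ab by (intro path_image_rectpath_subset_cbox) auto
  have "(f has_contour_integral 0) (rectpath (Complex a c) (Complex b d))"
    by (rule Cauchy_theorem_convex_simple [OF f]) (use sub in auto)
  moreover have "continuous_on (path_image (rectpath (Complex a c) (Complex b d))) f"
    using holomorphic_on_imp_continuous_on [OF f] sub by (rule continuous_on_subset)
  ultimately show ?thesis
    using contour_integral_rectpath [OF ab, of f] by (simp add: contour_integral_unique)
qed

abbreviation vertical_integral :: "real \<Rightarrow> real \<Rightarrow> (complex \<Rightarrow> complex) \<Rightarrow> complex" where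
  "vertical_integral T c f \<equiv> integral {-T..T} (\<lambda>t. f (Complex c t))"

text \<open>The poles (1/2, 0) serve the terms of the Dirichlet series; (1, 1/2) and (1/2, 0)
  together serve the pole of - zeta' / zeta at 1. The quadratic decay makes truncation at height T
  cost only O(1 / T).\<close>

definition perron_kernel :: "real \<Rightarrow> real \<Rightarrow> real \<Rightarrow> complex \<Rightarrow> complex" where
  "perron_kernel a b v w = exp (w * of_real v) / ((w - of_real a) * (w - of_real b))"

text \<open>The sum of the residues at a and b, times 2 pi and not 2 pi i because
  \<open>vertical_integral\<close> integrates over t, with dw = i dt. For v < 0 the contour closes
  to the right, where there are no poles.\<close>

definition perron_limit :: "real \<Rightarrow> real \<Rightarrow> real \<Rightarrow> real" where
  "perron_limit a b v = (if v \<ge> 0 then 2 * pi * (exp (a * v) - exp (b * v)) / (a - b) else 0)"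

lemma norm_perron_kernel_le:
  assumes "norm (w - of_real a) \<ge> T" "norm (w - of_real b) \<ge> T" "Re w * v \<le> m" "T > 0"
  shows "norm (perron_kernel a b v w) \<le> exp m / T\<^sup>2"
proof -
  have "norm (perron_kernel a b v w) = exp (Re w * v) / (norm (w - of_real a) * norm (w - of_real b))"
    by (simp add: perron_kernel_def norm_divide norm_mult)
  also have "\<dots> \<le> exp m / (T * T)"
    using assms by (intro frac_le mult_mono) auto
  finally show ?thesis by (simp add: power2_eq_square)
qed

text \<open>The segment is closed to a rectangle on the left for v >= 0 and on the right for v < 0.
  On the new sides both poles are at distance at least T and Re w * v <= c * v, so the kernel is at
  most exp (c v) / T^2. Their total length is at most 6 T because c <= T.\<close>

lemma perron_kernel_bound:
  assumes ab: "0 \<le> b" "b < a" "a < c" and T: "T \<ge> c"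
  shows "norm (vertical_integral T c (perron_kernel a b v) - of_real (perron_limit a b v))
    \<le> 6 * exp (c * v) / T"
proof -
  let ?Q = "perron_kernel a b v"
  define m where "m = exp (c * v) / T\<^sup>2"
  have T0: "T > 0" using ab T by linarith
  have m0: "m \<ge> 0" by (simp add: m_def)
  have hol: "?Q holomorphic_on S" if "of_real a \<notin> S" "of_real b \<notin> S" for S
    unfolding perron_kernel_def using that by (auto intro!: holomorphic_intros)
  have re_ge: "norm (w - of_real x) \<ge> T" if "\<bar>Re w - x\<bar> \<ge> T \<or> \<bar>Im w\<bar> \<ge> T" for w x
    using that abs_Re_le_cmod [of "w - of_real x"] abs_Im_le_cmod [of "w - of_real x"] by auto
  have bnd: "norm (?Q w) \<le> m" if "\<And>x. x \<in> {a, b} \<Longrightarrow> \<bar>Re w - x\<bar> \<ge> T \<or> \<bar>Im w\<bar> \<ge> T" "Re w * v \<le> c * v" for w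
    unfolding m_def using that T0 by (intro norm_perron_kernel_le re_ge) auto
  have ibound: "norm (integral {p..q} (\<lambda>x. ?Q (g x))) \<le> m * (q - p)"
    if "p \<le> q" "continuous_on {p..q} g" "\<And>x. x \<in> {p..q} \<Longrightarrow> g x \<noteq> of_real a \<and> g x \<noteq> of_real b"
      "\<And>x. x \<in> {p..q} \<Longrightarrow> norm (?Q (g x)) \<le> m" for p q g
    using that unfolding perron_kernel_def
    by (intro integral_bound) (auto intro!: continuous_intros)
  have horizontal: "norm (integral {p..q} (\<lambda>x. ?Q (Complex x t))) \<le> m * (q - p)"
    if "\<bar>t\<bar> = T" "p \<le> q" "\<And>x. x \<in> {p..q} \<Longrightarrow> x * v \<le> c * v" for t p q
    using that T0 by (intro ibound bnd continuous_on_Complex) (auto simp: complex_eq_iff)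
  have vertical: "norm (integral {-T..T} (\<lambda>y. ?Q (Complex x y))) \<le> m * (2 * T)"
    if "\<And>y. y \<in> {a, b} \<Longrightarrow> \<bar>x - y\<bar> \<ge> T" "x * v \<le> c * v" for x
  proof -
    have "norm (integral {-T..T} (\<lambda>y. ?Q (Complex x y))) \<le> m * (T - - T)"
      using that(1) [of a] that(1) [of b] that(2) T0 by (intro ibound bnd continuous_on_Complex) (auto simp: complex_eq_iff)
    then show ?thesis by simp
  qed
  let ?K = "vertical_integral T c ?Q"
  show ?thesis
  proof (cases "v \<ge> 0")
    case False
    have "?Q holomorphic_on cbox (Complex c (-T)) (Complex (c + T) T)"
      using ab by (intro hol) (auto simp: in_cbox_complex_iff)
    from rectangle_integrals_eq [OF _ _ this]
    have eq: "\<i> * ?K = integral {c..c+T} (\<lambda>x. ?Q (Complex x (-T))) + \<i> * integral {-T..T} (\<lambda>y. ?Q (Complex (c+T) y))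
       - integral {c..c+T} (\<lambda>x. ?Q (Complex x T))"
      using T0 by (simp add: algebra_simps)
    have b1: "norm (integral {c..c+T} (\<lambda>x. ?Q (Complex x t))) \<le> m * (c + T - c)" if "\<bar>t\<bar> = T" for t
      using that T0 False by (intro horizontal) (auto intro: mult_right_mono_neg)
    have b2: "norm (integral {-T..T} (\<lambda>y. ?Q (Complex (c+T) y))) \<le> m * (2 * T)"
      using ab T0 False by (intro vertical) (auto intro: mult_right_mono_neg)
    have "norm ?K = norm (\<i> * ?K)" by (simp add: norm_mult)
    also have "\<dots> \<le> (norm (integral {c..c+T} (\<lambda>x. ?Q (Complex x (-T)))) + norm (\<i> * integral {-T..T} (\<lambda>y. ?Q (Complex (c+T) y))))
       + norm (integral {c..c+T} (\<lambda>x. ?Q (Complex x T)))"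
      unfolding eq by (intro order_trans [OF norm_triangle_ineq4] add_mono norm_triangle_ineq order_refl)
    also have "\<dots> \<le> m * T + m * (2 * T) + m * T"
      using b1 [of T] b1 [of "-T"] b2 T0 by (simp add: norm_mult algebra_simps)
    also have "\<dots> \<le> m * (6 * T)" using mult_nonneg_nonneg [OF m0 less_imp_le [OF T0]] by (simp add: algebra_simps)
    also have "\<dots> = 6 * exp (c * v) / T" using T0 by (simp add: m_def power2_eq_square)
    finally show ?thesis using False by (simp add: perron_limit_def)
  next
    case True
    let ?g = "rectpath (Complex (-T) (-T)) (Complex c T)"
    have inbox: "of_real x \<in> box (Complex (-T) (-T)) (Complex c T)" if "x \<in> {a, b}" for x
      using that ab T0 by (auto simp: in_box_complex_iff)
    have notin: "of_real x \<notin> path_image ?g" if "x \<in> {a, b}" for x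
      using inbox [OF that] path_image_rectpath_inter_box [of "Complex (-T) (-T)" "Complex c T"] T0 ab by fastforce
    have one: "((\<lambda>w. exp (w * of_real v) / (w - of_real x)) has_contour_integral (2 * pi * \<i> * exp (of_real x * of_real v))) ?g"
      if "x \<in> {a, b}" for x
    proof -
      have "((\<lambda>w. exp (w * of_real v) / (w - of_real x)) has_contour_integral
          (2 * pi * \<i> * winding_number ?g (of_real x) * exp (of_real x * of_real v))) ?g"
        by (rule Cauchy_integral_formula_convex_simple [of UNIV])
           (use notin [OF that] in \<open>auto intro!: holomorphic_intros\<close>)
      then show ?thesis using winding_number_rectpath [OF inbox [OF that]] by simp
    qed
    have "((\<lambda>w. (exp (w * of_real v) / (w - of_real a) - exp (w * of_real v) / (w - of_real b)) / (of_real (a - b)))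
        has_contour_integral ((2 * pi * \<i> * exp (of_real a * of_real v) - 2 * pi * \<i> * exp (of_real b * of_real v)) / of_real (a - b))) ?g"
      by (intro has_contour_integral_div has_contour_integral_diff one) auto
    moreover have "(exp (w * of_real v) / (w - of_real a) - exp (w * of_real v) / (w - of_real b)) / (of_real (a - b)) = ?Q w"
      if "w \<in> path_image ?g" for w
    proof -
      have "w - of_real a \<noteq> 0" "w - of_real b \<noteq> 0" "of_real a - of_real b \<noteq> (0 :: complex)"
        using that notin [of a] notin [of b] ab by auto
      then show ?thesis unfolding perron_kernel_def by (simp add: divide_simps) (simp add: algebra_simps)
    qed
    ultimately have "(?Q has_contour_integral ((2 * pi * \<i> * exp (of_real a * of_real v) - 2 * pi * \<i> * exp (of_real b * of_real v)) / of_real (a - b))) ?g"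
      by (rule has_contour_integral_eq)
    moreover have "(2 * pi * \<i> * exp (of_real a * of_real v) - 2 * pi * \<i> * exp (of_real b * of_real v)) / of_real (a - b) = \<i> * of_real (perron_limit a b v)"
    proof -
      have ex: "exp (of_real x * of_real v) = complex_of_real (exp (x * v))" for x
        by (simp add: exp_of_real flip: of_real_mult)
      show ?thesis unfolding ex perron_limit_def using True by (simp add: algebra_simps diff_divide_distrib)
    qed
    ultimately have ci: "contour_integral ?g ?Q = \<i> * of_real (perron_limit a b v)"
      by (simp add: contour_integral_unique)
    have "continuous_on (path_image ?g) ?Q"
      using notin by (intro holomorphic_on_imp_continuous_on hol) auto
    from contour_integral_rectpath [OF _ _ this]
    have eq: "\<i> * (?K - of_real (perron_limit a b v)) = \<i> * integral {-T..T} (\<lambda>y. ?Q (Complex (-T) y))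
       + integral {-T..c} (\<lambda>x. ?Q (Complex x T)) - integral {-T..c} (\<lambda>x. ?Q (Complex x (-T)))"
      using T0 ab unfolding ci by (simp add: algebra_simps)
    have b1: "norm (integral {-T..c} (\<lambda>x. ?Q (Complex x t))) \<le> m * (c - - T)" if "\<bar>t\<bar> = T" for t
      using that T0 ab True by (intro horizontal) (auto intro: mult_right_mono)
    have b2: "norm (integral {-T..T} (\<lambda>y. ?Q (Complex (-T) y))) \<le> m * (2 * T)"
      using mult_right_mono [of "-T" c v] ab T0 True by (intro vertical) auto
    have "norm (?K - of_real (perron_limit a b v)) = norm (\<i> * (?K - of_real (perron_limit a b v)))" by (simp add: norm_mult)
    also have "\<dots> \<le> (norm (\<i> * integral {-T..T} (\<lambda>y. ?Q (Complex (-T) y))) + norm (integral {-T..c} (\<lambda>x. ?Q (Complex x T))))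
       + norm (integral {-T..c} (\<lambda>x. ?Q (Complex x (-T))))"
      unfolding eq by (intro order_trans [OF norm_triangle_ineq4] add_mono norm_triangle_ineq order_refl)
    also have "\<dots> \<le> m * (2 * T) + m * (c + T) + m * (c + T)"
      using b1 [of T] b1 [of "-T"] b2 T0 by (simp add: norm_mult algebra_simps)
    also have "\<dots> = m * (4 * T + 2 * c)" by (simp add: algebra_simps)
    also have "\<dots> \<le> m * (6 * T)" using T T0 by (intro mult_left_mono m0) auto
    also have "\<dots> = 6 * exp (c * v) / T" using T0 by (simp add: m_def power2_eq_square)
    finally show ?thesis .
  qed
qed

text \<open>Here \<open>u\<close> is ln X. With \<open>zeta_reg\<close> for zeta the pole at 1 is
  removed, so that under the Riemann hypothesis the integrand is holomorphic for Re w > 1/2; the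
  pole contributes the main term separately.\<close>

definition zeta_perron :: "real \<Rightarrow> complex \<Rightarrow> complex" where
  "zeta_perron u w = - (deriv zeta_reg w / zeta_reg w) * exp ((w - 1/2) * of_real u) / ((w - 1/2) * w)"

text \<open>Twice this sum is \<open>\<integral>\<^sub>1\<^sup>X \<psi> t / t powr (3/2) dt\<close>.\<close>

definition psi_half :: "real \<Rightarrow> real" where
  "psi_half X = (\<Sum>n\<in>{1..nat \<lfloor>X\<rfloor>}. mangoldt n * (1 / sqrt n - 1 / sqrt X))"

text \<open>The factor exp (- u / 2) turns X powr w into X powr (w - 1/2). The pole term 1 / ((w -
  1) (w - 1/2) w) splits as 1 / ((w - 1) (w - 1/2)) - 1 / ((w - 1/2) w), a difference of two
  kernels.\<close>

lemma perron_zeta_series: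
  assumes u: "u \<ge> 0" and w: "Re w = 2"
  defines "c \<equiv> \<lambda>n. mangoldt (Suc n) * of_real (exp (- u / 2))"
  shows "(\<lambda>n. c n * perron_kernel (1/2) 0 (u - ln (Suc n)) w) sums
     (zeta_perron u w + of_real (exp (- u / 2)) * (perron_kernel 1 (1/2) u w - perron_kernel (1/2) 0 u w))"
proof -
  define E where "E = of_real (exp (- u / 2)) * exp (w * of_real u) / ((w - 1/2) * w)"
  have nr: "w - z \<noteq> 0" if "Re z < 2" for z using that w by auto
  have wn: "w \<noteq> 0" "w - 1/2 \<noteq> 0" "w - 1 \<noteq> 0" using nr [of 0] nr [of "1/2"] nr [of 1] by simp_all
  have "(\<lambda>n. mangoldt (Suc n) * of_nat (Suc n) powr (- w) * E) sums
     ((1 / (w - 1) - deriv zeta_reg w / zeta_reg w) * E)"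
    using w by (intro sums_mult2 zeta_log_deriv) auto
  moreover have "mangoldt (Suc n) * of_nat (Suc n) powr (- w) * E = c n * perron_kernel (1/2) 0 (u - ln (Suc n)) w" for n
  proof -
    have "exp (w * of_real (u - ln (Suc n))) = exp (w * of_real u) * of_nat (Suc n) powr (- w)"
      by (simp add: powr_def Ln_of_nat ring_distribs flip: exp_add del: of_nat_Suc)
    then show ?thesis by (simp add: c_def perron_kernel_def E_def)
  qed
  moreover have "(1 / (w - 1) - deriv zeta_reg w / zeta_reg w) * E =
     zeta_perron u w + of_real (exp (- u / 2)) * (perron_kernel 1 (1/2) u w - perron_kernel (1/2) 0 u w)"
  proof -
    have ex: "exp ((w - 1/2) * of_real u) = of_real (exp (- u / 2)) * exp (w * of_real u)"
      by (simp add: exp_of_real [symmetric] algebra_simps flip: exp_add)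
    have *: "1 / (w - 1) * (1 / ((w - 1/2) * w)) = 1 / ((w - 1) * (w - 1/2)) - 1 / ((w - 1/2) * w)"
    proof -
      have f1: "1 / ((w - 1) * (w - 1/2)) = w / ((w - 1) * (w - 1/2) * w)" using wn(1) by simp
      have f2: "1 / ((w - 1/2) * w) = (w - 1) / ((w - 1) * ((w - 1/2) * w))"
        using wn(3) by simp
      have f3: "w / ((w - 1) * (w - 1/2) * w) - (w - 1) / ((w - 1) * (w - 1/2) * w) = 1 / ((w - 1) * (w - 1/2) * w)"
        by (subst diff_divide_distrib [symmetric]) simp
      have "1 / (w - 1) * (1 / ((w - 1/2) * w)) = 1 / ((w - 1) * (w - 1/2) * w)"
        by (simp add: mult.assoc)
      also have "\<dots> = 1 / ((w - 1) * (w - 1/2)) - 1 / ((w - 1/2) * w)"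
        unfolding f1 f2 mult.assoc [symmetric] f3 ..
      finally show ?thesis .
    qed
    have e1: "1 / (w - 1) * E = of_real (exp (- u / 2)) * (perron_kernel 1 (1/2) u w - perron_kernel (1/2) 0 u w)"
    proof -
      have "1 / (w - 1) * E = of_real (exp (- u / 2)) * exp (w * of_real u) * (1 / (w - 1) * (1 / ((w - 1/2) * w)))"
        by (simp add: E_def)
      also have "\<dots> = of_real (exp (- u / 2)) * exp (w * of_real u) * (1 / ((w - 1) * (w - 1/2)) - 1 / ((w - 1/2) * w))"
        by (subst *) (rule refl)
      finally show ?thesis by (simp add: perron_kernel_def right_diff_distrib mult.assoc)
    qed
    have e2: "- (deriv zeta_reg w / zeta_reg w) * E = zeta_perron u w"
      unfolding E_def zeta_perron_def ex by simp
    have "(1 / (w - 1) - deriv zeta_reg w / zeta_reg w) * E = - (deriv zeta_reg w / zeta_reg w) * E + 1 / (w - 1) * E"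
      by (simp add: algebra_simps)
    then show ?thesis unfolding e1 e2 .
  qed
  ultimately show ?thesis by simp
qed

lemma perron_kernel_continuous:
  assumes "a < c" "b < c"
  shows "continuous_on S (\<lambda>t. perron_kernel a b v (Complex c t))"
proof -
  have "Complex c t - of_real x \<noteq> 0" if "x < c" for t x using that by (auto simp: complex_eq_iff)
  with assms show ?thesis unfolding perron_kernel_def
    by (intro continuous_intros) (auto intro!: continuous_intros simp: Complex_eq)
qed

text \<open>On a finite segment sum and integral are exchanged by the Weierstrass M-test. The second
  conclusion is its majorant, kept because it also sums the truncation errors in
  \<open>zeta_perron_tendsto\<close>.\<close>

lemma zeta_perron_truncated:
  assumes u: "u \<ge> 0" and T: "T > 0"
  defines "c \<equiv> \<lambda>n. mangoldt (Suc n) * of_real (exp (- u / 2))"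
  shows "(\<lambda>n. c n * vertical_integral T 2 (perron_kernel (1/2) 0 (u - ln (Suc n)))) sums
     (vertical_integral T 2 (zeta_perron u) + of_real (exp (- u / 2)) *
       (vertical_integral T 2 (perron_kernel 1 (1/2) u) - vertical_integral T 2 (perron_kernel (1/2) 0 u)))"
    and "summable (\<lambda>n. norm (c n) * exp (2 * (u - ln (Suc n))))"
proof -
  define M where "M n = norm (c n) * exp (2 * (u - ln (Suc n)))" for n
  define g where "g n t = c n * perron_kernel (1/2) 0 (u - ln (Suc n)) (Complex 2 t)" for n t
  define G where "G t = zeta_perron u (Complex 2 t) + of_real (exp (- u / 2)) * (perron_kernel 1 (1/2) u (Complex 2 t) - perron_kernel (1/2) 0 u (Complex 2 t))" for t
  have M: "summable M"
  proof -
    have "M n = exp (3/2 * u) * norm (mangoldt (Suc n) * of_nat (Suc n) powr (- 2) :: complex)" for n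
    proof -
      have "exp (- (2 * ln (real (Suc n)))) = real (Suc n) powr (- 2)"
        by (simp add: powr_def del: of_nat_Suc)
      moreover have "exp (- u / 2) * exp (2 * (u - ln (Suc n))) = exp (3/2 * u) * exp (- (2 * ln (real (Suc n))))"
        by (simp flip: exp_add add: algebra_simps)
      ultimately have "exp (- u / 2) * exp (2 * (u - ln (Suc n))) = exp (3/2 * u) * real (Suc n) powr (- 2)" by simp
      moreover have "norm (of_nat (Suc n) powr (- 2) :: complex) = real (Suc n) powr (- 2)"
        using norm_of_nat_powr [of n "-2"] by simp
      ultimately show ?thesis
        by (simp only: M_def c_def norm_mult norm_mangoldt norm_of_real abs_exp_cancel mult.assoc) (simp add: mult.left_commute)
    qed
    moreover have "summable (\<lambda>n. norm (mangoldt (Suc n) * of_nat (Suc n) powr (- 2) :: complex))"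
      using mangoldt_powr_summable [of 2] by simp
    then have "summable (\<lambda>n. exp (3/2 * u) * norm (mangoldt (Suc n) * of_nat (Suc n) powr (- 2) :: complex))"
      by (rule summable_mult)
    ultimately show ?thesis by presburger
  qed
  then show "summable (\<lambda>n. norm (c n) * exp (2 * (u - ln (Suc n))))" unfolding M_def .
  have gM: "norm (g n t) \<le> M n" for n t
  proof -
    have 1: "norm (Complex 2 t - of_real x) \<ge> 1" if "x \<le> 1" for x
      using complex_Re_le_cmod [of "Complex 2 t - of_real x"] that by simp
    have "norm (perron_kernel (1/2) 0 (u - ln (Suc n)) (Complex 2 t)) \<le> exp (2 * (u - ln (Suc n))) / 1\<^sup>2"
      by (rule norm_perron_kernel_le) (use 1 [of "1/2"] 1 [of 0] in auto)
    then show ?thesis unfolding g_def M_def by (simp add: norm_mult mult_left_mono)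
  qed
  have sG: "(\<lambda>n. g n t) sums G t" for t
    unfolding g_def G_def c_def by (rule perron_zeta_series [OF u]) simp
  have cg: "continuous_on S (g n)" for n S
    unfolding g_def by (intro continuous_intros perron_kernel_continuous) auto
  have "uniform_limit {-T..T} (\<lambda>N t. \<Sum>n<N. g n t) (\<lambda>t. \<Sum>n. g n t) sequentially"
    by (rule Weierstrass_m_test [OF gM M])
  moreover have "(\<lambda>t. \<Sum>n. g n t) = G" using sG by (auto simp: sums_iff)
  ultimately have ul: "uniform_limit {-T..T} (\<lambda>N t. \<Sum>n<N. g n t) G sequentially" by simp
  obtain I J where IJ: "\<And>N. ((\<lambda>t. \<Sum>n<N. g n t) has_integral I N) {-T..T}" "(G has_integral J) {-T..T}" "I \<longlonglongrightarrow> J"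
    by (rule uniform_limit_integral [OF ul]) (auto intro!: continuous_intros cg)
  have "I N = (\<Sum>n<N. integral {-T..T} (g n))" for N
  proof -
    have "((\<lambda>t. \<Sum>n<N. g n t) has_integral (\<Sum>n<N. integral {-T..T} (g n))) {-T..T}"
      by (intro has_integral_sum integrable_integral integrable_continuous_interval cg) auto
    then show ?thesis using IJ(1) has_integral_unique by blast
  qed
  then have "I = (\<lambda>N. \<Sum>n<N. integral {-T..T} (g n))" by (rule ext)
  then have s1: "(\<lambda>n. integral {-T..T} (g n)) sums J" using IJ(3) by (simp add: sums_def)
  have cc: "(\<lambda>t. perron_kernel a b v (Complex 2 t)) integrable_on {-T..T}" if "a < 2" "b < 2" for a b v
    using that by (intro integrable_continuous_interval perron_kernel_continuous)
  have zi: "(\<lambda>t. zeta_perron u (Complex 2 t)) integrable_on {-T..T}"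
  proof -
    have "(\<lambda>t. G t - of_real (exp (- u / 2)) * (perron_kernel 1 (1/2) u (Complex 2 t) - perron_kernel (1/2) 0 u (Complex 2 t))) integrable_on {-T..T}"
      using IJ(2) by (intro integrable_diff integrable_on_mult_right cc) (auto simp: integrable_on_def)
    then show ?thesis by (simp add: G_def)
  qed
  have "J = integral {-T..T} G" using IJ(2) by (simp add: integral_unique)
  also have "\<dots> = vertical_integral T 2 (zeta_perron u) + of_real (exp (- u / 2)) *
       (vertical_integral T 2 (perron_kernel 1 (1/2) u) - vertical_integral T 2 (perron_kernel (1/2) 0 u))"
    unfolding G_def
    by (subst integral_add [OF zi], intro integrable_diff integrable_on_mult_right cc, simp, simp, simp, simp)
       (subst integral_mult_right, subst integral_diff [OF cc cc], auto)
  finally have Jeq: "J = \<dots>" .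
  show "(\<lambda>n. c n * vertical_integral T 2 (perron_kernel (1/2) 0 (u - ln (Suc n)))) sums
     (vertical_integral T 2 (zeta_perron u) + of_real (exp (- u / 2)) *
       (vertical_integral T 2 (perron_kernel 1 (1/2) u) - vertical_integral T 2 (perron_kernel (1/2) 0 u)))"
  proof -
    have "integral {-T..T} (g n) = c n * vertical_integral T 2 (perron_kernel (1/2) 0 (u - ln (Suc n)))" for n
      unfolding g_def [abs_def] by (rule integral_mult_right)
    with s1 show ?thesis unfolding Jeq by simp
  qed
qed

text \<open>The n-th truncation error is at most 6 |c_n| exp (2 v_n) / T, and these bounds are
  summable, so the total is O(1 / T). Terms with n > exp u have v_n < 0 and limit 0, which leaves
  the finite sum in \<open>psi_half\<close>. The two kernels of the pole term yield exp (u/2) - 2 +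
  exp (- u/2).\<close>

lemma zeta_perron_tendsto:
  assumes u: "u \<ge> 0"
  shows "((\<lambda>T. vertical_integral T 2 (zeta_perron u)) \<longlongrightarrow>
     of_real (4 * pi * (psi_half (exp u) - (exp (u/2) - 2 + exp (- u/2))))) at_top"
proof -
  define c :: "nat \<Rightarrow> complex" where "c n = mangoldt (Suc n) * of_real (exp (- u / 2))" for n
  define v where "v n = u - ln (real (Suc n))" for n
  define K where "K a b y T = vertical_integral T 2 (perron_kernel a b y)" for a b y T
  define A where "A = (\<Sum>n. norm (c n) * exp (2 * v n))"
  have sM: "summable (\<lambda>n. norm (c n) * exp (2 * v n))"
    unfolding c_def v_def by (rule zeta_perron_truncated(2) [OF u zero_less_one])
  have lim0: "((\<lambda>T. B / T) \<longlongrightarrow> (0 :: real)) at_top" for B by real_asymp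
  have Klim: "((\<lambda>T. K a b y T) \<longlongrightarrow> of_real (perron_limit a b y)) at_top" if "0 \<le> b" "b < a" "a < 2" for a b y
  proof -
    have "((\<lambda>T. K a b y T - of_real (perron_limit a b y)) \<longlongrightarrow> 0) at_top"
    proof (rule Lim_null_comparison [OF _ lim0])
      show "\<forall>\<^sub>F T in at_top. norm (K a b y T - of_real (perron_limit a b y)) \<le> 6 * exp (2 * y) / T"
        using eventually_ge_at_top [of 2] unfolding K_def
        by eventually_elim (use that in \<open>auto intro!: perron_kernel_bound\<close>)
    qed
    then show ?thesis by (simp add: LIM_zero_iff)
  qed
  define S where "S = complex_of_real (4 * pi * psi_half (exp u))"
  have sS: "(\<lambda>n. c n * of_real (perron_limit (1/2) 0 (v n))) sums S"
  proof -
    have "(\<lambda>n. c n * of_real (perron_limit (1/2) 0 (v n))) sums (\<Sum>n<nat \<lfloor>exp u\<rfloor>. c n * of_real (perron_limit (1/2) 0 (v n)))"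
    proof (rule sums_finite)
      fix n assume "n \<notin> {..<nat \<lfloor>exp u\<rfloor>}"
      then have "exp u < real (Suc n)" by (simp add: not_less) linarith
      then have "ln (exp u) < ln (real (Suc n))" by (subst ln_less_cancel_iff) auto
      then have "v n < 0" by (simp add: v_def del: of_nat_Suc)
      then show "c n * of_real (perron_limit (1/2) 0 (v n)) = 0" by (simp add: perron_limit_def)
    qed simp
    also have "(\<Sum>n<nat \<lfloor>exp u\<rfloor>. c n * of_real (perron_limit (1/2) 0 (v n))) =
      (\<Sum>n<nat \<lfloor>exp u\<rfloor>. of_real (4 * pi * (mangoldt (Suc n) * (1 / sqrt (Suc n) - 1 / sqrt (exp u)))))"
    proof (intro sum.cong refl)
      fix n assume "n \<in> {..<nat \<lfloor>exp u\<rfloor>}"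
      then have "real (Suc n) \<le> exp u" by simp linarith
      then have "ln (real (Suc n)) \<le> ln (exp u)" by (subst ln_le_cancel_iff) auto
      then have v0: "v n \<ge> 0" by (simp add: v_def del: of_nat_Suc)
      have sq: "exp (- (u/2)) = 1 / sqrt (exp u)"
      proof -
        have "sqrt (exp u) = exp (u/2)"
          by (rule real_sqrt_unique) (simp_all add: exp_double [symmetric])
        then show ?thesis by (simp add: exp_minus inverse_eq_divide)
      qed
      have "exp (ln (real (Suc n)) / 2) = sqrt (real (Suc n))"
        by (rule real_sqrt_unique [symmetric]) (simp_all add: exp_double [symmetric] del: of_nat_Suc)
      moreover have "exp (v n / 2) * exp (- (u/2)) * exp (ln (real (Suc n)) / 2) = 1"
        by (simp add: v_def field_simps flip: exp_add)
      ultimately have sn: "exp (v n / 2) * exp (- (u/2)) = 1 / sqrt (real (Suc n))"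
        by (simp add: field_simps del: of_nat_Suc)
      have "perron_limit (1/2) 0 (v n) * exp (- (u/2)) = 4 * pi * (exp (v n / 2) * exp (- (u/2)) - exp (- (u/2)))"
        using v0 by (simp add: perron_limit_def algebra_simps)
      also have "\<dots> = 4 * pi * (1 / sqrt (real (Suc n)) - 1 / sqrt (exp u))"
        unfolding sn unfolding sq ..
      finally have *: "perron_limit (1/2) 0 (v n) * exp (- (u/2)) = 4 * pi * (1 / sqrt (real (Suc n)) - 1 / sqrt (exp u))" .
      have "c n * of_real (perron_limit (1/2) 0 (v n)) = of_real (mangoldt (Suc n) * (perron_limit (1/2) 0 (v n) * exp (- (u/2))))"
        by (simp add: c_def)
      then show "c n * of_real (perron_limit (1/2) 0 (v n)) = of_real (4 * pi * (mangoldt (Suc n) * (1 / sqrt (Suc n) - 1 / sqrt (exp u))))"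
        unfolding * by (simp add: mult_ac del: of_nat_Suc)
    qed
    also have "\<dots> = of_real (4 * pi * (\<Sum>n<nat \<lfloor>exp u\<rfloor>. mangoldt (Suc n) * (1 / sqrt (Suc n) - 1 / sqrt (exp u))))"
      by (simp only: of_real_sum sum_distrib_left)
    also have "\<dots> = S"
      unfolding S_def psi_half_def by (simp add: sum.atLeast1_atMost_eq del: of_nat_Suc)
    finally show ?thesis .
  qed
  define J where "J T = vertical_integral T 2 (zeta_perron u) + of_real (exp (- u / 2)) * (K 1 (1/2) u T - K (1/2) 0 u T)" for T
  have sJ: "(\<lambda>n. c n * K (1/2) 0 (v n) T) sums J T" if "T > 0" for T
    unfolding J_def K_def c_def v_def using zeta_perron_truncated(1) [OF u that] .
  have "((\<lambda>T. J T - S) \<longlongrightarrow> 0) at_top"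
  proof (rule Lim_null_comparison [OF _ lim0])
    show "\<forall>\<^sub>F T in at_top. norm (J T - S) \<le> (6 * A) / T"
      using eventually_ge_at_top [of 2]
    proof eventually_elim
      fix T :: real assume T: "T \<ge> 2"
      have d: "(\<lambda>n. c n * K (1/2) 0 (v n) T - c n * of_real (perron_limit (1/2) 0 (v n))) sums (J T - S)"
        using T by (intro sums_diff sJ sS) auto
      have "norm (J T - S) = norm (\<Sum>n. c n * K (1/2) 0 (v n) T - c n * of_real (perron_limit (1/2) 0 (v n)))"
        using d by (simp add: sums_iff)
      also have "\<dots> \<le> (\<Sum>n. 6 / T * (norm (c n) * exp (2 * v n)))"
      proof (rule norm_suminf_le)
        show "summable (\<lambda>n. 6 / T * (norm (c n) * exp (2 * v n)))" by (intro summable_mult sM)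
        fix n
        have "norm (K (1/2) 0 (v n) T - of_real (perron_limit (1/2) 0 (v n))) \<le> 6 * exp (2 * v n) / T"
          unfolding K_def by (rule perron_kernel_bound) (use T in auto)
        from mult_left_mono [OF this, of "norm (c n)"]
        show "norm (c n * K (1/2) 0 (v n) T - c n * of_real (perron_limit (1/2) 0 (v n))) \<le> 6 / T * (norm (c n) * exp (2 * v n))"
          by (simp add: norm_mult mult_ac flip: right_diff_distrib)
      qed
      also have "\<dots> = 6 / T * A" unfolding A_def by (intro suminf_mult sM)
      finally show "norm (J T - S) \<le> (6 * A) / T" by simp
    qed
  qed
  then have Jlim: "(J \<longlongrightarrow> S) at_top" by (simp add: LIM_zero_iff)
  have "((\<lambda>T. J T - of_real (exp (- u / 2)) * (K 1 (1/2) u T - K (1/2) 0 u T)) \<longlongrightarrow>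
     S - of_real (exp (- u / 2)) * (of_real (perron_limit 1 (1/2) u) - of_real (perron_limit (1/2) 0 u))) at_top"
    by (intro tendsto_intros Jlim Klim) auto
  moreover have "S - of_real (exp (- u / 2)) * (of_real (perron_limit 1 (1/2) u) - of_real (perron_limit (1/2) 0 u))
     = of_real (4 * pi * (psi_half (exp u) - (exp (u/2) - 2 + exp (- u/2))))"
  proof -
    have "exp (- u / 2) * (perron_limit 1 (1/2) u - perron_limit (1/2) 0 u) =
       4 * pi * (exp (- u/2) * exp u - 2 * (exp (- u/2) * exp (u/2)) + exp (- u/2))"
      using u by (simp add: perron_limit_def algebra_simps)
    also have "\<dots> = 4 * pi * (exp (u/2) - 2 + exp (- u/2))"
      by (simp flip: exp_add)
    finally have "of_real (exp (- u / 2)) * (of_real (perron_limit 1 (1/2) u) - of_real (perron_limit (1/2) 0 u)) = complex_of_real (4 * pi * (exp (u/2) - 2 + exp (- u/2)))"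
      by (metis of_real_diff of_real_mult)
    then show ?thesis unfolding S_def by (simp add: algebra_simps)
  qed
  ultimately show ?thesis by (simp add: J_def)
qed

subsection \<open>Holomorphic functions with positive real part\<close>

text \<open>The Cayley transform \<open>g\<close> maps the right half-plane to the unit disc and the
  value at the centre to 0, so the Schwarz lemma applies. The second conclusion is a Harnack
  inequality for the modulus; for this the imaginary part at the centre is subtracted.\<close>

lemma Schwarz_positive_real_part:
  assumes hol: "\<Phi> holomorphic_on ball c r" and r: "r > 0"
    and pos: "\<And>z. z \<in> ball c r \<Longrightarrow> Re (\<Phi> z) > 0"
  shows "norm (deriv \<Phi> c) \<le> 2 * Re (\<Phi> c) / r"
    and "\<And>z \<rho>. norm (z - c) \<le> \<rho> * r \<Longrightarrow> \<rho> < 1 \<Longrightarrow>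
      norm (\<Phi> z - \<i> * of_real (Im (\<Phi> c))) \<le> (1 + \<rho>) / (1 - \<rho>) * Re (\<Phi> c)"
proof -
  define G where "G \<zeta> = c + of_real r * \<zeta>" for \<zeta>
  define g where "g \<zeta> = (\<Phi> (G \<zeta>) - \<Phi> c) / (\<Phi> (G \<zeta>) + cnj (\<Phi> c))" for \<zeta>
  have G: "G \<zeta> \<in> ball c r" if "norm \<zeta> < 1" for \<zeta>
    using that r by (simp add: G_def dist_norm norm_mult)
  have posc: "Re (\<Phi> c) > 0" using pos r by simp
  have nz: "\<Phi> (G \<zeta>) + cnj (\<Phi> c) \<noteq> 0" if "norm \<zeta> < 1" for \<zeta>
  proof -
    have "Re (\<Phi> (G \<zeta>) + cnj (\<Phi> c)) > 0" using pos [OF G [OF that]] posc by simp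
    then show ?thesis by (metis less_irrefl zero_complex.sel(1))
  qed
  have holG: "(\<lambda>\<zeta>. \<Phi> (G \<zeta>)) holomorphic_on ball 0 1"
  proof -
    have "(\<Phi> \<circ> G) holomorphic_on ball 0 1"
      by (rule holomorphic_on_compose_gen [OF _ hol])
         (auto simp: G_def [abs_def] intro!: holomorphic_intros G [unfolded G_def])
    then show ?thesis by (simp add: o_def)
  qed
  have holg: "g holomorphic_on ball 0 1"
    unfolding g_def using nz by (intro holomorphic_intros holG) auto
  have g0: "g 0 = 0" by (simp add: g_def G_def)
  have lt: "norm (g \<zeta>) < 1" if "norm \<zeta> < 1" for \<zeta>
  proof -
    define A B where "A = \<Phi> (G \<zeta>)" and "B = \<Phi> c"
    have "(norm (A + cnj B))\<^sup>2 - (norm (A - B))\<^sup>2 = 4 * (Re A * Re B)"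
      unfolding cmod_power2 by (simp add: power2_eq_square algebra_simps)
    moreover have "Re A * Re B > 0" using pos [OF G [OF that]] posc by (simp add: A_def B_def)
    ultimately have "(norm (A - B))\<^sup>2 < (norm (A + cnj B))\<^sup>2" by simp
    then have "norm (A - B) < norm (A + cnj B)" by (simp add: power_less_imp_less_base)
    then show ?thesis using nz [OF that] by (simp add: g_def A_def B_def norm_divide)
  qed
  have S: "norm (g \<zeta>) \<le> norm \<zeta>" if "norm \<zeta> < 1" for \<zeta>
    using Schwarz_Lemma(1) [OF holg g0 lt that] .
  have S': "norm (deriv g 0) \<le> 1"
    using Schwarz_Lemma(2) [OF holg g0 lt, of 0] by simp
  have "(\<Phi> has_field_derivative deriv \<Phi> c) (at (G 0))"
    using holomorphic_derivI [OF hol open_ball, of c] r by (simp add: G_def)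
  moreover have "(G has_field_derivative of_real r) (at 0)"
    unfolding G_def [abs_def] by (auto intro!: derivative_eq_intros)
  ultimately have dG: "((\<lambda>\<zeta>. \<Phi> (G \<zeta>)) has_field_derivative deriv \<Phi> c * of_real r) (at 0)"
    by (rule DERIV_chain2)
  have nz0: "\<Phi> (G 0) + cnj (\<Phi> c) \<noteq> 0" by (rule nz) simp
  have "\<Phi> (G 0) - \<Phi> c = 0" by (simp add: G_def)
  with DERIV_divide [OF DERIV_diff [OF dG DERIV_const [of "\<Phi> c"]] DERIV_add [OF dG DERIV_const [of "cnj (\<Phi> c)"]] nz0]
  have "(g has_field_derivative (deriv \<Phi> c * of_real r) / (\<Phi> (G 0) + cnj (\<Phi> c))) (at 0)"
    using nz0 unfolding g_def [abs_def] by simp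
  then have "deriv g 0 = (deriv \<Phi> c * of_real r) / (\<Phi> (G 0) + cnj (\<Phi> c))" by (rule DERIV_imp_deriv)
  moreover have "\<Phi> (G 0) + cnj (\<Phi> c) = of_real (2 * Re (\<Phi> c))"
    by (simp add: G_def complex_eq_iff)
  ultimately have "norm (deriv g 0) = norm (deriv \<Phi> c) * r / (2 * Re (\<Phi> c))"
    using r posc by (simp add: norm_divide norm_mult)
  with S' r posc show "norm (deriv \<Phi> c) \<le> 2 * Re (\<Phi> c) / r"
    by (simp add: field_simps)
  fix z \<rho> assume z: "norm (z - c) \<le> \<rho> * r" and rho: "\<rho> < 1"
  define \<zeta> where "\<zeta> = (z - c) / of_real r"
  have nzeta: "norm \<zeta> \<le> \<rho>" using z r by (simp add: \<zeta>_def norm_divide field_simps)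
  then have z1: "norm \<zeta> < 1" using rho by simp
  have Gz: "G \<zeta> = z" using r by (simp add: G_def \<zeta>_def)
  define A b where "A = \<Phi> z - \<i> * of_real (Im (\<Phi> c))" and "b = Re (\<Phi> c)"
  have A1: "\<Phi> z - \<Phi> c = A - of_real b" and A2: "\<Phi> z + cnj (\<Phi> c) = A + of_real b"
    by (simp_all add: A_def b_def complex_eq_iff)
  have "norm (g \<zeta>) \<le> \<rho>" using S [OF z1] nzeta by simp
  then have "norm (A - of_real b) \<le> \<rho> * norm (A + of_real b)"
    using nz [OF z1] unfolding g_def Gz A1 A2 by (simp add: norm_divide divide_le_eq)
  moreover have "norm A - b \<le> norm (A - of_real b)"
    using norm_triangle_ineq2 [of A "of_real b"] posc by (simp add: b_def)
  moreover have "\<rho> * norm (A + of_real b) \<le> \<rho> * (norm A + b)"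
    using norm_triangle_ineq [of A "of_real b"] posc order_trans [OF norm_ge_zero nzeta]
    by (intro mult_left_mono) (auto simp: b_def)
  ultimately have "norm A - b \<le> \<rho> * (norm A + b)" by linarith
  then have "norm A * (1 - \<rho>) \<le> (1 + \<rho>) * b" by (simp add: algebra_simps)
  then show "norm (\<Phi> z - \<i> * of_real (Im (\<Phi> c))) \<le> (1 + \<rho>) / (1 - \<rho>) * Re (\<Phi> c)"
    using rho by (simp add: A_def b_def pos_le_divide_eq)
qed

lemma sin_ge_half:
  assumes "pi / 3 \<le> t" "t \<le> 2 * pi / 3"
  shows "sin t \<ge> 1/2"
proof -
  have "cos (pi / 3) \<le> cos \<bar>pi / 2 - t\<bar>"
    using assms pi_gt_zero by (intro cos_monotone_0_pi_le) linarith+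
  then show ?thesis by (simp add: cos_60 cos_diff)
qed

text \<open>The kernel \<open>sinh (\<pi> (z - p) / 3)\<close> is real of constant sign on the horizontal sides of the square
  and purely imaginary on the left one, so only the right side needs information on the imaginary part.\<close>

lemma vertical_integral_positive_real_part:
  assumes hol: "\<Phi> holomorphic_on {z. Re z > 0}"
    and pos: "\<And>z. Re z > 0 \<Longrightarrow> Re (\<Phi> z) > 0" and x: "x > 0"
  shows "integral {b + 1..b + 2} (\<lambda>y. Re (\<Phi> (Complex x y))) \<le> 18 * exp pi * Re (\<Phi> (Complex (x + 3) (b + 3/2)))"
proof -
  let ?h = "\<lambda>y. Re (\<Phi> (Complex x y)) * sin (pi * (y - b) / 3)"
  define c where "c = Complex (x + 3) (b + 3/2)"
  define p where "p = Complex x b"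
  \<comment> \<open>Subtracting this constant keeps all real parts and lets |\<open>\<Psi>\<close>|
    on the right side be bounded by Re (\<open>\<Phi>\<close> c) alone.\<close>
  define \<Psi> where "\<Psi> z = \<Phi> z - \<i> * of_real (Im (\<Phi> c))" for z
  define k where "k z = (exp (of_real pi * (z - p) / 3) - exp (- (of_real pi * (z - p) / 3))) / 2" for z
  define f where "f z = \<Psi> z * k z" for z
  let ?R = "cbox p (Complex (x + 3) (b + 3))"
  have Rsub: "?R \<subseteq> {z. Re z > 0}" using x by (auto simp: p_def in_cbox_complex_iff)
  have holPsi: "\<Psi> holomorphic_on {z. Re z > 0}" unfolding \<Psi>_def by (intro holomorphic_intros hol)
  have holf: "f holomorphic_on ?R" unfolding f_def k_def
    by (intro holomorphic_intros holomorphic_on_subset [OF holPsi Rsub]) auto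
  have contPsi: "continuous_on S (\<lambda>t. \<Psi> (g t))" if "continuous_on S g" "\<And>t. t \<in> S \<Longrightarrow> Re (g t) > 0" for S and g :: "real \<Rightarrow> complex"
    by (rule continuous_on_compose2 [OF holomorphic_on_imp_continuous_on [OF holPsi]]) (use that in auto)
  have contf: "continuous_on S (\<lambda>t. f (g t))" if "continuous_on S g" "\<And>t. t \<in> S \<Longrightarrow> Re (g t) > 0" for S and g :: "real \<Rightarrow> complex"
    unfolding f_def k_def by (intro continuous_intros contPsi that) auto
  note cC = continuous_on_Complex
  have RePsi: "Re (\<Psi> z) = Re (\<Phi> z)" for z by (simp add: \<Psi>_def)
  let ?B = "integral {x..x+3} (\<lambda>s. f (Complex s b))"
  let ?T = "integral {x..x+3} (\<lambda>s. f (Complex s (b+3)))"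
  let ?L = "integral {b..b+3} (\<lambda>y. f (Complex x y))"
  let ?Ri = "integral {b..b+3} (\<lambda>y. f (Complex (x+3) y))"
  have eq: "?B + \<i> * ?Ri - ?T - \<i> * ?L = 0"
    using rectangle_integrals_eq [OF _ _ holf [unfolded p_def]] by simp
  have kk: "(exp (of_real r) - exp (- of_real r)) / 2 = complex_of_real (sinh r)" for r
    by (simp add: sinh_def exp_of_real flip: of_real_minus)
  have kB: "k (Complex s b) = of_real (sinh (pi * (s - x) / 3))" for s
  proof -
    have e: "of_real pi * (Complex s b - p) / 3 = complex_of_real (pi * (s - x) / 3)"
      by (simp add: p_def complex_eq_iff)
    show ?thesis unfolding k_def e kk ..
  qed
  have kk': "(exp (of_real r + \<i> * pi) - exp (- (of_real r + \<i> * pi))) / 2 = - complex_of_real (sinh r)" for r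
  proof -
    have e1: "exp (of_real r + \<i> * pi) = - exp (complex_of_real r)"
      by (simp add: exp_add exp_pi_i')
    have "exp (- (of_real r + \<i> * pi)) = inverse (exp (complex_of_real r + \<i> * pi))"
      by (rule exp_minus)
    also have "\<dots> = - exp (- complex_of_real r)" unfolding e1 by (simp add: exp_minus)
    finally have e2: "exp (- (of_real r + \<i> * pi)) = - exp (- complex_of_real r)" .
    show ?thesis unfolding kk [symmetric] e1 e2 by (simp add: field_simps)
  qed
  have kT: "k (Complex s (b + 3)) = - of_real (sinh (pi * (s - x) / 3))" for s
  proof -
    have e: "of_real pi * (Complex s (b+3) - p) / 3 = complex_of_real (pi * (s - x) / 3) + \<i> * pi"
      by (simp add: p_def complex_eq_iff)
    show ?thesis unfolding k_def e kk' ..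
  qed
  have kL: "k (Complex x y) = \<i> * of_real (sin (pi * (y - b) / 3))" for y
  proof -
    have e: "of_real pi * (Complex x y - p) / 3 = \<i> * complex_of_real (pi * (y - b) / 3)"
      by (simp add: p_def complex_eq_iff)
    have kk'': "(exp (\<i> * of_real r) - exp (- (\<i> * of_real r))) / 2 = \<i> * complex_of_real (sin r)" for r
    proof -
      have "complex_of_real (sin r) = (exp (\<i> * of_real r) - exp (- (\<i> * of_real r))) / (2 * \<i>)"
        using sin_exp_eq [of "complex_of_real r"] by (simp only: sin_of_real mult_minus_left)
      then show ?thesis by (simp add: field_simps)
    qed
    show ?thesis unfolding k_def e kk'' ..
  qed
  have ib: "(\<lambda>t. f (g t)) integrable_on {q..r}" if "continuous_on {q..r} g" "\<And>t. t \<in> {q..r} \<Longrightarrow> Re (g t) > 0" for g and q r :: real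
    by (intro integrable_continuous_interval contf that)
  have ReB: "Re ?B \<ge> 0"
  proof -
    have "Re ?B = integral {x..x+3} (\<lambda>s. Re (f (Complex s b)))"
      using integral_linear [OF ib bounded_linear_Re, of x "x+3" "\<lambda>s. Complex s b"] x cC by (simp add: o_def)
    also have "\<dots> \<ge> 0"
    proof (rule integral_nonneg)
      show "(\<lambda>s. Re (f (Complex s b))) integrable_on {x..x+3}"
        using x by (intro integrable_continuous_interval continuous_on_Re contf cC) auto
      fix s assume "s \<in> {x..x+3}"
      then show "0 \<le> Re (f (Complex s b))"
        using pos [of "Complex s b"] x unfolding f_def kB by (auto simp: RePsi)
    qed
    finally show ?thesis .
  qed
  have ReT: "Re ?T \<le> 0"
  proof -
    have "Re ?T = integral {x..x+3} (\<lambda>s. Re (f (Complex s (b+3))))"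
      using integral_linear [OF ib bounded_linear_Re, of x "x+3" "\<lambda>s. Complex s (b+3)"] x cC by (simp add: o_def)
    also have "\<dots> = - integral {x..x+3} (\<lambda>s. - Re (f (Complex s (b+3))))" by simp
    moreover have "integral {x..x+3} (\<lambda>s. - Re (f (Complex s (b+3)))) \<ge> 0"
    proof (rule integral_nonneg)
      show "(\<lambda>s. - Re (f (Complex s (b+3)))) integrable_on {x..x+3}"
        using x by (intro integrable_continuous_interval continuous_on_minus continuous_on_Re contf cC) auto
      fix s assume "s \<in> {x..x+3}"
      then show "0 \<le> - Re (f (Complex s (b+3)))"
        using pos [of "Complex s (b+3)"] x unfolding f_def kT by (auto simp: RePsi)
    qed
    ultimately show ?thesis by linarith
  qed
  have ReL: "- Re (\<i> * ?L) = integral {b..b+3} ?h"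
  proof -
    have "- Re (\<i> * ?L) = Im ?L" by simp
    also have "\<dots> = integral {b..b+3} (\<lambda>y. Im (f (Complex x y)))"
      using integral_linear [OF ib bounded_linear_Im, of b "b+3" "\<lambda>y. Complex x y"] x cC by (simp add: o_def)
    also have "(\<lambda>y. Im (f (Complex x y))) = ?h"
      unfolding f_def kL by (auto simp: RePsi)
    finally show ?thesis .
  qed
  \<comment> \<open>The right side lies within 3/2 of \<open>c\<close>, half the radius 3, so the
    Harnack factor is (1 + 1/2) / (1 - 1/2) = 3. The kernel is at most exp pi there and the side has
    length 3, which gives 9 exp pi.\<close>
  have nR: "norm ?Ri \<le> (3 * Re (\<Phi> c) * exp pi) * (b + 3 - b)"
  proof (rule integral_bound)
    show "continuous_on {b..b+3} (\<lambda>y. f (Complex (x+3) y))" using x by (intro contf cC) auto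
    fix y assume y: "y \<in> {b..b+3}"
    have "norm (\<Psi> (Complex (x+3) y)) \<le> (1 + 1/2) / (1 - 1/2) * Re (\<Phi> c)"
      unfolding \<Psi>_def
    proof (rule Schwarz_positive_real_part(2) [where \<Phi> = \<Phi> and c = c and r = 3])
      have sub: "ball c 3 \<subseteq> {z. Re z > 0}"
      proof
        fix z assume "z \<in> ball c 3"
        then have "\<bar>Re (c - z)\<bar> < 3" using abs_Re_le_cmod [of "c - z"] by (simp add: dist_norm)
        then show "z \<in> {z. Re z > 0}" using x by (simp add: c_def)
      qed
      then show "\<Phi> holomorphic_on ball c 3" using hol holomorphic_on_subset by blast
      show "Re (\<Phi> z) > 0" if "z \<in> ball c 3" for z using sub that pos by auto
      have "Complex (x+3) y - c = \<i> * of_real (y - (b + 3/2))" by (simp add: c_def complex_eq_iff)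
      then have "norm (Complex (x+3) y - c) = \<bar>y - (b + 3/2)\<bar>" by (simp only: norm_mult norm_ii norm_of_real mult_1)
      then show "norm (Complex (x+3) y - c) \<le> 1/2 * 3" using y by (simp add: abs_le_iff field_simps)
    qed auto
    moreover have "norm (k (Complex (x+3) y)) \<le> exp pi"
    proof -
      have re: "Re (of_real pi * (Complex (x+3) y - p) / 3) = pi" by (simp add: p_def)
      have "norm (exp (of_real pi * (Complex (x+3) y - p) / 3) - exp (- (of_real pi * (Complex (x+3) y - p) / 3))) \<le> exp pi + exp (- pi)"
        by (rule order_trans [OF norm_triangle_ineq4]) (simp only: norm_exp_eq_Re re uminus_complex.sel order_refl)
      also have "\<dots> \<le> 2 * exp pi" using pi_gt_zero by simp
      finally show ?thesis by (simp add: k_def norm_divide)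
    qed
    ultimately show "norm (f (Complex (x+3) y)) \<le> 3 * Re (\<Phi> c) * exp pi"
      using pos [of c] x unfolding f_def norm_mult by (intro mult_mono) (auto simp: c_def)
  qed simp
  \<comment> \<open>In the real part of Cauchy's identity both horizontal sides have a favourable
    sign and are dropped.\<close>
  have "integral {b..b+3} ?h \<le> norm ?Ri"
  proof -
    have "Re (?B + \<i> * ?Ri - ?T - \<i> * ?L) = 0" using eq by simp
    then have "- Re (\<i> * ?L) \<le> Im ?Ri" using ReB ReT by simp
    then show ?thesis unfolding ReL using abs_Im_le_cmod [of ?Ri] by linarith
  qed
  then have main: "integral {b..b+3} ?h \<le> 9 * exp pi * Re (\<Phi> c)"
    using nR by (simp add: mult_ac)
  have contPhi: "continuous_on S (\<lambda>y. Re (\<Phi> (Complex x y)))" for S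
    using continuous_on_Re [OF contPsi [OF cC(1) [of S x]]] x by (simp add: RePsi)
  have sin0: "sin (pi * (y - b) / 3) \<ge> 0" if "y \<in> {b..b+3}" for y
    using that mult_left_mono [of "y - b" 3 pi] by (intro sin_ge_zero) auto
  have cont2: "continuous_on S ?h" for S
    by (intro continuous_intros contPhi) auto
  \<comment> \<open>On the middle third the sine is at least 1/2, and \<open>?h\<close> is
    nonnegative on the whole side; this costs the factor 2 that turns 9 into 18.\<close>
  have "integral {b+1..b+2} (\<lambda>y. Re (\<Phi> (Complex x y))) \<le> integral {b+1..b+2} (\<lambda>y. 2 * (Re (\<Phi> (Complex x y)) * sin (pi * (y - b) / 3)))"
  proof (rule integral_le)
    show "(\<lambda>y. Re (\<Phi> (Complex x y))) integrable_on {b+1..b+2}"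
      by (intro integrable_continuous_interval contPhi)
    show "(\<lambda>y. 2 * (Re (\<Phi> (Complex x y)) * sin (pi * (y - b) / 3))) integrable_on {b+1..b+2}"
      by (intro integrable_continuous_interval continuous_intros cont2)
    fix y assume y: "y \<in> {b+1..b+2}"
    have "sin (pi * (y - b) / 3) \<ge> 1/2"
      using y mult_left_mono [of "y - b" 2 pi] mult_left_mono [of 1 "y - b" pi] by (intro sin_ge_half) auto
    then have "Re (\<Phi> (Complex x y)) * (1/2) \<le> Re (\<Phi> (Complex x y)) * sin (pi * (y - b) / 3)"
      using pos [of "Complex x y"] x by (intro mult_left_mono) auto
    then show "Re (\<Phi> (Complex x y)) \<le> 2 * (Re (\<Phi> (Complex x y)) * sin (pi * (y - b) / 3))" by simp
  qed
  also have "\<dots> = 2 * integral {b+1..b+2} ?h"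
    by (rule integral_mult_right)
  also have "integral {b+1..b+2} ?h \<le> integral {b..b+3} ?h"
  proof (rule integral_subset_le)
    show "\<forall>y\<in>{b..b+3}. 0 \<le> Re (\<Phi> (Complex x y)) * sin (pi * (y - b) / 3)"
      using sin0 pos x by (intro ballI mult_nonneg_nonneg) (auto intro: less_imp_le)
  qed (auto intro!: integrable_continuous_interval cont2)
  finally show ?thesis using main by (simp add: c_def)
qed

subsection \<open>The logarithmic derivative near the critical line under the Riemann hypothesis\<close>

abbreviation zeta_ld :: "complex \<Rightarrow> complex" where
  "zeta_ld w \<equiv> deriv zeta_reg w / zeta_reg w"

text \<open>Non-vanishing on a convex half-plane provides a holomorphic logarithm \<open>H\<close>
  of \<open>zeta_reg\<close>, and \<open>norm_zeta_reg_le\<close> makes the real part positive. The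
  argument is shifted by 1/2 so that the critical line becomes the imaginary axis.\<close>

lemma zeta_positive_real_part:
  assumes RH: riemann_hypothesis
  obtains \<Phi> M where "M > 0" "\<Phi> holomorphic_on {z. Re z > 0}" "\<And>z. Re z > 0 \<Longrightarrow> Re (\<Phi> z) > 0"
    "\<And>z. Re z > 0 \<Longrightarrow> Re (\<Phi> z) = ln M + 2 * ln (norm (z + 3/2)) - ln (norm (zeta_reg (z + 1/2)))"
    "\<And>z. Re z > 0 \<Longrightarrow> deriv \<Phi> z = 2 / (z + 3/2) - zeta_ld (z + 1/2)"
proof -
  let ?U = "{z. Re z > 0}"
  obtain M where M: "M > 0" "\<And>s. Re s \<ge> 1/2 \<Longrightarrow> norm (zeta_reg s) < M * (norm (s + 1))^2"
    using norm_zeta_reg_le by blast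
  define F where "F z = zeta_reg (z + 1/2)" for z
  have Fhol: "F holomorphic_on ?U"
  proof -
    have "(zeta_reg \<circ> (\<lambda>z. z + 1/2)) holomorphic_on ?U"
      by (rule holomorphic_on_compose_gen [OF _ zeta_reg_holomorphic]) (auto intro!: holomorphic_intros)
    then show ?thesis by (simp add: o_def F_def [abs_def])
  qed
  have Fnz: "F z \<noteq> 0" if "Re z > 0" for z
    unfolding F_def using that by (intro zeta_reg_nonzero RH) auto
  have "convex ?U" by (rule convex_halfspace_Re_gt)
  then obtain H where H: "H holomorphic_on ?U" "\<And>z. z \<in> ?U \<Longrightarrow> F z = exp (H z)"
    using holomorphic_logarithm_exists [OF _ open_halfspace_Re_gt Fhol, of 1] Fnz
    by (smt (verit, best) mem_Collect_eq one_complex.sel(1))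
  define \<Phi> where "\<Phi> z = of_real (ln M) + 2 * ln (z + 3/2) - H z" for z
  have ne: "z + 3/2 \<notin> \<real>\<^sub>\<le>\<^sub>0" if "Re z > 0" for z
    using that by (auto simp: complex_nonpos_Reals_iff)
  have re: "Re (\<Phi> z) = ln M + 2 * ln (norm (z + 3/2)) - ln (norm (zeta_reg (z + 1/2)))" if z: "Re z > 0" for z
  proof -
    have "z + 3/2 \<noteq> 0" using ne [OF z] by auto
    then have "Re (ln (z + 3/2)) = ln (norm (z + 3/2))" by simp
    moreover have "norm (zeta_reg (z + 1/2)) = exp (Re (H z))"
      using H(2) [of z] z by (simp add: F_def)
    ultimately show ?thesis by (simp add: \<Phi>_def)
  qed
  show thesis
  proof
    show "M > 0" by fact
    show "\<Phi> holomorphic_on ?U"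
      unfolding \<Phi>_def using ne by (intro holomorphic_intros H) auto
    fix z assume z: "Re z > 0"
    have nz: "z + 3/2 \<noteq> 0" using ne [OF z] by auto
    show "Re (\<Phi> z) = ln M + 2 * ln (norm (z + 3/2)) - ln (norm (zeta_reg (z + 1/2)))" by (rule re [OF z])
    have "norm (zeta_reg (z + 1/2)) < M * (norm (z + 3/2))^2"
      using M(2) [of "z + 1/2"] z by (simp add: add.assoc)
    moreover have "norm (zeta_reg (z + 1/2)) > 0" using Fnz [OF z] by (simp add: F_def)
    ultimately have "ln (norm (zeta_reg (z + 1/2))) < ln (M * (norm (z + 3/2))^2)"
      by (subst ln_less_cancel_iff) linarith+
    also have "\<dots> = ln M + 2 * ln (norm (z + 3/2))"
      using M nz by (subst ln_mult) (auto simp: ln_realpow)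
    finally show "Re (\<Phi> z) > 0" unfolding re [OF z] by simp
    have oU: "open ?U" by (rule open_halfspace_Re_gt)
    have zU: "z \<in> ?U" using z by simp
    have dH: "(H has_field_derivative deriv H z) (at z)"
      by (rule holomorphic_derivI [OF H(1) oU zU])
    then have "((\<lambda>z. exp (H z)) has_field_derivative (exp (H z) * deriv H z)) (at z)"
      by (auto intro!: derivative_eq_intros)
    then have "(F has_field_derivative (exp (H z) * deriv H z)) (at z)"
      by (rule has_field_derivative_transform_within_open [OF _ oU zU]) (use H(2) in auto)
    moreover have "(F has_field_derivative deriv zeta_reg (z + 1/2)) (at z)"
    proof -
      have "(zeta_reg has_field_derivative deriv zeta_reg (z + 1/2)) (at (z + 1/2))"
        using z by (intro holomorphic_derivI [OF zeta_reg_holomorphic open_halfspace_Re_gt]) auto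
      then show ?thesis unfolding F_def [abs_def] by (simp add: DERIV_shift)
    qed
    ultimately have "exp (H z) * deriv H z = deriv zeta_reg (z + 1/2)" by (rule DERIV_unique)
    moreover have "exp (H z) = zeta_reg (z + 1/2)" using H(2) [OF zU] by (simp add: F_def)
    moreover have "zeta_reg (z + 1/2) \<noteq> 0" using Fnz [OF z] by (simp add: F_def)
    ultimately have dHe: "deriv H z = zeta_ld (z + 1/2)" by (simp add: field_simps)
    have "((\<lambda>z. ln (z + 3/2)) has_field_derivative inverse (z + 3/2)) (at z)"
      using has_field_derivative_Ln [OF ne [OF z]] by (subst (asm) DERIV_shift)
    then have "(\<Phi> has_field_derivative (0 + 2 * inverse (z + 3/2) - deriv H z)) (at z)"
      unfolding \<Phi>_def [abs_def] by (intro DERIV_diff DERIV_add DERIV_const DERIV_cmult dH)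
    then have "(\<Phi> has_field_derivative (2 / (z + 3/2) - deriv H z)) (at z)"
      by (simp only: add_0 divide_inverse [of 2 "z + 3/2"])
    then show "deriv \<Phi> z = 2 / (z + 3/2) - zeta_ld (z + 1/2)"
      unfolding dHe by (rule DERIV_imp_deriv)
  qed
qed

lemma zeta_ld_holomorphic:
  assumes RH: riemann_hypothesis
  shows "(\<lambda>w. zeta_ld w) holomorphic_on {w. Re w > 1/2}"
  using zeta_reg_nonzero [OF RH]
  by (intro holomorphic_intros holomorphic_deriv holomorphic_on_subset [OF zeta_reg_holomorphic] open_halfspace_Re_gt) auto

lemma zeta_ld_continuous:
  assumes RH: riemann_hypothesis and x: "x > 0"
  shows "continuous_on S (\<lambda>t. zeta_ld (Complex (1/2 + x) t))"
  using x by (intro continuous_on_vertical [OF zeta_ld_holomorphic [OF RH]]) auto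

text \<open>The pointwise bound is poor in x and serves to remove the horizontal sides when the line
  is shifted with x fixed, hence the range up to 3/2. The mean bound is uniform in x and controls
  large t. Growth like a square root is harmless against the weight 1 / t^2.\<close>

lemma zeta_ld_bounds:
  assumes RH: riemann_hypothesis
  obtains C where "C > 0"
    "\<And>x t. 0 < x \<Longrightarrow> x \<le> 3/2 \<Longrightarrow> norm (zeta_ld (Complex (1/2 + x) t)) \<le> C / x\<^sup>2 * sqrt (1 + \<bar>t\<bar>)"
    "\<And>x b. 0 < x \<Longrightarrow> x \<le> 1 \<Longrightarrow> x * integral {b..b+1} (\<lambda>t. norm (zeta_ld (Complex (1/2 + x) t))) \<le> C * sqrt (2 + \<bar>b\<bar>)"
proof -
  obtain \<Phi> M where M: "M > 0" and hol: "\<Phi> holomorphic_on {z. Re z > 0}"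
    and pos: "\<And>z. Re z > 0 \<Longrightarrow> Re (\<Phi> z) > 0"
    and re: "\<And>z. Re z > 0 \<Longrightarrow> Re (\<Phi> z) = ln M + 2 * ln (norm (z + 3/2)) - ln (norm (zeta_reg (z + 1/2)))"
    and der: "\<And>z. Re z > 0 \<Longrightarrow> deriv \<Phi> z = 2 / (z + 3/2) - zeta_ld (z + 1/2)"
    using zeta_positive_real_part [OF RH] by metis
  define C0 where "C0 = \<bar>ln M\<bar> + 2 * ln 6 + 4 + ln (4 :: real)"
  have "ln (6::real) \<ge> 0" "ln (4::real) \<ge> 0" by auto
  then have C0: "C0 \<ge> 4" by (simp add: C0_def)
  have far: "Re (\<Phi> z) \<le> C0 * sqrt (1 + \<bar>Im z\<bar>)" if z: "3/2 \<le> Re z" "Re z \<le> 4" for z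
  proof -
    define q where "q = sqrt (1 + \<bar>Im z\<bar>)"
    have q1: "q \<ge> 1" by (simp add: q_def)
    have "norm (z + 3/2) \<le> \<bar>Re (z + 3/2)\<bar> + \<bar>Im (z + 3/2)\<bar>" by (rule cmod_le)
    also have "\<dots> \<le> 6 * (1 + \<bar>Im z\<bar>)" using z by simp
    finally have n: "norm (z + 3/2) \<le> 6 * (1 + \<bar>Im z\<bar>)" .
    have "Re (z + 3/2) > 0" using z by simp
    then have "z + 3/2 \<noteq> 0" by (metis less_irrefl zero_complex.sel(1))
    then have "ln (norm (z + 3/2)) \<le> ln (6 * (1 + \<bar>Im z\<bar>))" using n by (subst ln_le_cancel_iff) auto
    also have "\<dots> = ln 6 + ln (1 + \<bar>Im z\<bar>)" by (subst ln_mult) auto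
    also have "ln (1 + \<bar>Im z\<bar>) \<le> 2 * q" unfolding q_def by (rule ln_le_2_sqrt) simp
    finally have a: "ln (norm (z + 3/2)) \<le> ln 6 + 2 * q" by simp
    have "norm (zeta_reg (z + 1/2)) \<ge> 1/4" using z by (intro norm_zeta_reg_ge) simp
    then have "ln (norm (zeta_reg (z + 1/2))) \<ge> ln (1/4)" by (subst ln_le_cancel_iff) auto
    then have b: "- ln (norm (zeta_reg (z + 1/2))) \<le> ln 4" by (simp add: ln_div)
    have "Re z > 0" using z by simp
    from re [OF this] have "Re (\<Phi> z) \<le> (\<bar>ln M\<bar> + 2 * ln 6 + ln 4) * 1 + 4 * q" using a b by (simp add: algebra_simps)
    also have "\<dots> \<le> (\<bar>ln M\<bar> + 2 * ln 6 + ln 4) * q + 4 * q"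
      using q1 \<open>ln 6 \<ge> 0\<close> \<open>ln 4 \<ge> 0\<close> by (intro add_mono mult_left_mono) auto
    also have "\<dots> = C0 * q" by (simp add: C0_def algebra_simps)
    finally show ?thesis by (simp add: q_def)
  qed
  have ball_sub: "ball c (Re c) \<subseteq> {z. Re z > 0}" for c
  proof
    fix z assume "z \<in> ball c (Re c)"
    then show "z \<in> {z. Re z > 0}" using complex_Re_le_cmod [of "c - z"] by (simp add: dist_norm)
  qed
  \<comment> \<open>Harnack in the disc of radius 2 about \<open>Complex 2 y\<close>: with \<rho> =
    1 - x / 2 the factor (1 + \<rho>) / (1 - \<rho>) is (4 - x) / x.\<close>
  have near: "Re (\<Phi> (Complex x y)) \<le> 4 / x * (C0 * sqrt (1 + \<bar>y\<bar>))" if x: "0 < x" "x \<le> 3/2" for x y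
  proof -
    define c where "c = Complex 2 y"
    define \<rho> where "\<rho> = (2 - x) / 2"
    have posc: "Re (\<Phi> c) > 0" using pos [of c] by (simp add: c_def)
    have "norm (\<Phi> (Complex x y) - \<i> * of_real (Im (\<Phi> c))) \<le> (1 + \<rho>) / (1 - \<rho>) * Re (\<Phi> c)"
    proof (rule Schwarz_positive_real_part(2) [where \<Phi> = \<Phi> and c = c and r = 2])
      have s: "ball c 2 \<subseteq> {z. Re z > 0}" using ball_sub [of c] by (simp add: c_def)
      show "\<Phi> holomorphic_on ball c 2" by (rule holomorphic_on_subset [OF hol s])
      show "Re (\<Phi> z) > 0" if "z \<in> ball c 2" for z using s that pos by auto
      have "Complex x y - c = of_real (x - 2)" by (simp add: c_def complex_eq_iff)
      then have "norm (Complex x y - c) = \<bar>x - 2\<bar>" by (simp only: norm_of_real)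
      then show "norm (Complex x y - c) \<le> \<rho> * 2" using x by (simp add: \<rho>_def)
    qed (use x in \<open>auto simp: \<rho>_def\<close>)
    moreover have "Re (\<Phi> (Complex x y)) \<le> norm (\<Phi> (Complex x y) - \<i> * of_real (Im (\<Phi> c)))"
      using complex_Re_le_cmod [of "\<Phi> (Complex x y) - \<i> * of_real (Im (\<Phi> c))"] by simp
    moreover have "(1 + \<rho>) / (1 - \<rho>) * Re (\<Phi> c) \<le> 4 / x * Re (\<Phi> c)"
      using x posc by (intro mult_right_mono) (auto simp: \<rho>_def field_simps)
    moreover have "4 / x * Re (\<Phi> c) \<le> 4 / x * (C0 * sqrt (1 + \<bar>y\<bar>))"
      using far [of c] x by (intro mult_left_mono) (auto simp: c_def)
    ultimately show ?thesis by linarith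
  qed
  \<comment> \<open>The disc about z of radius x = Re z is the largest one inside the half-plane.
    The summand 2 / (z + 3/2) comes from the logarithm added in \<open>\<Phi>\<close> and is at most
    2.\<close>
  have ld: "norm (zeta_ld (Complex (1/2 + x) t)) \<le> 2 + 2 / x * Re (\<Phi> (Complex x t))" if x: "0 < x" for x t
  proof -
    define z where "z = Complex x t"
    have zz: "z + 1/2 = Complex (1/2 + x) t" by (simp add: z_def complex_eq_iff)
    have "norm (deriv \<Phi> z) \<le> 2 * Re (\<Phi> z) / x"
    proof (rule Schwarz_positive_real_part(1))
      have s: "ball z x \<subseteq> {z. Re z > 0}" using ball_sub [of z] by (simp add: z_def)
      show "\<Phi> holomorphic_on ball z x" by (rule holomorphic_on_subset [OF hol s])
      show "Re (\<Phi> w) > 0" if "w \<in> ball z x" for w using s that pos by auto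
    qed (rule x)
    moreover have "deriv \<Phi> z = 2 / (z + 3/2) - zeta_ld (z + 1/2)" using x by (intro der) (simp add: z_def)
    moreover have "norm (2 / (z + 3/2)) \<le> 2"
    proof -
      have "norm (z + 3/2) \<ge> 1" using complex_Re_le_cmod [of "z + 3/2"] x by (simp add: z_def)
      then have "2 / norm (z + 3/2) \<le> 2 / 1" by (intro divide_left_mono) auto
      then show ?thesis by (simp only: norm_divide) simp
    qed
    moreover have "norm (zeta_ld (z + 1/2)) \<le> norm (2 / (z + 3/2)) + norm (2 / (z + 3/2) - zeta_ld (z + 1/2))"
      using norm_triangle_ineq4 [of "2 / (z + 3/2)" "2 / (z + 3/2) - zeta_ld (z + 1/2)"] by simp
    ultimately have "norm (zeta_ld (z + 1/2)) \<le> 2 + 2 * Re (\<Phi> z) / x" by simp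
    then show ?thesis unfolding zz by (simp add: z_def)
  qed
  define C where "C = 8 * C0 + 5 + 36 * exp pi * C0 * 2"
  have "C > 0" using C0 by (auto simp: C_def intro!: add_pos_nonneg mult_nonneg_nonneg)
  moreover have "norm (zeta_ld (Complex (1/2 + x) t)) \<le> C / x\<^sup>2 * sqrt (1 + \<bar>t\<bar>)" if x: "0 < x" "x \<le> 3/2" for x t
  proof -
    define q where "q = sqrt (1 + \<bar>t\<bar>)"
    have q1: "q \<ge> 1" by (simp add: q_def)
    have "norm (zeta_ld (Complex (1/2 + x) t)) \<le> 2 + 2 / x * (4 / x * (C0 * q))"
      using ld [OF x(1), of t] mult_left_mono [OF near [OF x, of t], of "2 / x"] x by (simp add: q_def)
    also have "2 / x * (4 / x * (C0 * q)) = 8 * C0 / x\<^sup>2 * q" by (simp add: power2_eq_square)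
    also have "2 \<le> 5 / x\<^sup>2 * q"
    proof -
      have "x\<^sup>2 \<le> (3/2)\<^sup>2" using x by (intro power_mono) auto
      then have "2 * x\<^sup>2 \<le> 5" by (simp add: power2_eq_square)
      then have "2 \<le> 5 / x\<^sup>2" using x by (simp add: field_simps)
      also have "\<dots> \<le> 5 / x\<^sup>2 * q" using mult_left_mono [OF q1, of "5 / x\<^sup>2"] by simp
      finally show ?thesis .
    qed
    finally have "norm (zeta_ld (Complex (1/2 + x) t)) \<le> (5 + 8 * C0) / x\<^sup>2 * q"
      by (simp add: add_divide_distrib algebra_simps)
    also have "\<dots> \<le> C / x\<^sup>2 * q"
      using q1 C0 by (intro mult_right_mono divide_right_mono) (auto simp: C_def)
    finally show ?thesis by (simp add: q_def)
  qed
  moreover have "x * integral {b..b+1} (\<lambda>t. norm (zeta_ld (Complex (1/2 + x) t))) \<le> C * sqrt (2 + \<bar>b\<bar>)" if x: "0 < x" "x \<le> 1" for x b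
  proof -
    define q where "q = sqrt (2 + \<bar>b\<bar>)"
    have q1: "q \<ge> 1" by (simp add: q_def)
    have contPhi: "continuous_on S (\<lambda>t. Re (\<Phi> (Complex x t)))" for S
      by (intro continuous_on_Re continuous_on_vertical [OF hol]) (use x in auto)
    have contld: "continuous_on S (\<lambda>t. norm (zeta_ld (Complex (1/2 + x) t)))" for S
      by (intro continuous_on_norm zeta_ld_continuous RH x)
    \<comment> \<open>\<open>{b..b+1}\<close> is the middle third of the segment of length 3 that
      starts at \<open>b - 1\<close>.\<close>
    have "integral {b..b+1} (\<lambda>t. Re (\<Phi> (Complex x t))) \<le> 18 * exp pi * Re (\<Phi> (Complex (x + 3) (b + 1/2)))"
      using vertical_integral_positive_real_part [OF hol pos x(1), of "b - 1"] by (simp add: add.commute)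
    also have "Re (\<Phi> (Complex (x + 3) (b + 1/2))) \<le> C0 * sqrt (1 + \<bar>b + 1/2\<bar>)"
      using far [of "Complex (x + 3) (b + 1/2)"] x by simp
    also have "sqrt (1 + \<bar>b + 1/2\<bar>) \<le> q" unfolding q_def by simp
    finally have I: "integral {b..b+1} (\<lambda>t. Re (\<Phi> (Complex x t))) \<le> 18 * exp pi * (C0 * q)"
      using C0 by (simp add: mult_left_mono)
    have "integral {b..b+1} (\<lambda>t. norm (zeta_ld (Complex (1/2 + x) t))) \<le> integral {b..b+1} (\<lambda>t. 2 + 2 / x * Re (\<Phi> (Complex x t)))"
      by (intro integral_le integrable_continuous_interval contld continuous_intros contPhi ld) (use x in auto)
    also have "\<dots> = 2 + 2 / x * integral {b..b+1} (\<lambda>t. Re (\<Phi> (Complex x t)))"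
    proof -
      have "(\<lambda>t. Re (\<Phi> (Complex x t))) integrable_on {b..b+1}"
        by (intro integrable_continuous_interval contPhi)
      then have "(\<lambda>t. 2 / x * Re (\<Phi> (Complex x t))) integrable_on {b..b+1}" by (rule integrable_on_mult_right)
      then have "integral {b..b+1} (\<lambda>t. 2 + 2 / x * Re (\<Phi> (Complex x t))) = integral {b..b+1} (\<lambda>t. 2) + integral {b..b+1} (\<lambda>t. 2 / x * Re (\<Phi> (Complex x t)))"
        by (intro integral_add) auto
      then show ?thesis by simp
    qed
    finally have "x * integral {b..b+1} (\<lambda>t. norm (zeta_ld (Complex (1/2 + x) t))) \<le> x * (2 + 2 / x * integral {b..b+1} (\<lambda>t. Re (\<Phi> (Complex x t))))"
      using x by (intro mult_left_mono) auto
    also have "\<dots> = 2 * x + 2 * integral {b..b+1} (\<lambda>t. Re (\<Phi> (Complex x t)))"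
      using x by (simp add: field_simps)
    also have "\<dots> \<le> 2 * q + 2 * (18 * exp pi * (C0 * q))" using I x q1 by (intro add_mono mult_left_mono) auto
    also have "\<dots> = (2 + 36 * exp pi * C0) * q" by (simp add: algebra_simps)
    also have "\<dots> \<le> C * q" using C0 q1 by (intro mult_right_mono) (auto simp: C_def)
    finally show ?thesis by (simp add: q_def)
  qed
  ultimately show thesis by (rule that)
qed

section \<open>Local behaviour of logarithmic derivatives and the weighted integral for bounded and
  large t\<close>

lemma holomorphic_locally_bounded:
  assumes "g holomorphic_on S" "open S" "z0 \<in> S"
  obtains r C where "r > 0" "ball z0 r \<subseteq> S" "\<And>w. w \<in> ball z0 r \<Longrightarrow> norm (g w) \<le> C"
proof -
  obtain r where r: "r > 0" "cball z0 r \<subseteq> S" using assms open_contains_cball by blast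
  have "compact (g ` cball z0 r)"
    using r assms(1) by (intro compact_continuous_image holomorphic_on_imp_continuous_on holomorphic_on_subset [OF assms(1)]) auto
  then have "bounded (g ` cball z0 r)" by (rule compact_imp_bounded)
  then obtain C where "\<forall>w\<in>cball z0 r. norm (g w) \<le> C" unfolding bounded_iff by auto
  then show thesis using r by (intro that [of r C]) (auto simp: subset_iff)
qed

lemma log_deriv_locally_bounded:
  assumes f: "f holomorphic_on S" "open S" "z0 \<in> S" "f z0 \<noteq> 0"
  obtains r C where "r > 0" "ball z0 r \<subseteq> S" "\<And>w. w \<in> ball z0 r \<Longrightarrow> norm (deriv f w / f w) \<le> C"
proof -
  have "open {w \<in> S. f w \<noteq> 0}"
  proof -
    have "open (S \<inter> f -` (- {0}))"
      using f by (intro continuous_open_preimage holomorphic_on_imp_continuous_on) auto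
    moreover have "S \<inter> f -` (- {0}) = {w \<in> S. f w \<noteq> 0}" by auto
    ultimately show ?thesis by simp
  qed
  moreover have "(\<lambda>w. deriv f w / f w) holomorphic_on {w \<in> S. f w \<noteq> 0}"
    using f by (intro holomorphic_intros holomorphic_on_subset [OF holomorphic_deriv [OF f(1,2)]] holomorphic_on_subset [OF f(1)]) auto
  ultimately obtain r C where "r > 0" "ball z0 r \<subseteq> {w \<in> S. f w \<noteq> 0}" "\<And>w. w \<in> ball z0 r \<Longrightarrow> norm (deriv f w / f w) \<le> C"
    using holomorphic_locally_bounded [of "\<lambda>w. deriv f w / f w" "{w \<in> S. f w \<noteq> 0}" z0] f by auto
  then show thesis by (intro that [of r C]) auto
qed

text \<open>Near a zero of order n, f = (w - z0)^n g with g non-vanishing, whence (w - z0) f' / f =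
  n + (w - z0) g' / g.\<close>

lemma log_deriv_simple_pole:
  assumes f: "f holomorphic_on S" "open S" "connected S" "z0 \<in> S" and nc: "z1 \<in> S" "f z1 \<noteq> 0"
  obtains r C where "r > 0" "ball z0 r \<subseteq> S" "\<And>w. w \<in> ball z0 r \<Longrightarrow> norm (deriv f w / f w) * norm (w - z0) \<le> C"
proof (cases "f z0 = 0")
  case False
  obtain r C where rC: "r > 0" "ball z0 r \<subseteq> S" "\<And>w. w \<in> ball z0 r \<Longrightarrow> norm (deriv f w / f w) \<le> C"
    using log_deriv_locally_bounded [OF f(1,2,4) False] by blast
  show thesis
  proof (rule that [OF rC(1,2)])
    fix w assume w: "w \<in> ball z0 r"
    show "norm (deriv f w / f w) * norm (w - z0) \<le> C * r"
      using rC(3) [OF w] w order_trans [OF norm_ge_zero rC(3) [OF w]]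
      by (intro mult_mono) (auto simp: dist_norm norm_minus_commute)
  qed
next
  case True
  have "\<not> f constant_on S" using True f(4) nc by (metis constant_on_def)
  then obtain g r n where g: "0 < r" "ball z0 r \<subseteq> S" "g holomorphic_on ball z0 r"
     "\<And>w. w \<in> ball z0 r \<Longrightarrow> f w = (w - z0) ^ n * g w" "\<And>w. w \<in> ball z0 r \<Longrightarrow> g w \<noteq> 0" "0 < n"
    using holomorphic_factor_zero_nonconstant [OF f True] by metis
  obtain r' C where rC: "r' > 0" "ball z0 r' \<subseteq> ball z0 r" "\<And>w. w \<in> ball z0 r' \<Longrightarrow> norm (deriv g w / g w) \<le> C"
    using log_deriv_locally_bounded [OF g(3), of z0] g(1) g(5) [of z0] by auto
  show thesis
  proof (rule that [OF rC(1)])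
    show "ball z0 r' \<subseteq> S" using rC g by blast
    fix w assume w: "w \<in> ball z0 r'"
    have C0: "C \<ge> 0" using order_trans [OF norm_ge_zero rC(3) [OF w]] .
    show "norm (deriv f w / f w) * norm (w - z0) \<le> real n + C * r'"
    proof (cases "w = z0")
      case True
      then show ?thesis using C0 rC(1) by simp
    next
      case False
      have wr: "w \<in> ball z0 r" using w rC by blast
      obtain m where m: "n = Suc m" using g(6) by (cases n) auto
      have ratio: "(of_nat n * h ^ m * G + h ^ n * D) / (h ^ n * G) * h = of_nat n + D / G * h"
        if "h \<noteq> 0" "G \<noteq> 0" for h G D :: complex
        using that unfolding m by (simp add: field_simps)
      have dg: "(g has_field_derivative deriv g w) (at w)"
        by (rule holomorphic_derivI [OF g(3) open_ball wr])
      have "((\<lambda>w. (w - z0) ^ n) has_field_derivative (of_nat n * (1 * (w - z0) ^ (n - Suc 0)))) (at w)"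
        by (intro DERIV_power) (auto intro!: derivative_eq_intros)
      from DERIV_mult [OF this dg]
      have "((\<lambda>w. (w - z0) ^ n * g w) has_field_derivative (of_nat n * (w - z0) ^ m * g w + (w - z0) ^ n * deriv g w)) (at w)"
        by (simp add: m mult.commute)
      then have "(f has_field_derivative (of_nat n * (w - z0) ^ m * g w + (w - z0) ^ n * deriv g w)) (at w)"
        by (rule has_field_derivative_transform_within_open [OF _ open_ball wr]) (simp add: g(4))
      then have "deriv f w = of_nat n * (w - z0) ^ m * g w + (w - z0) ^ n * deriv g w" by (rule DERIV_imp_deriv)
      then have "deriv f w / f w * (w - z0) = of_nat n + deriv g w / g w * (w - z0)"
        unfolding g(4) [OF wr] using ratio [of "w - z0" "g w"] g(5) [OF wr] False by simp
      then have "norm (deriv f w / f w) * norm (w - z0) = norm (of_nat n + deriv g w / g w * (w - z0))"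
        by (simp flip: norm_mult)
      also have "\<dots> \<le> real n + norm (deriv g w / g w) * norm (w - z0)"
        by (rule order_trans [OF norm_triangle_ineq]) (simp only: norm_mult norm_of_nat order_refl)
      also have "\<dots> \<le> real n + C * r'"
        using rC(3) [OF w] w C0 by (intro add_left_mono mult_mono) (auto simp: dist_norm norm_minus_commute)
      finally show ?thesis .
    qed
  qed
qed

text \<open>Phrased with local bounds in place of continuity because (Re w - 1/2) |f' / f| is
  discontinuous at a zero on the critical line.\<close>

lemma compact_locally_bounded_imp_bounded:
  fixes m :: "'a::metric_space \<Rightarrow> real"
  assumes K: "compact K" and loc: "\<And>z. z \<in> K \<Longrightarrow> \<exists>r>0. \<exists>C. \<forall>w\<in>K \<inter> ball z r. m w \<le> C"
  shows "\<exists>C. \<forall>w\<in>K. m w \<le> C"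
proof -
  obtain r C where rC: "\<And>z. z \<in> K \<Longrightarrow> r z > 0 \<and> (\<forall>w\<in>K \<inter> ball z (r z). m w \<le> C z)"
    using loc by metis
  have "K \<subseteq> (\<Union>z\<in>K. ball z (r z))" using rC by fastforce
  then obtain D where D: "D \<subseteq> K" "finite D" "K \<subseteq> (\<Union>z\<in>D. ball z (r z))"
    using compactE_image [OF K, of K "\<lambda>z. ball z (r z)"] by auto
  have "m w \<le> Max (insert 0 (C ` D))" if w: "w \<in> K" for w
  proof -
    obtain z where z: "z \<in> D" "w \<in> ball z (r z)" using D w by blast
    then have "m w \<le> C z" using rC [of z] D w by auto
    also have "\<dots> \<le> Max (insert 0 (C ` D))" using z D by (intro Max_ge) auto
    finally show ?thesis .
  qed
  then show ?thesis by blast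
qed

text \<open>On Re w = 1/2 + x the modulus of \<open>zeta_perron u\<close> is exp (x u) / x times
  this weight; with x = 1 / u that factor is exp 1 * u.\<close>

definition ld_weight :: "real \<Rightarrow> real \<Rightarrow> real" where
  "ld_weight x t = x * norm (zeta_ld (Complex (1/2 + x) t)) / (norm (Complex x t) * norm (Complex (1/2 + x) t))"

lemma ld_weight_nonneg: "x \<ge> 0 \<Longrightarrow> ld_weight x t \<ge> 0"
  by (simp add: ld_weight_def)

lemma ld_weight_continuous:
  assumes RH: riemann_hypothesis and x: "x > 0"
  shows "continuous_on S (ld_weight x)"
proof -
  have nz: "Complex x t \<noteq> 0" "Complex (1/2 + x) t \<noteq> 0" for t using x by (auto simp: complex_eq_iff)
  show ?thesis unfolding ld_weight_def [abs_def]
    using nz by (intro continuous_on_divide continuous_on_mult continuous_on_norm continuous_on_const zeta_ld_continuous RH x continuous_on_Complex) auto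
qed

lemma ld_weight_integrable:
  assumes "riemann_hypothesis" "x > 0"
  shows "ld_weight x integrable_on {a..b}"
  by (intro integrable_continuous_interval ld_weight_continuous assms)

text \<open>The rectangle \<open>K\<close> includes the critical line, so compactness gives a bound
  uniform in x. At a zero z on the line, Re w - 1/2 <= |w - z| cancels the simple pole of f' / f. At
  1/2 the same factor is spent on 1 / |w - 1/2|, and f' / f stays bounded by
  \<open>zeta_reg_half\<close>.\<close>

lemma ld_weight_bounded:
  assumes RH: riemann_hypothesis
  shows "\<exists>C. \<forall>x t. 0 < x \<and> x \<le> 1 \<and> \<bar>t\<bar> \<le> N \<longrightarrow> ld_weight x t \<le> C"
proof -
  define m where "m w = (Re w - 1/2) * norm (zeta_ld w) / (norm (w - 1/2) * norm w)" for w
  define K where "K = cbox (Complex (1/2) (-N)) (Complex (3/2) N)"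
  let ?S = "{w. Re w > 0}"
  have S: "open ?S" "connected ?S"
    by (simp_all add: open_halfspace_Re_gt convex_connected convex_halfspace_Re_gt)
  have z1: "1 \<in> ?S" "zeta_reg 1 \<noteq> 0" by (simp_all add: zeta_reg_1)
  have KRe: "1/2 \<le> Re w" "Re w \<le> 3/2" if "w \<in> K" for w using that by (auto simp: K_def in_cbox_complex_iff)
  have Kn: "norm w \<ge> 1/2" if "w \<in> K" for w using KRe [OF that] complex_Re_le_cmod [of w] by linarith
  have "\<exists>C. \<forall>w\<in>K. m w \<le> C"
  proof (rule compact_locally_bounded_imp_bounded)
    show "compact K" by (simp add: K_def)
    fix z assume zK: "z \<in> K"
    have zS: "z \<in> ?S" using KRe [OF zK] by simp
    show "\<exists>r>0. \<exists>C. \<forall>w\<in>K \<inter> ball z r. m w \<le> C"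
    proof (cases "z = 1/2")
      case True
      obtain r C where rC: "r > 0" "\<And>w. w \<in> ball z r \<Longrightarrow> norm (zeta_ld w) \<le> C"
        using log_deriv_locally_bounded [OF zeta_reg_holomorphic S(1) zS] zeta_reg_half True by metis
      have "m w \<le> 2 * C" if w: "w \<in> K \<inter> ball z r" for w
      proof -
        have C0: "C \<ge> 0" using order_trans [OF norm_ge_zero rC(2) [of w]] w by simp
        have "Re w - 1/2 \<le> norm (w - 1/2)" using complex_Re_le_cmod [of "w - 1/2"] by simp
        then have a: "(Re w - 1/2) / norm (w - 1/2) \<le> 1" by (simp add: divide_le_eq_1)
        have a0: "(Re w - 1/2) / norm (w - 1/2) \<ge> 0" using KRe [of w] w by simp
        have b: "norm (zeta_ld w) / norm w \<le> C / (1/2)"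
          using rC(2) [of w] w Kn [of w] C0 by (intro frac_le) auto
        have "m w = (Re w - 1/2) / norm (w - 1/2) * (norm (zeta_ld w) / norm w)" by (simp add: m_def)
        also have "\<dots> \<le> 1 * (C / (1/2))" using a a0 b C0 by (intro mult_mono) auto
        finally show ?thesis by simp
      qed
      then show ?thesis using rC(1) by blast
    next
      case False
      define d where "d = norm (z - 1/2) / 2"
      have d: "d > 0" using False by (simp add: d_def)
      obtain r C where rC: "r > 0" "\<And>w. w \<in> K \<inter> ball z r \<Longrightarrow> (Re w - 1/2) * norm (zeta_ld w) \<le> C"
      proof (cases "Re z = 1/2")
        case True
        obtain r C where rC: "r > 0" "\<And>w. w \<in> ball z r \<Longrightarrow> norm (zeta_ld w) * norm (w - z) \<le> C"
          using log_deriv_simple_pole [OF zeta_reg_holomorphic S zS z1] by metis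
        show thesis
        proof (rule that [OF rC(1)])
          fix w assume w: "w \<in> K \<inter> ball z r"
          have "Re w - 1/2 \<le> norm (w - z)" using complex_Re_le_cmod [of "w - z"] True by simp
          then have "(Re w - 1/2) * norm (zeta_ld w) \<le> norm (w - z) * norm (zeta_ld w)"
            by (intro mult_right_mono) auto
          also have "\<dots> \<le> C" using rC(2) [of w] w by (simp only: mult.commute) auto
          finally show "(Re w - 1/2) * norm (zeta_ld w) \<le> C" .
        qed
      next
        case False
        then have "Re z > 1/2" using KRe [OF zK] by simp
        then have "zeta_reg z \<noteq> 0" by (rule zeta_reg_nonzero [OF RH])
        then obtain r C where rC: "r > 0" "\<And>w. w \<in> ball z r \<Longrightarrow> norm (zeta_ld w) \<le> C"
          using log_deriv_locally_bounded [OF zeta_reg_holomorphic S(1) zS] by metis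
        show thesis
        proof (rule that [OF rC(1)])
          fix w assume w: "w \<in> K \<inter> ball z r"
          have "(Re w - 1/2) * norm (zeta_ld w) \<le> 1 * C"
            using KRe [of w] w rC(2) [of w] by (intro mult_mono) auto
          then show "(Re w - 1/2) * norm (zeta_ld w) \<le> C" by simp
        qed
      qed
      have "m w \<le> \<bar>C\<bar> / (d * (1/2))" if w: "w \<in> K \<inter> ball z (min r d)" for w
      proof -
        have "norm (z - w) < d" using w by (simp add: dist_norm)
        moreover have "norm (z - 1/2) \<le> norm (z - w) + norm (w - 1/2)"
          using norm_triangle_ineq [of "z - w" "w - 1/2"] by simp
        ultimately have "norm (w - 1/2) \<ge> d" by (simp add: d_def)
        then show ?thesis unfolding m_def
          using rC(2) [of w] w Kn [of w] d by (intro frac_le mult_mono) auto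
      qed
      moreover have "min r d > 0" using rC(1) d by simp
      ultimately show ?thesis by blast
    qed
  qed
  then obtain C where C: "\<And>w. w \<in> K \<Longrightarrow> m w \<le> C" by blast
  have "ld_weight x t \<le> C" if "0 < x" "x \<le> 1" "\<bar>t\<bar> \<le> N" for x t
  proof -
    have "Complex (1/2 + x) t - 1/2 = Complex x t" by (simp add: complex_eq_iff)
    then have "ld_weight x t = m (Complex (1/2 + x) t)" by (simp add: ld_weight_def m_def)
    moreover have "Complex (1/2 + x) t \<in> K" using that by (auto simp: K_def in_cbox_complex_iff)
    ultimately show ?thesis using C by simp
  qed
  then show ?thesis by blast
qed

text \<open>Makes the ordinates of zeros a null set, to be discarded in the dominated convergence
  argument. If \<open>zeta_reg\<close> were constant, its value 1 at 1 would exclude zeros.\<close>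

lemma countable_critical_zeros: "countable {t. zeta_reg (Complex (1/2) t) = 0}"
proof -
  let ?S = "{w. Re w > 0}"
  have "countable {z\<in>?S. zeta_reg z = 0}"
  proof (cases "zeta_reg constant_on ?S")
    case True
    have "(1::complex) \<in> ?S" by simp
    then have "zeta_reg z = 1" if "z \<in> ?S" for z using True that zeta_reg_1 unfolding constant_on_def by metis
    then have "{z\<in>?S. zeta_reg z = 0} = {}" by auto
    then show ?thesis by (simp only: countable_empty)
  next
    case False
    have o: "open ?S" by (simp add: open_halfspace_Re_gt)
    obtain F :: "nat \<Rightarrow> complex set" where F: "\<And>n. compact (F n)" "\<Union> (range F) = ?S"
      using open_Union_compact_subsets [OF o] by metis
    then have "fsigma ?S" unfolding fsigma_Union_compact by (intro exI [of _ F]) auto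
    with False show ?thesis
      by (intro holomorphic_countable_zeros zeta_reg_holomorphic)
         (auto simp: open_halfspace_Re_gt convex_connected convex_halfspace_Re_gt)
  qed
  then have "countable (Im ` {z\<in>?S. zeta_reg z = 0})" by simp
  moreover have "{t. zeta_reg (Complex (1/2) t) = 0} \<subseteq> Im ` {z\<in>?S. zeta_reg z = 0}"
    by (auto intro!: image_eqI [where x = "Complex (1/2) t" for t])
  ultimately show ?thesis by (rule countable_subset [rotated])
qed

lemma ld_weight_integral_tendsto:
  assumes RH: riemann_hypothesis
  shows "((\<lambda>x. integral {-N..N} (ld_weight x)) \<longlongrightarrow> 0) (at_right 0)"
proof (rule tendsto_at_right_sequentially [of _ 1])
  fix S :: "nat \<Rightarrow> real" assume S: "\<And>n. 0 < S n" "\<And>n. S n < 1" "S \<longlonglongrightarrow> 0"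
  obtain C where C: "\<And>x t. 0 < x \<Longrightarrow> x \<le> 1 \<Longrightarrow> \<bar>t\<bar> \<le> N \<Longrightarrow> ld_weight x t \<le> C"
    using ld_weight_bounded [OF RH] by metis
  \<comment> \<open>The point 0 joins the exceptional set because 1 / |x + it| has no finite limit
    there. The integrands are set to 0 on \<open>E\<close> since
    \<open>dominated_convergence\<close> asks for convergence at every point.\<close>
  define E where "E = insert 0 {t. zeta_reg (Complex (1/2) t) = 0}"
  have "countable E" unfolding E_def by (intro countable_insert countable_critical_zeros)
  then have "negligible (\<Union> ((\<lambda>t. {t}) ` E))" by (intro negligible_countable_Union) auto
  then have negE: "negligible E" by simp
  define f where "f n t = (if t \<in> E then 0 else ld_weight (S n) t)" for n t
  have fint: "f n integrable_on {-N..N}" for n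
    by (rule integrable_spike [OF ld_weight_integrable [OF RH S(1)] negE]) (auto simp: f_def)
  have feq: "integral {-N..N} (f n) = integral {-N..N} (ld_weight (S n))" for n
    by (rule integral_spike [OF negE]) (auto simp: f_def)
  have "(\<lambda>n. integral {-N..N} (f n)) \<longlonglongrightarrow> integral {-N..N} (\<lambda>t. 0)"
  proof (rule dominated_convergence)
    show "f n integrable_on {-N..N}" for n by (rule fint)
    show "(\<lambda>t. \<bar>C\<bar>) integrable_on {-N..N}" by (rule integrable_const_ivl)
    show "norm (f n t) \<le> \<bar>C\<bar>" if "t \<in> {-N..N}" for n t
    proof -
      have "\<bar>t\<bar> \<le> N" using that by auto
      then show ?thesis
        using C [of "S n" t] S(1,2) [of n] ld_weight_nonneg [of "S n" t] by (auto simp: f_def)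
    qed
    show "(\<lambda>n. f n t) \<longlonglongrightarrow> 0" if "t \<in> {-N..N}" for t
    proof (cases "t \<in> E")
      case False
      have "zeta_reg (Complex (1/2) t) \<noteq> 0" using False by (auto simp: E_def)
      have t0: "t \<noteq> 0" using False by (auto simp: E_def)
      have "isCont (deriv zeta_reg) (Complex (1/2) t)"
        by (intro continuous_on_interior [of "{w. Re w > 0}"] holomorphic_on_imp_continuous_on holomorphic_deriv zeta_reg_holomorphic)
           (auto simp: open_halfspace_Re_gt interior_open)
      moreover have "isCont zeta_reg (Complex (1/2) t)"
        by (intro continuous_on_interior [of "{w. Re w > 0}"] holomorphic_on_imp_continuous_on zeta_reg_holomorphic)
           (auto simp: open_halfspace_Re_gt interior_open)
      ultimately have ic: "isCont (\<lambda>w. zeta_ld w) (Complex (1/2) t)"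
        using \<open>zeta_reg (Complex (1/2) t) \<noteq> 0\<close> by (intro continuous_intros)
      have cl: "(\<lambda>n. Complex (a + S n) t) \<longlonglongrightarrow> Complex (a + 0) t" for a
        by (intro tendsto_Complex tendsto_intros S)
      have l1: "(\<lambda>n. zeta_ld (Complex (1/2 + S n) t)) \<longlonglongrightarrow> zeta_ld (Complex (1/2 + 0) t)"
        using ic by (intro isCont_tendsto_compose [OF _ cl]) simp
      have l2: "(\<lambda>n. Complex (S n) t) \<longlonglongrightarrow> Complex 0 t" using cl [of 0] by simp
      have nz: "norm (Complex 0 t) * norm (Complex (1/2 + 0) t) \<noteq> 0" using t0 by (auto simp: complex_eq_iff)
      have "(\<lambda>n. ld_weight (S n) t) \<longlonglongrightarrow> 0 * norm (zeta_ld (Complex (1/2 + 0) t)) / (norm (Complex 0 t) * norm (Complex (1/2 + 0) t))"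
        unfolding ld_weight_def
        by (rule tendsto_divide [OF tendsto_mult [OF S(3) tendsto_norm [OF l1]] tendsto_mult [OF tendsto_norm [OF l2] tendsto_norm [OF cl]] nz])
      then show ?thesis using False by (simp add: f_def)
    qed (simp add: f_def)
  qed
  then show "(\<lambda>n. integral {-N..N} (ld_weight (S n))) \<longlonglongrightarrow> 0" by (simp add: feq)
qed simp

text \<open>A unit segment at height k contributes at most a constant times sqrt k / k^2, uniformly
  in x. The series converges, so its Cauchy criterion bounds the tails independently of the
  truncation.\<close>

lemma ld_weight_tail:
  assumes RH: riemann_hypothesis and e: "e > 0"
  obtains N :: nat where "N \<ge> 1"
    "\<And>x m. 0 < x \<Longrightarrow> x \<le> 1 \<Longrightarrow> integral {real N..real (N + m)} (ld_weight x) \<le> e"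
    "\<And>x m. 0 < x \<Longrightarrow> x \<le> 1 \<Longrightarrow> integral {- real (N + m)..- real N} (ld_weight x) \<le> e"
proof -
  obtain C where C: "C > 0"
    "\<And>x b. 0 < x \<Longrightarrow> x \<le> 1 \<Longrightarrow> x * integral {b..b+1} (\<lambda>t. norm (zeta_ld (Complex (1/2 + x) t))) \<le> C * sqrt (2 + \<bar>b\<bar>)"
    using zeta_ld_bounds [OF RH] by metis
  \<comment> \<open>The factor 2 comes from 2 + |b| <= k + 3 <= 4 k under the square root.\<close>
  define B where "B k = 2 * C * real k powr (- (3/2))" for k
  have piece: "integral {b..b+1} (ld_weight x) \<le> B k"
    if x: "0 < x" "x \<le> 1" and k: "k \<ge> 1" and b: "b = real k \<or> b = - real k - 1" for x b and k :: nat
  proof -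
    have "integral {b..b+1} (ld_weight x) \<le> integral {b..b+1} (\<lambda>t. x / (real k)\<^sup>2 * norm (zeta_ld (Complex (1/2 + x) t)))"
    proof (rule integral_le)
      show "ld_weight x integrable_on {b..b+1}" by (rule ld_weight_integrable [OF RH x(1)])
      show "(\<lambda>t. x / (real k)\<^sup>2 * norm (zeta_ld (Complex (1/2 + x) t))) integrable_on {b..b+1}"
        by (intro integrable_continuous_interval continuous_on_mult continuous_on_const continuous_on_norm zeta_ld_continuous RH x)
      fix t assume "t \<in> {b..b+1}"
      then have t: "\<bar>t\<bar> \<ge> real k" using b by auto
      have "norm (Complex a t) \<ge> real k" for a using abs_Im_le_cmod [of "Complex a t"] t by simp
      then have "real k * real k \<le> norm (Complex x t) * norm (Complex (1/2 + x) t)" by (intro mult_mono) auto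
      then have "ld_weight x t \<le> x * norm (zeta_ld (Complex (1/2 + x) t)) / (real k * real k)"
        unfolding ld_weight_def using x k by (intro divide_left_mono) (auto intro!: mult_pos_pos simp: complex_eq_iff)
      then show "ld_weight x t \<le> x / (real k)\<^sup>2 * norm (zeta_ld (Complex (1/2 + x) t))"
        by (simp add: power2_eq_square)
    qed
    also have "\<dots> = (x * integral {b..b+1} (\<lambda>t. norm (zeta_ld (Complex (1/2 + x) t)))) / (real k)\<^sup>2"
      by (subst integral_mult_right) simp
    also have "\<dots> \<le> (C * sqrt (2 + \<bar>b\<bar>)) / (real k)\<^sup>2" using C(2) [OF x] by (intro divide_right_mono) auto
    also have "\<dots> \<le> (C * (2 * sqrt (real k))) / (real k)\<^sup>2"
    proof -
      have "sqrt (2 + \<bar>b\<bar>) \<le> sqrt (4 * real k)" using b k by (intro real_sqrt_le_mono) auto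
      then have "sqrt (2 + \<bar>b\<bar>) \<le> 2 * sqrt (real k)" by (simp add: real_sqrt_mult)
      then show ?thesis using C(1) by (intro divide_right_mono mult_left_mono) auto
    qed
    also have "\<dots> = B k"
    proof -
      have "real k powr (1/2 - 2) = sqrt (real k) / (real k)\<^sup>2"
        unfolding powr_diff using k by (simp add: powr_half_sqrt powr_numeral)
      then show ?thesis by (simp add: B_def)
    qed
    finally show ?thesis .
  qed
  have "summable B" unfolding B_def by (intro summable_mult) (simp add: summable_real_powr_iff)
  then obtain N0 where N0: "\<And>m n. m \<ge> N0 \<Longrightarrow> norm (sum B {m..<n}) < e"
    using e unfolding summable_Cauchy by blast
  define N where "N = max N0 1"
  have Bsum: "sum B {N..<N+m} \<le> e" for m using N0 [of N "N + m"] by (auto simp: N_def)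
  have P: "integral {real N..real (N + m)} (ld_weight x) \<le> sum B {N..<N+m}" if x: "0 < x" "x \<le> 1" for x m
  proof (induction m)
    case (Suc m)
    have "integral {real N..real (N + Suc m)} (ld_weight x) = integral {real N..real (N + m)} (ld_weight x) + integral {real (N + m)..real (N + Suc m)} (ld_weight x)"
      by (intro HK_combine [symmetric] ld_weight_integrable RH x) auto
    also have "integral {real (N + m)..real (N + Suc m)} (ld_weight x) \<le> B (N + m)"
      using piece [OF x, of "N + m" "real (N + m)"] by (simp add: N_def add.commute add.left_commute)
    finally show ?case using Suc by simp
  qed simp
  have Q: "integral {- real (N + m)..- real N} (ld_weight x) \<le> sum B {N..<N+m}" if x: "0 < x" "x \<le> 1" for x m
  proof (induction m)
    case (Suc m)
    have "integral {- real (N + Suc m)..- real N} (ld_weight x) = integral {- real (N + Suc m)..- real (N + m)} (ld_weight x) + integral {- real (N + m)..- real N} (ld_weight x)"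
      by (intro HK_combine [symmetric] ld_weight_integrable RH x) auto
    also have "integral {- real (N + Suc m)..- real (N + m)} (ld_weight x) \<le> B (N + m)"
    proof -
      have e1: "- real (N + Suc m) = - real (N + m) - 1" by simp
      have e2: "- real (N + m) - 1 + 1 = - real (N + m)" by simp
      have "integral {- real (N + m) - 1..- real (N + m) - 1 + 1} (ld_weight x) \<le> B (N + m)"
        by (rule piece [OF x]) (auto simp: N_def)
      then show ?thesis unfolding e1 e2 .
    qed
    finally show ?case using Suc by simp
  qed simp
  show thesis
  proof (rule that [of N])
    show "N \<ge> 1" by (simp add: N_def)
  qed (use P Q Bsum order_trans in blast)+
qed

lemma ld_weight_integral_small:
  assumes RH: riemann_hypothesis and e: "e > 0"
  obtains d where "d > 0" "d \<le> 1" "\<And>x n. 0 < x \<Longrightarrow> x < d \<Longrightarrow> integral {- real n..real n} (ld_weight x) \<le> e"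
proof -
  obtain N :: nat where N: "N \<ge> 1"
    "\<And>x m. 0 < x \<Longrightarrow> x \<le> 1 \<Longrightarrow> integral {real N..real (N + m)} (ld_weight x) \<le> e/3"
    "\<And>x m. 0 < x \<Longrightarrow> x \<le> 1 \<Longrightarrow> integral {- real (N + m)..- real N} (ld_weight x) \<le> e/3"
    using ld_weight_tail [OF RH, of "e/3"] e by auto
  have "\<forall>\<^sub>F x in at_right 0. integral {-real N..real N} (ld_weight x) < e/3"
    by (rule order_tendstoD(2) [OF ld_weight_integral_tendsto [OF RH]]) (use e in simp)
  then obtain d where d: "d > 0" "\<And>x. 0 < x \<Longrightarrow> x < d \<Longrightarrow> integral {-real N..real N} (ld_weight x) < e/3"
    unfolding eventually_at_right_field by auto
  show thesis
  proof (rule that [of "min d 1"])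
    fix x n assume x: "0 < x" "x < min d 1"
    note int = ld_weight_integrable [OF RH x(1)]
    \<comment> \<open>Widening to \<open>N + n\<close> avoids comparing n with N and splits the
      interval into two tails and the fixed middle part.\<close>
    have "integral {- real n..real n} (ld_weight x) \<le> integral {- real (N + n)..real (N + n)} (ld_weight x)"
      using x by (intro integral_subset_le int) (auto intro: ld_weight_nonneg)
    also have "\<dots> = integral {- real (N + n)..- real N} (ld_weight x) + integral {- real N..real (N + n)} (ld_weight x)"
      by (intro HK_combine [symmetric] int) auto
    also have "integral {- real N..real (N + n)} (ld_weight x) = integral {- real N..real N} (ld_weight x) + integral {real N..real (N + n)} (ld_weight x)"
      by (intro HK_combine [symmetric] int) auto
    finally show "integral {- real n..real n} (ld_weight x) \<le> e"
      using N(2) [of x n] N(3) [of x n] d(2) [of x] x by simp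
  qed (use d in auto)
qed

section \<open>Shifting the line of integration towards the critical line\<close>

lemma zeta_perron_holomorphic:
  assumes RH: riemann_hypothesis
  shows "zeta_perron u holomorphic_on {w. Re w > 1/2}"
proof -
  have "w - z \<noteq> 0" if "Re w > Re z" for w z using that by auto
  from this [of "1/2"] this [of 0] have "w - 1/2 \<noteq> 0" "w \<noteq> 0" if "Re w > 1/2" for w using that by simp_all
  then show ?thesis unfolding zeta_perron_def [abs_def]
    by (intro holomorphic_intros zeta_ld_holomorphic RH) auto
qed

lemma norm_zeta_perron:
  "norm (zeta_perron u (Complex (1/2 + x) t)) =
     norm (zeta_ld (Complex (1/2 + x) t)) * exp (x * u) / (norm (Complex x t) * norm (Complex (1/2 + x) t))"
proof -
  have c: "Complex (1/2 + x) t - 1/2 = Complex x t" by (simp add: complex_eq_iff)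
  show ?thesis unfolding zeta_perron_def c by (simp add: norm_mult norm_divide)
qed

text \<open>Cauchy's theorem on the rectangle between the two lines. At height n the horizontal
  sides are O(sqrt n / n^2) by the pointwise bound, whose constant may depend on x and u because
  only n varies.\<close>

lemma zeta_perron_shift:
  assumes RH: riemann_hypothesis and u: "u \<ge> 0" and x: "0 < x" "x \<le> 1"
  shows "(\<lambda>n. vertical_integral (real n) 2 (zeta_perron u) - vertical_integral (real n) (1/2 + x) (zeta_perron u)) \<longlonglongrightarrow> 0"
proof -
  obtain C where C: "C > 0"
    "\<And>x t. 0 < x \<Longrightarrow> x \<le> 3/2 \<Longrightarrow> norm (zeta_ld (Complex (1/2 + x) t)) \<le> C / x\<^sup>2 * sqrt (1 + \<bar>t\<bar>)"
    using zeta_ld_bounds [OF RH] by metis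
  define A where "A = C / x\<^sup>2 * exp (3/2 * u)"
  let ?f = "zeta_perron u"
  show ?thesis
  proof (rule Lim_null_comparison)
    show "(\<lambda>n. 3 * A * (sqrt (1 + real n) / (real n)\<^sup>2)) \<longlonglongrightarrow> 0" by real_asymp
    show "\<forall>\<^sub>F n in sequentially. norm (vertical_integral (real n) 2 ?f - vertical_integral (real n) (1/2 + x) ?f) \<le> 3 * A * (sqrt (1 + real n) / (real n)\<^sup>2)"
      using eventually_gt_at_top [of 0]
    proof eventually_elim
      fix n :: nat assume n: "n > 0"
      define m where "m = A * (sqrt (1 + real n) / (real n)\<^sup>2)"
      have A0: "A \<ge> 0" using C by (simp add: A_def)
      have m0: "m \<ge> 0" using A0 by (simp add: m_def)
      have sub: "cbox (Complex (1/2 + x) (-real n)) (Complex 2 (real n)) \<subseteq> {w. Re w > 1/2}"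
        using x by (auto simp: in_cbox_complex_iff)
      have eq: "integral {1/2+x..2} (\<lambda>s. ?f (Complex s (-real n))) + \<i> * vertical_integral (real n) 2 ?f
        - integral {1/2+x..2} (\<lambda>s. ?f (Complex s (real n))) - \<i> * vertical_integral (real n) (1/2+x) ?f = 0"
        by (rule rectangle_integrals_eq) (use n x in \<open>auto intro: holomorphic_on_subset [OF zeta_perron_holomorphic [OF RH] sub]\<close>)
      have bound: "norm (integral {1/2+x..2} (\<lambda>s. ?f (Complex s y))) \<le> 3/2 * m" if y: "\<bar>y\<bar> = real n" for y
      proof -
        have "norm (integral {1/2+x..2} (\<lambda>s. ?f (Complex s y))) \<le> m * (2 - (1/2 + x))"
        proof (rule integral_bound)
          show "1/2 + x \<le> 2" using x by simp
          show "continuous_on {1/2+x..2} (\<lambda>s. ?f (Complex s y))"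
            by (rule continuous_on_compose2 [OF holomorphic_on_imp_continuous_on [OF zeta_perron_holomorphic [OF RH]] continuous_on_Complex(2)])
               (use x in auto)
          fix s assume s: "s \<in> {1/2+x..2}"
          define z where "z = s - 1/2"
          have z: "x \<le> z" "z \<le> 3/2" "s = 1/2 + z" using s by (auto simp: z_def)
          have nn: "norm (Complex a y) \<ge> real n" for a using abs_Im_le_cmod [of "Complex a y"] y by simp
          have "norm (zeta_ld (Complex (1/2 + z) y)) \<le> C / z\<^sup>2 * sqrt (1 + \<bar>y\<bar>)" using z x by (intro C) auto
          also have "\<dots> \<le> C / x\<^sup>2 * sqrt (1 + real n)"
            using z x C(1) unfolding y by (intro mult_right_mono divide_left_mono power_mono) auto
          finally have a: "norm (zeta_ld (Complex (1/2 + z) y)) \<le> C / x\<^sup>2 * sqrt (1 + real n)" .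
          have b: "exp (z * u) \<le> exp (3/2 * u)" using mult_right_mono [of z "3/2" u] z u by simp
          have "norm (?f (Complex s y)) \<le> (C / x\<^sup>2 * sqrt (1 + real n)) * exp (3/2 * u) / (real n * real n)"
            unfolding z(3) norm_zeta_perron using a b n nn C(1)
            by (intro frac_le mult_mono) auto
          then show "norm (?f (Complex s y)) \<le> m" by (simp add: m_def A_def power2_eq_square mult_ac)
        qed
        also have "\<dots> \<le> m * (3/2)" using x m0 by (intro mult_left_mono) auto
        finally show ?thesis by simp
      qed
      have "\<i> * (vertical_integral (real n) 2 ?f - vertical_integral (real n) (1/2 + x) ?f)
        = integral {1/2+x..2} (\<lambda>s. ?f (Complex s (real n))) - integral {1/2+x..2} (\<lambda>s. ?f (Complex s (-real n)))"
        using eq by (simp add: algebra_simps)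
      then have "norm (vertical_integral (real n) 2 ?f - vertical_integral (real n) (1/2 + x) ?f)
        = norm (integral {1/2+x..2} (\<lambda>s. ?f (Complex s (real n))) - integral {1/2+x..2} (\<lambda>s. ?f (Complex s (-real n))))"
        by (metis norm_ii norm_mult mult_1)
      also have "\<dots> \<le> 3/2 * m + 3/2 * m"
        by (rule order_trans [OF norm_triangle_ineq4 add_mono]) (use bound in auto)
      finally show "norm (vertical_integral (real n) 2 ?f - vertical_integral (real n) (1/2 + x) ?f) \<le> 3 * A * (sqrt (1 + real n) / (real n)\<^sup>2)"
        by (simp add: m_def)
    qed
  qed
qed

text \<open>With \<open>x = 1 / u\<close> the factor \<open>exp (x * u)\<close> on the shifted line is constant, and \<open>ld_weight_integral_small\<close>
  saves the required \<open>o(u)\<close>.\<close>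

theorem psi_half_asymptotics:
  assumes RH: riemann_hypothesis
  shows "((\<lambda>u. (psi_half (exp u) - exp (u/2)) / u) \<longlongrightarrow> 0) at_top"
proof -
  have key: "\<forall>\<^sub>F u in at_top. \<bar>psi_half (exp u) - (exp (u/2) - 2 + exp (- u/2))\<bar> \<le> e * u" if e: "e > 0" for e
  proof -
    obtain d where d: "d > 0" "d \<le> 1" "\<And>x n. 0 < x \<Longrightarrow> x < d \<Longrightarrow> integral {- real n..real n} (ld_weight x) \<le> e"
      using ld_weight_integral_small [OF RH e] by metis
    show ?thesis using eventually_gt_at_top [of "1 / d"]
    proof eventually_elim
      fix u :: real assume u: "u > 1 / d"
      have u0: "u > 0" using u d by (meson less_trans zero_less_divide_1_iff)
      define x where "x = 1 / u"
      have x: "0 < x" "x < d" using u u0 d by (auto simp: x_def field_simps)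
      define L where "L = complex_of_real (4 * pi * (psi_half (exp u) - (exp (u/2) - 2 + exp (- u/2))))"
      have "filterlim real at_top sequentially" by (rule filterlim_real_sequentially)
      then have "(\<lambda>n. vertical_integral (real n) 2 (zeta_perron u)) \<longlonglongrightarrow> L"
        unfolding L_def using u0 by (intro filterlim_compose [OF zeta_perron_tendsto]) auto
      from tendsto_diff [OF this zeta_perron_shift [OF RH less_imp_le [OF u0] x(1)]]
      have lim: "(\<lambda>n. vertical_integral (real n) (1/2 + x) (zeta_perron u)) \<longlonglongrightarrow> L"
        using u0 x d by simp
      have "norm L \<le> exp 1 * u * e"
      proof (rule Lim_norm_ubound [OF _ lim])
        show "\<forall>\<^sub>F n in sequentially. norm (vertical_integral (real n) (1/2 + x) (zeta_perron u)) \<le> exp 1 * u * e"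
        proof (rule always_eventually, rule allI)
          fix n :: nat
          have w: "norm (zeta_perron u (Complex (1/2 + x) t)) = exp 1 * u * ld_weight x t" for t
            unfolding norm_zeta_perron ld_weight_def using u0 by (simp add: x_def)
          have "continuous_on {-real n..real n} (\<lambda>t. zeta_perron u (Complex (1/2 + x) t))"
            using x by (intro continuous_on_vertical [OF zeta_perron_holomorphic [OF RH]]) auto
          then have "norm (vertical_integral (real n) (1/2 + x) (zeta_perron u)) \<le> integral {-real n..real n} (\<lambda>t. exp 1 * u * ld_weight x t)"
            by (intro integral_norm_bound_integral integrable_continuous_interval continuous_on_mult continuous_on_const ld_weight_continuous RH x)
               (simp_all only: w order_refl)
          also have "\<dots> = exp 1 * u * integral {-real n..real n} (ld_weight x)" by (rule integral_mult_right)
          also have "\<dots> \<le> exp 1 * u * e" using d(3) [OF x] u0 by (intro mult_left_mono) auto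
          finally show "norm (vertical_integral (real n) (1/2 + x) (zeta_perron u)) \<le> exp 1 * u * e" .
        qed
      qed simp
      then have "4 * pi * \<bar>psi_half (exp u) - (exp (u/2) - 2 + exp (- u/2))\<bar> \<le> exp 1 * u * e"
        unfolding L_def norm_of_real by (simp add: abs_mult)
      also have "\<dots> \<le> 4 * pi * (e * u)"
      proof -
        have "exp 1 \<le> 4 * pi" using exp_le pi_gt3 by linarith
        from mult_right_mono [OF this, of "e * u"] show ?thesis using e u0 by (simp add: mult_ac)
      qed
      finally show "\<bar>psi_half (exp u) - (exp (u/2) - 2 + exp (- u/2))\<bar> \<le> e * u" by simp
    qed
  qed
  have a: "((\<lambda>u. (psi_half (exp u) - (exp (u/2) - 2 + exp (- u/2))) / u) \<longlongrightarrow> 0) at_top"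
  proof (rule tendstoI)
    fix e :: real assume e: "e > 0"
    have "e / 2 > 0" using e by simp
    from key [OF this]
    show "\<forall>\<^sub>F u in at_top. dist ((psi_half (exp u) - (exp (u/2) - 2 + exp (- u/2))) / u) 0 < e"
      using eventually_gt_at_top [of 0]
    proof eventually_elim
      case (elim u)
      have "e * u > 0" using e elim by simp
      then show ?case using elim by (simp add: divide_less_eq)
    qed
  qed
  have b: "((\<lambda>u. (- 2 + exp (- u/2)) / u) \<longlongrightarrow> (0::real)) at_top" by real_asymp
  from tendsto_add [OF a b] show ?thesis by (simp add: diff_divide_distrib add_divide_distrib algebra_simps)
qed

subsection \<open>From the averaged bound to the prime number theorem\<close>

definition psi :: "real \<Rightarrow> real" where
  "psi x = (\<Sum>n\<in>{1..nat \<lfloor>x\<rfloor>}. mangoldt n)"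

text \<open>Riemann's weighted count of prime powers. The summand for n = 1 is 0 / 0, which is 0
  here.\<close>

definition prime_power_pi :: "real \<Rightarrow> real" where
  "prime_power_pi x = (\<Sum>n\<in>{1..nat \<lfloor>x\<rfloor>}. mangoldt n / ln n)"

lemma psi_mono: "x \<le> y \<Longrightarrow> psi x \<le> psi y"
  unfolding psi_def by (intro sum_mono2 mangoldt_nonneg) (auto intro: nat_mono floor_mono order_trans)

text \<open>Partial summation as an exchange of a finite sum with an integral:
  \<open>mangoldt n\<close> enters psi t only for t >= n, so it is weighted by the integral of f
  from max a n to X.\<close>

lemma psi_mult_has_integral:
  assumes "a \<ge> 1"
    and f: "\<And>n. 1 \<le> n \<Longrightarrow> real n \<le> X \<Longrightarrow> (f has_integral I n) {max a (real n)..X}"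
  shows "((\<lambda>t. psi t * f t) has_integral (\<Sum>n\<in>{1..nat \<lfloor>X\<rfloor>}. mangoldt n * I n)) {a..X}"
proof -
  have le: "real n \<le> X" if "n \<in> {1..nat \<lfloor>X\<rfloor>}" for n using that by auto linarith
  have "((\<lambda>t. \<Sum>n\<in>{1..nat \<lfloor>X\<rfloor>}. mangoldt n * (if t \<in> {max a (real n)..X} then f t else 0)) has_integral
      (\<Sum>n\<in>{1..nat \<lfloor>X\<rfloor>}. mangoldt n * I n)) {a..X}"
  proof (intro has_integral_sum has_integral_mult_right)
    fix n assume n: "n \<in> {1..nat \<lfloor>X\<rfloor>}"
    then show "((\<lambda>t. if t \<in> {max a (real n)..X} then f t else 0) has_integral I n) {a..X}"
      using f [of n] le [OF n] by (subst has_integral_restrict) auto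
  qed simp
  then show ?thesis
  proof (rule has_integral_eq [rotated])
    fix t assume t: "t \<in> {a..X}"
    have "(\<Sum>n\<in>{1..nat \<lfloor>X\<rfloor>}. mangoldt n * (if t \<in> {max a (real n)..X} then f t else 0))
      = (\<Sum>n\<in>{1..nat \<lfloor>t\<rfloor>}. mangoldt n * f t)"
    proof (rule sum.mono_neutral_cong_right)
      show "{1..nat \<lfloor>t\<rfloor>} \<subseteq> {1..nat \<lfloor>X\<rfloor>}" using t by (auto intro: nat_mono floor_mono order_trans)
      show "\<forall>i\<in>{1..nat \<lfloor>X\<rfloor>} - {1..nat \<lfloor>t\<rfloor>}. mangoldt i * (if t \<in> {max a (real i)..X} then f t else 0) = 0"
      proof
        fix i assume "i \<in> {1..nat \<lfloor>X\<rfloor>} - {1..nat \<lfloor>t\<rfloor>}"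
        then have "t < real i" using t \<open>a \<ge> 1\<close> by auto linarith
        then show "mangoldt i * (if t \<in> {max a (real i)..X} then f t else 0) = 0" by auto
      qed
      fix i assume "i \<in> {1..nat \<lfloor>t\<rfloor>}"
      then have "real i \<le> t" by auto linarith
      then show "mangoldt i * (if t \<in> {max a (real i)..X} then f t else 0) = mangoldt i * f t" using t by auto
    qed simp
    then show "(\<Sum>n\<in>{1..nat \<lfloor>X\<rfloor>}. mangoldt n * (if t \<in> {max a (real n)..X} then f t else 0)) = psi t * f t"
      by (simp add: psi_def sum_distrib_right)
  qed
qed

lemma DERIV_minus_2_div_sqrt:
  assumes "t > 0"
  shows "((\<lambda>t. - 2 / sqrt t) has_real_derivative (1 / (t * sqrt t))) (at t)"
proof -
  have "((\<lambda>t. - 2 / sqrt t) has_real_derivative (- (- 2 * (inverse (sqrt t) / 2)) / (sqrt t * sqrt t))) (at t)"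
    using assms by (auto intro!: derivative_eq_intros)
  moreover have "- (- 2 * (inverse (sqrt t) / 2)) / (sqrt t * sqrt t) = 1 / (t * sqrt t)"
    using assms by (simp add: field_simps)
  ultimately show ?thesis by simp
qed

text \<open>The closed form of the integral of (psi t - t) / t powr (3/2) over [1, X].\<close>

definition psi_err :: "real \<Rightarrow> real" where
  "psi_err X = 2 * psi_half X - 2 * sqrt X + 2"

lemma psi_err_has_integral:
  assumes "X \<ge> 1"
  shows "((\<lambda>t. (psi t - t) * (1 / (t * sqrt t))) has_integral psi_err X) {1..X}"
proof -
  have "((\<lambda>t. psi t * (1 / (t * sqrt t))) has_integral (\<Sum>n\<in>{1..nat \<lfloor>X\<rfloor>}. mangoldt n * (- 2 / sqrt X - (- 2 / sqrt n)))) {1..X}"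
  proof (rule psi_mult_has_integral)
    fix n :: nat assume n: "1 \<le> n" "real n \<le> X"
    have "((\<lambda>t. 1 / (t * sqrt t)) has_integral (- 2 / sqrt X - (- 2 / sqrt n))) {real n..X}"
      using n by (intro has_integral_antiderivative DERIV_minus_2_div_sqrt) auto
    then show "((\<lambda>t. 1 / (t * sqrt t)) has_integral (- 2 / sqrt X - (- 2 / sqrt n))) {max 1 (real n)..X}"
      using n by (simp add: max_def)
  qed simp
  moreover have "((\<lambda>t. t * (1 / (t * sqrt t))) has_integral (2 * sqrt X - 2 * sqrt 1)) {1..X}"
    using assms by (intro has_integral_antiderivative) (auto intro!: derivative_eq_intros simp: field_simps)
  ultimately have "((\<lambda>t. psi t * (1 / (t * sqrt t)) - t * (1 / (t * sqrt t))) has_integral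
     ((\<Sum>n\<in>{1..nat \<lfloor>X\<rfloor>}. mangoldt n * (- 2 / sqrt X - (- 2 / sqrt n))) - (2 * sqrt X - 2 * sqrt 1))) {1..X}"
    by (rule has_integral_diff)
  moreover have "(\<Sum>n\<in>{1..nat \<lfloor>X\<rfloor>}. mangoldt n * (- 2 / sqrt X - (- 2 / sqrt n))) = 2 * psi_half X"
    unfolding psi_half_def sum_distrib_left by (intro sum.cong) (auto simp: algebra_simps)
  moreover have "2 * psi_half X - (2 * sqrt X - 2 * sqrt 1) = psi_err X" by (simp add: psi_err_def)
  ultimately show ?thesis unfolding left_diff_distrib by (simp only:)
qed

lemma psi_err_diff_has_integral:
  assumes "1 \<le> x" "x \<le> y"
  shows "((\<lambda>t. (psi t - t) * (1 / (t * sqrt t))) has_integral (psi_err y - psi_err x)) {x..y}"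
proof -
  let ?f = "\<lambda>t. (psi t - t) * (1 / (t * sqrt t))"
  have I: "?f integrable_on {1..y}" using psi_err_has_integral [of y] assms by (auto simp: integrable_on_def)
  then have I2: "?f integrable_on {x..y}" by (rule integrable_on_subinterval) (use assms in auto)
  have "integral {1..x} ?f + integral {x..y} ?f = integral {1..y} ?f"
    using assms I by (intro HK_combine) auto
  then have "integral {x..y} ?f = psi_err y - psi_err x"
    using psi_err_has_integral [of x] psi_err_has_integral [of y] assms by (simp add: integral_unique)
  then show ?thesis using I2 by (metis integrable_integral)
qed

text \<open>The assumption is the single consequence of the Riemann hypothesis on which the rest of
  the argument rests.\<close>

locale averaged_bound =
  assumes psi_half_bound: "((\<lambda>u. (psi_half (exp u) - exp (u/2)) / u) \<longlongrightarrow> 0) at_top"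
begin

lemma psi_err_small: "((\<lambda>x. psi_err x / ln x) \<longlongrightarrow> 0) at_top"
proof -
  have "((\<lambda>x. (psi_half (exp (ln x)) - exp (ln x / 2)) / ln x) \<longlongrightarrow> 0) at_top"
    by (rule filterlim_compose [OF psi_half_bound ln_at_top])
  moreover have "((\<lambda>x. 2 / ln x) \<longlongrightarrow> (0 :: real)) at_top" by real_asymp
  ultimately have "((\<lambda>x. 2 * ((psi_half (exp (ln x)) - exp (ln x / 2)) / ln x) + 2 / ln x) \<longlongrightarrow> 2 * 0 + 0) at_top"
    by (intro tendsto_intros)
  moreover have "\<forall>\<^sub>F x in at_top. 2 * ((psi_half (exp (ln x)) - exp (ln x / 2)) / ln x) + 2 / ln x = psi_err x / ln x"
    using eventually_gt_at_top [of 0]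
  proof eventually_elim
    case (elim x)
    have "exp (ln x / 2) = sqrt x"
      by (rule real_sqrt_unique [symmetric]) (use elim in \<open>simp_all add: exp_double [symmetric]\<close>)
    then show ?case using elim by (simp add: psi_err_def add_divide_distrib diff_divide_distrib algebra_simps)
  qed
  ultimately show ?thesis by (simp add: filterlim_cong)
qed

lemma psi_err_eventually_le:
  assumes e: "e > 0"
  shows "\<forall>\<^sub>F x in at_top. \<bar>psi_err x\<bar> \<le> e * ln x"
proof -
  have "\<forall>\<^sub>F x in at_top. \<bar>psi_err x / ln x\<bar> < e"
    using tendstoD [OF psi_err_small e] by (simp add: dist_real_def)
  then show ?thesis using eventually_gt_at_top [of 1]
  proof eventually_elim
    case (elim x)
    then show ?case by (simp add: abs_divide divide_less_eq)
  qed
qed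

text \<open>If psi t - t keeps one sign and size at least d on an interval, its weighted integral
  over that interval is large, and this integral is a difference of two values of
  \<open>psi_err\<close>. The number \<open>s\<close> is the sign.\<close>

lemma psi_err_jump:
  assumes xy: "1 \<le> x" "x \<le> y" and s: "\<bar>s\<bar> = 1" and d: "d \<ge> 0"
    and ge: "\<And>t. t \<in> {x..y} \<Longrightarrow> s * (psi t - t) \<ge> d"
  shows "(y - x) * d / (y * sqrt y) \<le> \<bar>psi_err x\<bar> + \<bar>psi_err y\<bar>"
proof -
  have "(y - x) * (d * (1 / (y * sqrt y))) \<le> s * (psi_err y - psi_err x)"
  proof (rule has_integral_le)
    show "((\<lambda>t. d * (1 / (y * sqrt y))) has_integral (y - x) * (d * (1 / (y * sqrt y)))) {x..y}"
      using has_integral_const_real [of "d * (1 / (y * sqrt y))" x y] xy by simp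
    show "((\<lambda>t. s * ((psi t - t) * (1 / (t * sqrt t)))) has_integral s * (psi_err y - psi_err x)) {x..y}"
      by (intro has_integral_mult_right psi_err_diff_has_integral xy)
    fix t assume t: "t \<in> {x..y}"
    have "1 / (y * sqrt y) \<le> 1 / (t * sqrt t)"
      using t xy by (intro divide_left_mono mult_mono) auto
    then have "d * (1 / (y * sqrt y)) \<le> s * (psi t - t) * (1 / (t * sqrt t))"
      by (rule mult_mono [OF ge [OF t] _ order_trans [OF d ge [OF t]]]) (use xy in simp)
    then show "d * (1 / (y * sqrt y)) \<le> s * ((psi t - t) * (1 / (t * sqrt t)))" by (simp only: mult.assoc)
  qed
  also have "\<dots> \<le> \<bar>s * (psi_err y - psi_err x)\<bar>" by (rule abs_ge_self)
  also have "\<dots> \<le> \<bar>psi_err x\<bar> + \<bar>psi_err y\<bar>" unfolding abs_mult s by simp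
  finally show ?thesis by simp
qed

text \<open>A Tauberian argument: psi increases, so psi x > (1 + e) x forces psi t - t >= e x / 2 up
  to x + e x / 2, and psi x < (1 - e) x forces the opposite to the left of x. Either makes
  \<open>psi_err\<close> change by a multiple of e^2 sqrt x, against its bound by ln x.\<close>

lemma psi_bounds:
  assumes e: "0 < e" "e < 1"
  shows "\<forall>\<^sub>F x in at_top. psi x \<le> (1 + e) * x \<and> psi x \<ge> (1 - e) * x"
proof -
  have "\<forall>\<^sub>F x in at_top. e/2 * x * (e/2 * x) / (2 * x * sqrt (2 * x)) > 2 * ln (2 * x)"
    using e by real_asymp
  \<comment> \<open>From x / 2 on, because the interval to the left of x starts at x - e x /
    2.\<close>
  moreover have "\<forall>\<^sub>F x in at_top. \<forall>y\<ge>x/2. \<bar>psi_err y\<bar> \<le> 1 * ln y"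
  proof -
    obtain X0 where "\<And>y. y \<ge> X0 \<Longrightarrow> \<bar>psi_err y\<bar> \<le> 1 * ln y"
      using psi_err_eventually_le [of 1] unfolding eventually_at_top_linorder by auto
    then show ?thesis by (intro eventually_at_top_linorderI [of "2 * X0"]) auto
  qed
  ultimately show ?thesis using eventually_ge_at_top [of 2]
  proof eventually_elim
    case (elim x)
    have ex: "0 \<le> e/2 * x" "e/2 * x \<le> 1/2 * x" using e elim by (auto intro!: mult_right_mono)
    have contra: False
      if y: "x / 2 \<le> y" "y \<le> z" "z \<le> 2 * x" "z - y = e/2 * x" and s: "\<bar>s\<bar> = 1"
        and ge: "\<And>t. t \<in> {y..z} \<Longrightarrow> s * (psi t - t) \<ge> e/2 * x" for y z s
    proof -
      have "e/2 * x * (e/2 * x) / (2 * x * sqrt (2 * x)) \<le> (z - y) * (e/2 * x) / (z * sqrt z)"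
        unfolding y(4) using y elim ex by (intro divide_left_mono mult_mono) auto
      also have "\<dots> \<le> \<bar>psi_err y\<bar> + \<bar>psi_err z\<bar>"
        using y elim ex s by (intro psi_err_jump [of _ _ s] ge) auto
      also have "\<dots> \<le> 1 * ln y + 1 * ln z" using elim(2) y by (intro add_mono) auto
      also have "\<dots> \<le> 2 * ln (2 * x)"
      proof -
        have "ln y \<le> ln (2 * x)" "ln z \<le> ln (2 * x)" using y elim by auto
        then show ?thesis by simp
      qed
      finally show False using elim by simp
    qed
    show ?case
    proof (intro conjI; rule ccontr)
      assume "\<not> psi x \<le> (1 + e) * x"
      then have px: "psi x > (1 + e) * x" by simp
      show False
      proof (rule contra [of x "x + e/2 * x" 1])
        show "e/2 * x \<le> 1 * (psi t - t)" if "t \<in> {x..x + e/2 * x}" for t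
          using psi_mono [of x t] px that by (simp add: algebra_simps)
      qed (use ex elim in auto)
    next
      assume "\<not> (1 - e) * x \<le> psi x"
      then have px: "psi x < (1 - e) * x" by simp
      show False
      proof (rule contra [of "x - e/2 * x" x "-1"])
        show "e/2 * x \<le> - 1 * (psi t - t)" if "t \<in> {x - e/2 * x..x}" for t
          using psi_mono [of t x] px that by (simp add: algebra_simps)
      qed (use ex elim in auto)
    qed
  qed
qed

lemma psi_asymptotics: "((\<lambda>x. psi x / x) \<longlongrightarrow> 1) at_top"
proof (rule tendstoI)
  fix e :: real assume e: "e > 0"
  define d where "d = min (e/2) (1/2)"
  have d: "0 < d" "d < 1" "d < e" using e by (auto simp: d_def)
  show "\<forall>\<^sub>F x in at_top. dist (psi x / x) 1 < e"
    using psi_bounds [OF d(1,2)] eventually_gt_at_top [of 0]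
  proof eventually_elim
    case (elim x)
    then have "psi x / x \<le> 1 + d" "psi x / x \<ge> 1 - d" by (simp_all add: field_simps)
    then show ?case using d by (simp add: dist_real_def abs_less_iff)
  qed
qed

end

section \<open>The logarithmic integral and Riemann's count of prime powers\<close>

definition li_sq :: "real \<Rightarrow> real" where
  "li_sq x = integral {2..x} (\<lambda>t. 1 / (ln t)\<^sup>2)"

definition li :: "real \<Rightarrow> real" where
  "li x = integral {2..x} (\<lambda>t. 1 / ln t)"

lemma inverse_ln_continuous:
  "continuous_on {2..x} (\<lambda>t::real. 1 / ln t)" "continuous_on {2..x} (\<lambda>t::real. 1 / (ln t)\<^sup>2)"
  by (auto intro!: continuous_intros)

lemma li_sq_nonneg: "li_sq x \<ge> 0"
  unfolding li_sq_def by (intro integral_nonneg integrable_continuous_interval inverse_ln_continuous) auto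

lemma li_sq_mono:
  assumes "x \<le> y"
  shows "li_sq x \<le> li_sq y"
  unfolding li_sq_def using assms
  by (intro integral_subset_le integrable_continuous_interval inverse_ln_continuous) auto

lemma DERIV_div_ln: "t \<ge> 2 \<Longrightarrow> ((\<lambda>t. t / ln t) has_real_derivative (1 / ln t - 1 / (ln t)\<^sup>2)) (at t)"
  by (auto intro!: derivative_eq_intros simp: divide_simps power2_eq_square)

lemma li_eq:
  assumes "x \<ge> 2"
  shows "li x = x / ln x - 2 / ln 2 + li_sq x"
proof -
  have "((\<lambda>t. 1 / ln t - 1 / (ln t)\<^sup>2) has_integral (x / ln x - 2 / ln 2)) {2..x}"
    using DERIV_div_ln assms by (intro has_integral_antiderivative) auto
  moreover have "((\<lambda>t. 1 / ln t - 1 / (ln t)\<^sup>2) has_integral (li x - li_sq x)) {2..x}"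
    unfolding li_def li_sq_def
    by (intro has_integral_diff integrable_integral integrable_continuous_interval inverse_ln_continuous)
  ultimately have "x / ln x - 2 / ln 2 = li x - li_sq x" by (rule has_integral_unique)
  then show ?thesis by simp
qed

lemma li_sq_small: "((\<lambda>x. li_sq x * ln x / x) \<longlongrightarrow> 0) at_top"
proof -
  have "((\<lambda>x. li_sq x / (x / ln x)) \<longlongrightarrow> 0) at_top"
  proof (rule lhospital_at_top_at_top)
    show "filterlim (\<lambda>x::real. x / ln x) at_top at_top" by real_asymp
    have "\<forall>\<^sub>F x::real in at_top. 1 / ln x - 1 / (ln x)\<^sup>2 > 0" by real_asymp
    then show "\<forall>\<^sub>F x::real in at_top. 1 / ln x - 1 / (ln x)\<^sup>2 \<noteq> 0" by eventually_elim (rule less_imp_neq [THEN not_sym])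
    show "((\<lambda>x::real. (1 / (ln x)\<^sup>2) / (1 / ln x - 1 / (ln x)\<^sup>2)) \<longlongrightarrow> 0) at_top" by real_asymp
    show "\<forall>\<^sub>F x in at_top. (li_sq has_real_derivative 1 / (ln x)\<^sup>2) (at x)"
      using eventually_gt_at_top [of 2]
    proof eventually_elim
      case (elim x)
      have "((\<lambda>x. integral {2..x} (\<lambda>t. 1 / (ln t)\<^sup>2)) has_real_derivative 1 / (ln x)\<^sup>2) (at x within {2..x+1})"
        using elim by (intro integral_has_real_derivative inverse_ln_continuous) auto
      moreover have "at x within {2..x+1} = at x" using elim by (intro at_within_interior) auto
      ultimately show ?case unfolding li_sq_def [abs_def] by simp
    qed
    show "\<forall>\<^sub>F x::real in at_top. ((\<lambda>x. x / ln x) has_real_derivative 1 / ln x - 1 / (ln x)\<^sup>2) (at x)"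
      using eventually_ge_at_top [of 2] by eventually_elim (rule DERIV_div_ln)
  qed
  then show ?thesis by simp
qed

text \<open>The error that partial summation leaves when psi is replaced by its main term in
  \<open>prime_power_pi\<close>.\<close>

definition psi_err_ln :: "real \<Rightarrow> real" where
  "psi_err_ln x = integral {2..x} (\<lambda>t. (psi t - t) * (1 / (t * (ln t)\<^sup>2)))"

lemma psi_err_ln_has_integral:
  assumes x: "x \<ge> 2"
  shows "((\<lambda>t. (psi t - t) * (1 / (t * (ln t)\<^sup>2))) has_integral (prime_power_pi x - psi x / ln x - li_sq x)) {2..x}"
proof -
  have d: "((\<lambda>t. - 1 / ln t) has_real_derivative (1 / (t * (ln t)\<^sup>2))) (at t)" if "t \<ge> 2" for t
  proof -
    have "ln t > 0" using that by simp
    then show ?thesis using that by (auto intro!: derivative_eq_intros simp: divide_simps power2_eq_square)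
  qed
  have "((\<lambda>t. psi t * (1 / (t * (ln t)\<^sup>2))) has_integral (\<Sum>n\<in>{1..nat \<lfloor>x\<rfloor>}. mangoldt n * (- 1 / ln x - (- 1 / ln (max 2 (real n)))))) {2..x}"
  proof (rule psi_mult_has_integral)
    fix n :: nat assume n: "1 \<le> n" "real n \<le> x"
    show "((\<lambda>t. 1 / (t * (ln t)\<^sup>2)) has_integral (- 1 / ln x - (- 1 / ln (max 2 (real n))))) {max 2 (real n)..x}"
      using n x by (intro has_integral_antiderivative d) auto
  qed simp
  moreover have "(\<Sum>n\<in>{1..nat \<lfloor>x\<rfloor>}. mangoldt n * (- 1 / ln x - (- 1 / ln (max 2 (real n))))) = prime_power_pi x - psi x / ln x"
  proof -
    \<comment> \<open>The maximum with 2 changes only n = 1, where \<open>mangoldt\<close>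
      vanishes.\<close>
    have "mangoldt n * (- 1 / ln x - (- 1 / ln (max 2 (real n)))) = mangoldt n / ln (real n) - mangoldt n / ln x" if "n \<ge> 1" for n
    proof (cases "n = 1")
      case False
      then have "max 2 (real n) = real n" using that by simp
      then show ?thesis by (simp add: algebra_simps)
    qed simp
    then have "(\<Sum>n\<in>{1..nat \<lfloor>x\<rfloor>}. mangoldt n * (- 1 / ln x - (- 1 / ln (max 2 (real n))))) = (\<Sum>n\<in>{1..nat \<lfloor>x\<rfloor>}. mangoldt n / ln (real n) - mangoldt n / ln x)"
      by (intro sum.cong) auto
    then show ?thesis by (simp add: prime_power_pi_def psi_def sum_subtractf sum_divide_distrib)
  qed
  ultimately have p: "((\<lambda>t. psi t * (1 / (t * (ln t)\<^sup>2))) has_integral (prime_power_pi x - psi x / ln x)) {2..x}" by simp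
  have "((\<lambda>t. 1 / (ln t)\<^sup>2) has_integral li_sq x) {2..x}"
    unfolding li_sq_def by (intro integrable_integral integrable_continuous_interval inverse_ln_continuous)
  from has_integral_diff [OF p this]
  show ?thesis by (rule has_integral_eq [rotated]) (auto simp: field_simps)
qed

lemma psi_err_ln_eq: "x \<ge> 2 \<Longrightarrow> psi_err_ln x = prime_power_pi x - psi x / ln x - li_sq x"
  unfolding psi_err_ln_def by (rule integral_unique [OF psi_err_ln_has_integral])

lemma li_minus_prime_power_pi:
  assumes "x \<ge> 2"
  shows "li x - prime_power_pi x = (x - psi x) / ln x - 2 / ln 2 - psi_err_ln x"
  using li_eq [OF assms] psi_err_ln_eq [OF assms] by (simp add: diff_divide_distrib)

text \<open>The derivative has the sign of ln t - 4, and 60 exceeds exp 4 because 2.72^4 is below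
  55. Monotonicity is the hypothesis of the second mean value theorem in
  \<open>psi_err_ln_small\<close>.\<close>

lemma sqrt_div_ln_squared_mono:
  assumes "60 \<le> a" "a \<le> b"
  shows "sqrt a / (ln a)\<^sup>2 \<le> sqrt b / (ln b)\<^sup>2"
proof (rule DERIV_nonneg_imp_nondecreasing [OF assms(2)])
  fix t assume t: "a \<le> t" "t \<le> b"
  have "exp (4 * 1) = exp (1 :: real) ^ 4" by (subst exp_of_nat_mult [symmetric]) simp
  also have "\<dots> \<le> 2.72 ^ 4" by (intro power_mono) (use e_less_272 in auto)
  also have "\<dots> \<le> (60 :: real)" by (simp add: power4_eq_xxxx)
  finally have "exp 4 \<le> t" using t assms by simp
  then have l4: "ln t \<ge> 4" using t assms by (simp add: ln_ge_iff)
  have "((\<lambda>t. sqrt t / (ln t)\<^sup>2) has_real_derivative ((inverse (sqrt t) / 2 * (ln t)\<^sup>2 - sqrt t * (2 * ln t * (1 / t))) / ((ln t)\<^sup>2 * (ln t)\<^sup>2))) (at t)"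
    using t assms l4 by (auto intro!: derivative_eq_intros)
  moreover have "(inverse (sqrt t) / 2 * (ln t)\<^sup>2 - sqrt t * (2 * ln t * (1 / t))) / ((ln t)\<^sup>2 * (ln t)\<^sup>2) \<ge> 0"
  proof (rule divide_nonneg_nonneg)
    have "sqrt t * (1 / t) = inverse (sqrt t)" using t assms by (simp add: field_simps)
    then have "sqrt t * (2 * ln t * (1 / t)) = 2 * ln t * inverse (sqrt t)"
      by (metis mult.assoc mult.left_commute)
    then have "inverse (sqrt t) / 2 * (ln t)\<^sup>2 - sqrt t * (2 * ln t * (1 / t)) = inverse (sqrt t) * ln t * (ln t / 2 - 2)"
      by (simp add: algebra_simps power2_eq_square)
    also have "\<dots> \<ge> 0" using l4 t assms by (intro mult_nonneg_nonneg) auto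
    finally show "0 \<le> inverse (sqrt t) / 2 * (ln t)\<^sup>2 - sqrt t * (2 * ln t * (1 / t))" .
  qed auto
  ultimately show "\<exists>y. ((\<lambda>t. sqrt t / (ln t)\<^sup>2) has_real_derivative y) (at t) \<and> 0 \<le> y" by blast
qed

text \<open>Prime powers \<open>n = p ^ k\<close> contribute \<open>1 / k\<close>: exponent 1 gives \<open>\<pi> x\<close>, exponent 2 gives \<open>\<pi> (sqrt x) / 2\<close>.\<close>

lemma prime_power_pi_bounds:
  assumes x: "x \<ge> 2"
  shows "prime_power_pi x - real (prime_count x) - real (prime_count (sqrt x)) / 2 \<in> {0..x powr (1/3) * (ln x / ln 2)}"
proof -
  define N where "N = nat \<lfloor>x\<rfloor>"
  have N: "n \<le> N \<longleftrightarrow> real n \<le> x" for n unfolding N_def using x by (auto simp: le_nat_iff le_floor_iff)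
  define P where "P = {(p, k). prime p \<and> k \<ge> 1 \<and> p ^ k \<le> N}"
  let ?P1 = "{pk\<in>P. snd pk = 1}"
  let ?P2 = "{pk\<in>P. snd pk = 2}"
  let ?P3 = "{pk\<in>P. snd pk \<ge> 3}"
  have kle: "real k \<le> ln x / ln 2" if "(p, k) \<in> P" for p k
  proof -
    have "p \<ge> 2" using that by (auto simp: P_def dest: prime_ge_2_nat)
    then have "2 ^ k \<le> p ^ k" by (rule power_mono) simp
    then have "real (2 ^ k) \<le> x" using that N [of "2 ^ k"] by (auto simp: P_def)
    then have "ln (2 ^ k) \<le> ln x" using x by (subst ln_le_cancel_iff) auto
    then show ?thesis by (simp add: ln_realpow field_simps)
  qed
  have pN: "p \<le> N" if "(p, k) \<in> P" for p k
  proof -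
    have "p ^ 1 \<le> p ^ k" using that by (intro power_increasing) (auto simp: P_def prime_gt_0_nat Suc_le_eq)
    then show ?thesis using that by (auto simp: P_def)
  qed
  have finP: "finite P"
  proof (rule finite_subset)
    show "P \<subseteq> {..N} \<times> {..nat \<lfloor>ln x / ln 2\<rfloor>}"
    proof clarify
      fix p k assume pk: "(p, k) \<in> P"
      have "int k \<le> \<lfloor>ln x / ln 2\<rfloor>" using kle [OF pk] by (simp add: le_floor_iff)
      then show "p \<in> {..N} \<and> k \<in> {..nat \<lfloor>ln x / ln 2\<rfloor>}" using pN [OF pk] by (simp add: le_nat_iff)
    qed
  qed auto
  have inj: "inj_on (\<lambda>(p, k). p ^ k) P"
  proof (rule inj_onI)
    fix a b assume ab: "a \<in> P" "b \<in> P" "(case a of (p, k) \<Rightarrow> p ^ k) = (case b of (p, k) \<Rightarrow> p ^ k)"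
    obtain p k q m where "a = (p, k)" "b = (q, m)" by fastforce
    with ab show "a = b" using prime_power_inj'' [of p q k m] by (simp add: P_def)
  qed
  have "prime_power_pi x = (\<Sum>n\<in>(\<lambda>(p, k). p ^ k) ` P. mangoldt n / ln n)"
    unfolding prime_power_pi_def N_def [symmetric]
  proof (rule sum.mono_neutral_right)
    show "(\<lambda>(p, k). p ^ k) ` P \<subseteq> {1..N}"
      by (auto simp: P_def Suc_le_eq prime_gt_0_nat)
    show "\<forall>i\<in>{1..N} - (\<lambda>(p, k). p ^ k) ` P. mangoldt i / ln (real i) = 0"
    proof
      fix i assume i: "i \<in> {1..N} - (\<lambda>(p, k). p ^ k) ` P"
      have "\<not> primepow i"
      proof
        assume "primepow i"
        then obtain p k where "prime p" "k > 0" "i = p ^ k" by (auto simp: primepow_def)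
        then have "(p, k) \<in> P" "i = (\<lambda>(p, k). p ^ k) (p, k)" using i by (auto simp: P_def)
        then show False using i by blast
      qed
      then show "mangoldt i / ln (real i) = 0" by (simp add: mangoldt_def)
    qed
  qed simp
  also have "\<dots> = (\<Sum>(p, k)\<in>P. 1 / real k)"
  proof (subst sum.reindex [OF inj], rule sum.cong)
    fix pk assume "pk \<in> P"
    then obtain p k where pk: "pk = (p, k)" "prime p" "k \<ge> 1" by (auto simp: P_def)
    then have "ln (real p) > 0" using prime_gt_1_nat [of p] by simp
    then show "((\<lambda>n. mangoldt n / ln (real n)) \<circ> (\<lambda>(p, k). p ^ k)) pk = (case pk of (p, k) \<Rightarrow> 1 / real k)"
      using pk by (simp add: ln_realpow)
  qed simp
  also have "P = ?P1 \<union> (?P2 \<union> ?P3)"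
  proof -
    have "snd pk \<ge> 1" if "pk \<in> P" for pk using that by (auto simp: P_def)
    then show ?thesis by (force simp: not_le)
  qed
  also have "(\<Sum>(p, k)\<in>\<dots>. 1 / real k) = (\<Sum>(p, k)\<in>?P1. 1 / real k) + ((\<Sum>(p, k)\<in>?P2. 1 / real k) + (\<Sum>(p, k)\<in>?P3. 1 / real k))"
    using finP by (subst sum.union_disjoint, simp, simp, force, subst sum.union_disjoint) auto
  also have "(\<Sum>(p, k)\<in>?P1. 1 / real k) = real (prime_count x)"
  proof -
    have "(\<Sum>(p, k)\<in>?P1. 1 / real k) = (\<Sum>pk\<in>?P1. 1)"
      by (intro sum.cong) auto
    also have "\<dots> = real (card ?P1)" by simp
    also have "card ?P1 = prime_count x"
    proof -
      have "?P1 = (\<lambda>p. (p, 1)) ` {p. prime p \<and> real p \<le> x}"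
        by (auto simp: P_def N [symmetric])
      then show ?thesis unfolding prime_count_def by (simp add: card_image inj_on_def)
    qed
    finally show ?thesis .
  qed
  also have "(\<Sum>(p, k)\<in>?P2. 1 / real k) = real (prime_count (sqrt x)) / 2"
  proof -
    have "(\<Sum>(p, k)\<in>?P2. 1 / real k) = (\<Sum>pk\<in>?P2. 1 / 2)"
      by (intro sum.cong) auto
    also have "\<dots> = real (card ?P2) / 2" by simp
    also have "card ?P2 = prime_count (sqrt x)"
    proof -
      have "p\<^sup>2 \<le> N \<longleftrightarrow> real p \<le> sqrt x" for p
        unfolding N using x real_le_rsqrt [of "real p" x] real_sqrt_le_iff [of "(real p)\<^sup>2" x] by auto
      then have "?P2 = (\<lambda>p. (p, 2)) ` {p. prime p \<and> real p \<le> sqrt x}" by (auto simp: P_def)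
      then show ?thesis unfolding prime_count_def by (simp add: card_image inj_on_def)
    qed
    finally show ?thesis .
  qed
  finally have eq: "prime_power_pi x - real (prime_count x) - real (prime_count (sqrt x)) / 2 = (\<Sum>(p, k)\<in>?P3. 1 / real k)"
    by simp
  \<comment> \<open>Exponents k >= 3 force p <= x powr (1/3), and always k <= ln x / ln 2. Counting
    all such pairs with weight 1 stays below the order sqrt x / ln x.\<close>
  have "(\<Sum>(p, k)\<in>?P3. 1 / real k) \<le> (\<Sum>pk\<in>?P3. 1)"
    by (intro sum_mono) (auto simp: field_simps)
  also have "\<dots> = real (card ?P3)" by simp
  also have "\<dots> \<le> real (card ({1..nat \<lfloor>x powr (1/3)\<rfloor>} \<times> {1..nat \<lfloor>ln x / ln 2\<rfloor>}))"
  proof (intro of_nat_mono card_mono)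
    show "?P3 \<subseteq> {1..nat \<lfloor>x powr (1/3)\<rfloor>} \<times> {1..nat \<lfloor>ln x / ln 2\<rfloor>}"
    proof clarify
      fix p k assume pk: "(p, k) \<in> P" "snd (p, k) \<ge> 3"
      have p1: "p \<ge> 1" using pk by (auto simp: P_def Suc_le_eq prime_gt_0_nat)
      then have "p ^ 3 \<le> p ^ k" using pk by (intro power_increasing) auto
      then have "real (p ^ 3) \<le> x" using pk N [of "p ^ 3"] by (auto simp: P_def)
      then have "(real p ^ 3) powr (1/3) \<le> x powr (1/3)" by (intro powr_mono2) auto
      moreover have "(real p ^ 3) powr (1/3) = real p"
        using p1 by (simp add: powr_powr flip: powr_numeral)
      ultimately have "real p \<le> x powr (1/3)" by simp
      moreover have "real k \<le> ln x / ln 2" by (rule kle [OF pk(1)])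
      ultimately have "int p \<le> \<lfloor>x powr (1/3)\<rfloor>" "int k \<le> \<lfloor>ln x / ln 2\<rfloor>" by (simp_all add: le_floor_iff)
      then show "p \<in> {1..nat \<lfloor>x powr (1/3)\<rfloor>} \<and> k \<in> {1..nat \<lfloor>ln x / ln 2\<rfloor>}" using p1 pk by (auto simp: le_nat_iff)
    qed
  qed auto
  also have "\<dots> = real (nat \<lfloor>x powr (1/3)\<rfloor>) * real (nat \<lfloor>ln x / ln 2\<rfloor>)" by simp
  also have "\<dots> \<le> x powr (1/3) * (ln x / ln 2)"
    using x by (intro mult_mono) (auto intro: of_nat_floor)
  finally show ?thesis unfolding eq by (auto intro!: sum_nonneg)
qed

lemma prime_count_le:
  assumes "x \<ge> 0"
  shows "real (prime_count x) \<le> x"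
proof -
  have "{p::nat. prime p \<and> real p \<le> x} \<subseteq> {1..nat \<lfloor>x\<rfloor>}"
    by (auto simp: Suc_le_eq prime_gt_0_nat le_nat_iff le_floor_iff)
  then have "prime_count x \<le> nat \<lfloor>x\<rfloor>" unfolding prime_count_def using card_mono [of "{1..nat \<lfloor>x\<rfloor>}"] by fastforce
  then show ?thesis using assms by linarith
qed

section \<open>Asymptotics of the counts of primes and prime powers\<close>

context averaged_bound
begin

text \<open>The integrand is w(t) = sqrt t / (ln t)^2 times that of \<open>psi_err\<close>. Since w
  increases, the second mean value theorem bounds the integral by w(x) times increments of
  \<open>psi_err\<close>, which are o(ln x); and w(x) ln x is exactly sqrt x / ln x.\<close>

lemma psi_err_ln_small: "((\<lambda>x. psi_err_ln x * (ln x / sqrt x)) \<longlongrightarrow> 0) at_top"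
proof (rule tendstoI)
  fix e0 :: real assume e0: "e0 > 0"
  \<comment> \<open>The final bound is 5 e: one from the part up to \<open>X0\<close>, four from two
    increments of \<open>psi_err\<close>, each at most 2 e ln x.\<close>
  define e where "e = e0 / 8"
  have e: "e > 0" using e0 by (simp add: e_def)
  obtain X1 where X1: "\<And>x. x \<ge> X1 \<Longrightarrow> \<bar>psi_err x\<bar> \<le> e * ln x"
    using psi_err_eventually_le [OF e] unfolding eventually_at_top_linorder by auto
  define X0 where "X0 = max X1 60"
  have X0: "X0 \<ge> 60" "X0 \<ge> X1" by (auto simp: X0_def)
  have "((\<lambda>x. \<bar>psi_err_ln X0\<bar> * (ln x / sqrt x)) \<longlongrightarrow> 0) at_top" by real_asymp
  then have "\<forall>\<^sub>F x in at_top. \<bar>psi_err_ln X0\<bar> * (ln x / sqrt x) < e"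
    using e by (rule order_tendstoD)
  then show "\<forall>\<^sub>F x in at_top. dist (psi_err_ln x * (ln x / sqrt x)) 0 < e0"
    using eventually_ge_at_top [of X0]
  proof eventually_elim
    case (elim x)
    define w where "w t = sqrt t / (ln t)\<^sup>2" for t :: real
    let ?f = "\<lambda>t. (psi t - t) * (1 / (t * sqrt t))"
    let ?g = "\<lambda>t. (psi t - t) * (1 / (t * (ln t)\<^sup>2))"
    have x: "x \<ge> 60" using elim X0 by simp
    have fint: "?f integrable_on {X0..x}" using psi_err_diff_has_integral [of X0 x] X0 elim by (auto simp: integrable_on_def)
    obtain c where c: "c \<in> {X0..x}"
      and hi: "((\<lambda>t. w t * ?f t) has_integral (w X0 * integral {X0..c} ?f + w x * integral {c..x} ?f)) {X0..x}"
    proof (rule second_mean_value_theorem_full [OF fint elim(2), where g = w])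
      show "w s \<le> w t" if "X0 \<le> s" "s \<le> t" "t \<le> x" for s t
        unfolding w_def using that X0 by (intro sqrt_div_ln_squared_mono) auto
    qed blast
    have wf: "w t * ?f t = ?g t" if "t \<in> {X0..x}" for t
    proof -
      have "t > 0" using that X0 by auto
      then have "sqrt t \<noteq> 0" by simp
      then show ?thesis by (simp add: w_def)
    qed
    have gint: "integral {X0..x} ?g = w X0 * integral {X0..c} ?f + w x * integral {c..x} ?f"
      by (rule integral_unique [OF has_integral_eq [OF _ hi]]) (use wf in auto)
    have "integral {2..X0} ?g + integral {X0..x} ?g = integral {2..x} ?g"
      using psi_err_ln_has_integral [of x] x X0 elim by (intro HK_combine) (auto simp: integrable_on_def)
    then have J: "psi_err_ln x = psi_err_ln X0 + (w X0 * (psi_err c - psi_err X0) + w x * (psi_err x - psi_err c))"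
      using gint c X0 integral_unique [OF psi_err_diff_has_integral [of X0 c]] integral_unique [OF psi_err_diff_has_integral [of c x]]
      by (simp add: psi_err_ln_def)
    have lnx: "ln x > 0" using x by simp
    have Bt: "\<bar>psi_err t\<bar> \<le> e * ln x" if "t \<in> {X0..x}" for t
    proof -
      have "\<bar>psi_err t\<bar> \<le> e * ln t" using that X0 by (intro X1) auto
      also have "\<dots> \<le> e * ln x" using that X0 e by (intro mult_left_mono) auto
      finally show ?thesis .
    qed
    have w0: "0 \<le> w X0" "w X0 \<le> w x" "0 \<le> w x"
      using X0 elim x unfolding w_def by (auto intro!: sqrt_div_ln_squared_mono)
    have d1: "\<bar>psi_err c - psi_err X0\<bar> \<le> 2 * (e * ln x)" "\<bar>psi_err x - psi_err c\<bar> \<le> 2 * (e * ln x)"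
      using Bt [of c] Bt [of X0] Bt [of x] c elim(2) by auto
    have "\<bar>psi_err_ln x\<bar> \<le> \<bar>psi_err_ln X0\<bar> + (w X0 * \<bar>psi_err c - psi_err X0\<bar> + w x * \<bar>psi_err x - psi_err c\<bar>)"
      unfolding J using w0 by (intro order_trans [OF abs_triangle_ineq] add_mono order_trans [OF abs_triangle_ineq]) (auto simp: abs_mult)
    also have "\<dots> \<le> \<bar>psi_err_ln X0\<bar> + (w x * (2 * (e * ln x)) + w x * (2 * (e * ln x)))"
      using w0 d1 by (intro add_mono mult_mono) auto
    finally have "\<bar>psi_err_ln x\<bar> \<le> \<bar>psi_err_ln X0\<bar> + 4 * e * (w x * ln x)" by (simp add: algebra_simps)
    then have "\<bar>psi_err_ln x\<bar> * (ln x / sqrt x) \<le> (\<bar>psi_err_ln X0\<bar> + 4 * e * (w x * ln x)) * (ln x / sqrt x)"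
      using lnx x by (intro mult_right_mono) auto
    also have "\<dots> = \<bar>psi_err_ln X0\<bar> * (ln x / sqrt x) + 4 * e * (w x * ln x * (ln x / sqrt x))" by (simp add: algebra_simps)
    also have "w x * ln x * (ln x / sqrt x) = 1" using x lnx by (simp add: w_def power2_eq_square)
    finally have "\<bar>psi_err_ln x\<bar> * (ln x / sqrt x) < 5 * e" using elim by simp
    moreover have "dist (psi_err_ln x * (ln x / sqrt x)) 0 = \<bar>psi_err_ln x\<bar> * (ln x / sqrt x)"
      using lnx x by (simp add: dist_real_def abs_mult)
    ultimately show ?case using e0 unfolding e_def by linarith
  qed
qed

lemma prime_power_pi_asymptotics: "((\<lambda>x. prime_power_pi x * ln x / x) \<longlongrightarrow> 1) at_top"
proof -
  have "((\<lambda>x. 1 / sqrt x) \<longlongrightarrow> (0::real)) at_top" by real_asymp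
  then have "((\<lambda>x. psi_err_ln x * (ln x / sqrt x) * (1 / sqrt x) + psi x / x + li_sq x * ln x / x) \<longlongrightarrow> 0 * 0 + 1 + 0) at_top"
    by (intro tendsto_intros psi_err_ln_small psi_asymptotics li_sq_small)
  moreover have "\<forall>\<^sub>F x in at_top. psi_err_ln x * (ln x / sqrt x) * (1 / sqrt x) + psi x / x + li_sq x * ln x / x = prime_power_pi x * ln x / x"
    using eventually_ge_at_top [of 2]
  proof eventually_elim
    case (elim x)
    then have l: "ln x > 0" and s: "sqrt x * sqrt x = x" by auto
    have "psi_err_ln x * (ln x / sqrt x) * (1 / sqrt x) = psi_err_ln x * ln x / x" using s by simp
    also have "psi_err_ln x * ln x = prime_power_pi x * ln x - psi x - li_sq x * ln x"
      unfolding psi_err_ln_eq [OF elim] using l by (simp add: algebra_simps)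
    finally show ?case by (simp add: diff_divide_distrib)
  qed
  ultimately show ?thesis by (simp add: filterlim_cong)
qed

text \<open>The prime number theorem, wanted at sqrt x to evaluate the contribution of the squares
  of primes. Higher powers are estimated here by the trivial bound for the count up to sqrt
  x.\<close>

lemma prime_count_asymptotics: "((\<lambda>x. real (prime_count x) * ln x / x) \<longlongrightarrow> 1) at_top"
proof -
  have "((\<lambda>x. prime_power_pi x * ln x / x - real (prime_count x) * ln x / x) \<longlongrightarrow> 0) at_top"
  proof (rule Lim_null_comparison)
    show "((\<lambda>x::real. (x powr (1/3) * (ln x / ln 2) + sqrt x) * ln x / x) \<longlongrightarrow> 0) at_top" by real_asymp
    show "\<forall>\<^sub>F x in at_top. norm (prime_power_pi x * ln x / x - real (prime_count x) * ln x / x) \<le> (x powr (1/3) * (ln x / ln 2) + sqrt x) * ln x / x"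
      using eventually_ge_at_top [of 2]
    proof eventually_elim
      case (elim x)
      have "real (prime_count (sqrt x)) \<le> sqrt x" using elim by (intro prime_count_le) auto
      then have "\<bar>prime_power_pi x - real (prime_count x)\<bar> \<le> x powr (1/3) * (ln x / ln 2) + sqrt x"
        using prime_power_pi_bounds [OF elim] by auto
      then have "\<bar>prime_power_pi x - real (prime_count x)\<bar> * (ln x / x) \<le> (x powr (1/3) * (ln x / ln 2) + sqrt x) * (ln x / x)"
        using elim by (intro mult_right_mono) auto
      moreover have "prime_power_pi x * ln x / x - real (prime_count x) * ln x / x = (prime_power_pi x - real (prime_count x)) * (ln x / x)"
        by (simp add: algebra_simps diff_divide_distrib)
      ultimately show ?case using elim by (simp add: abs_mult)
    qed
  qed
  from tendsto_diff [OF prime_power_pi_asymptotics this] show ?thesis by simp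
qed

text \<open>Squares of primes contribute half the count up to sqrt x. This half cancels against ln
  (sqrt x) = ln x / 2, so the prime number theorem gives sqrt x / ln x with constant 1.\<close>

lemma prime_power_pi_minus_prime_count:
  "((\<lambda>x. (prime_power_pi x - real (prime_count x)) * (ln x / sqrt x)) \<longlongrightarrow> 1) at_top"
proof -
  have "filterlim sqrt at_top (at_top :: real filter)" by real_asymp
  from filterlim_compose [OF prime_count_asymptotics this]
  have a: "((\<lambda>x. real (prime_count (sqrt x)) * ln (sqrt x) / sqrt x) \<longlongrightarrow> 1) at_top" .
  have "((\<lambda>x. (prime_power_pi x - real (prime_count x)) * (ln x / sqrt x) - real (prime_count (sqrt x)) * ln (sqrt x) / sqrt x) \<longlongrightarrow> 0) at_top"
  proof (rule Lim_null_comparison)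
    show "((\<lambda>x::real. x powr (1/3) * (ln x / ln 2) * (ln x / sqrt x)) \<longlongrightarrow> 0) at_top" by real_asymp
    show "\<forall>\<^sub>F x in at_top. norm ((prime_power_pi x - real (prime_count x)) * (ln x / sqrt x) - real (prime_count (sqrt x)) * ln (sqrt x) / sqrt x) \<le> x powr (1/3) * (ln x / ln 2) * (ln x / sqrt x)"
      using eventually_ge_at_top [of 2]
    proof eventually_elim
      case (elim x)
      have "\<bar>prime_power_pi x - real (prime_count x) - real (prime_count (sqrt x)) / 2\<bar> \<le> x powr (1/3) * (ln x / ln 2)"
        using prime_power_pi_bounds [OF elim] by auto
      then have "\<bar>prime_power_pi x - real (prime_count x) - real (prime_count (sqrt x)) / 2\<bar> * (ln x / sqrt x) \<le> x powr (1/3) * (ln x / ln 2) * (ln x / sqrt x)"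
        using elim by (intro mult_right_mono) auto
      moreover have "(prime_power_pi x - real (prime_count x)) * (ln x / sqrt x) - real (prime_count (sqrt x)) * ln (sqrt x) / sqrt x
        = (prime_power_pi x - real (prime_count x) - real (prime_count (sqrt x)) / 2) * (ln x / sqrt x)"
        using elim by (simp add: ln_sqrt algebra_simps diff_divide_distrib)
      ultimately show ?case using elim by (simp add: abs_mult)
    qed
  qed
  from tendsto_add [OF this a] show ?thesis by simp
qed

end

subsection \<open>The step function approximation\<close>

lemma L_seq_Suc: "L_seq l (Suc n) = L_seq l n + (1 + real l * real n)"
  using h_step_eq [of l n] by (simp add: h_step_def)

lemma L_seq_ge:
  assumes "l \<ge> 1" "n \<ge> 1"
  shows "L_seq l n \<ge> (real n)\<^sup>2 / 2" "L_seq l n \<ge> real n"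
proof -
  have "real l * (real n - 1) \<ge> 1 * (real n - 1)" using assms by (intro mult_right_mono) auto
  then have "real n * (real l * (real n - 1) + 2) \<ge> real n * (1 * (real n - 1) + 2)" by (intro mult_left_mono) auto
  then show "L_seq l n \<ge> (real n)\<^sup>2 / 2" by (simp add: L_seq_def power2_eq_square algebra_simps)
  have "real l * (real n - 1) \<ge> 0" using assms by simp
  then have "real n * (real l * (real n - 1) + 2) \<ge> real n * 2" by (intro mult_left_mono) auto
  then show "L_seq l n \<ge> real n" by (simp add: L_seq_def)
qed

text \<open>The levels grow quadratically and the steps linearly, so the square of a step is
  comparable to its level; this keeps the error of each step in \<open>li_diff_step\<close> of order
  1 / (ln n)^2.\<close>

lemma h_step_squared_le:
  assumes "l \<ge> 1" "n \<ge> 2"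
  shows "(1 + real l * real n)\<^sup>2 \<le> 16 * real l * L_seq l n"
proof -
  have "1 * 1 \<le> real l * real n" using assms by (intro mult_mono) auto
  then have "(1 + real l * real n)\<^sup>2 \<le> (2 * (real l * real n))\<^sup>2" by (intro power_mono) auto
  also have "\<dots> = 8 * real l * (real l * real n * (real n / 2))" by (simp add: power2_eq_square)
  also have "\<dots> \<le> 8 * real l * (real l * real n * (real n - 1))"
    using assms by (intro mult_left_mono) auto
  also have "\<dots> \<le> 16 * real l * L_seq l n" by (simp add: L_seq_def algebra_simps)
  finally show ?thesis .
qed

text \<open>On a step from a to b = a + h the integrand 1 / ln t lies between 1 / ln b and 1 / ln a,
  so the error is at most h (1 / ln a - 1 / ln b) <= h^2 / (a (ln a)^2). Variable x covers both a
  full step and the unfinished last one.\<close>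

lemma li_diff_step:
  assumes l: "l \<ge> 1" and n: "n \<ge> 2" and x: "L_seq l n \<le> x" "x \<le> L_seq l (Suc n)"
  shows "li x - li (L_seq l n) - (x - L_seq l n) / ln (L_seq l (Suc n)) \<in> {0..16 * real l / (ln (real n))\<^sup>2}"
proof -
  define a b where "a = L_seq l n" and "b = L_seq l (Suc n)"
  define h where "h = 1 + real l * real n"
  have an: "a \<ge> real n" unfolding a_def using l n by (intro L_seq_ge) auto
  then have a2: "a \<ge> 2" using n by linarith
  have b: "b = a + h" by (simp add: a_def b_def h_def L_seq_Suc)
  have h0: "h > 0" by (simp add: h_def add_pos_nonneg)
  have ab: "a \<le> x" "x \<le> b" "a < b" using x h0 by (auto simp: a_def b_def L_seq_Suc h_def)
  have la: "ln a > 0" "ln b > 0" "ln a \<le> ln b" using a2 ab by auto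
  have int: "(\<lambda>t. 1 / ln t) integrable_on {a..x}"
    by (rule integrable_on_subinterval [OF integrable_continuous_interval [OF inverse_ln_continuous(1) [of x]]]) (use a2 in auto)
  have "integral {2..a} (\<lambda>t. 1 / ln t) + integral {a..x} (\<lambda>t. 1 / ln t) = integral {2..x} (\<lambda>t. 1 / ln t)"
    using a2 ab by (intro HK_combine integrable_continuous_interval inverse_ln_continuous) auto
  then have I: "li x - li a = integral {a..x} (\<lambda>t. 1 / ln t)" by (simp add: li_def)
  have lo: "(x - a) / ln b \<le> integral {a..x} (\<lambda>t. 1 / ln t)"
  proof (rule has_integral_le [OF _ integrable_integral [OF int]])
    show "((\<lambda>t. 1 / ln b) has_integral (x - a) / ln b) {a..x}"
      using has_integral_const_real [of "1 / ln b" a x] ab by simp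
    show "1 / ln b \<le> 1 / ln t" if "t \<in> {a..x}" for t
      using that a2 ab by (intro divide_left_mono) auto
  qed
  have hi: "integral {a..x} (\<lambda>t. 1 / ln t) \<le> (x - a) / ln a"
  proof (rule has_integral_le [OF integrable_integral [OF int]])
    show "((\<lambda>t. 1 / ln a) has_integral (x - a) / ln a) {a..x}"
      using has_integral_const_real [of "1 / ln a" a x] ab by simp
    show "1 / ln t \<le> 1 / ln a" if "t \<in> {a..x}" for t
      using that a2 ab by (intro divide_left_mono) auto
  qed
  have "ln b - ln a \<le> (b - a) / a"
    using ln_le_minus_one [of "b / a"] a2 ab by (simp add: ln_div diff_divide_distrib)
  then have "(ln b - ln a) / (ln a * ln b) \<le> (h / a) / (ln a * ln a)"
    using la b a2 h0 by (intro frac_le mult_left_mono) auto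
  moreover have "1 / ln a - 1 / ln b = (ln b - ln a) / (ln a * ln b)" using la by (simp add: field_simps)
  ultimately have d: "1 / ln a - 1 / ln b \<le> h / (a * (ln a)\<^sup>2)" by (simp add: power2_eq_square mult.assoc)
  have "(x - a) / ln a - (x - a) / ln b = (x - a) * (1 / ln a - 1 / ln b)" by (simp add: algebra_simps)
  also have "\<dots> \<le> h * (h / (a * (ln a)\<^sup>2))"
    using d ab b la h0 by (intro mult_mono) (auto simp: field_simps)
  also have "\<dots> = h\<^sup>2 / a / (ln a)\<^sup>2" by (simp add: power2_eq_square)
  also have "\<dots> \<le> (16 * real l) / (ln (real n))\<^sup>2"
  proof (rule frac_le)
    show "h\<^sup>2 / a \<le> 16 * real l" using h_step_squared_le [OF l n] a2 by (simp add: h_def a_def pos_divide_le_eq)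
    have "0 \<le> ln (real n)" "ln (real n) \<le> ln a" using an n a2 by auto
    then show "(ln (real n))\<^sup>2 \<le> (ln a)\<^sup>2" by (intro power_mono) auto
    show "0 < (ln (real n))\<^sup>2" using n by simp
  qed simp
  finally show ?thesis using lo hi I unfolding a_def [symmetric] b_def [symmetric] by auto
qed

lemma Sigma_sum_Suc: "n \<ge> 1 \<Longrightarrow> Sigma_sum l (Suc n) = Sigma_sum l n + h_step l n / ln (L_seq l (Suc n))"
  by (simp add: Sigma_sum_def s_term_def)

lemma inverse_ln_squared_le_li_sq:
  assumes "n \<ge> 3"
  shows "1 / (ln (real n))\<^sup>2 \<le> li_sq (real n) - li_sq (real n - 1)"
proof -
  have "integral {2..real n - 1} (\<lambda>t. 1 / (ln t)\<^sup>2) + integral {real n - 1..real n} (\<lambda>t. 1 / (ln t)\<^sup>2) = integral {2..real n} (\<lambda>t. 1 / (ln t)\<^sup>2)"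
    using assms by (intro HK_combine integrable_continuous_interval inverse_ln_continuous) auto
  moreover have "1 / (ln (real n))\<^sup>2 \<le> integral {real n - 1..real n} (\<lambda>t. 1 / (ln t)\<^sup>2)"
  proof (rule has_integral_le)
    show "((\<lambda>t. 1 / (ln (real n))\<^sup>2) has_integral 1 / (ln (real n))\<^sup>2) {real n - 1..real n}"
      using has_integral_const_real [of "1 / (ln (real n))\<^sup>2" "real n - 1" "real n"] by simp
    show "((\<lambda>t. 1 / (ln t)\<^sup>2) has_integral integral {real n - 1..real n} (\<lambda>t. 1 / (ln t)\<^sup>2)) {real n - 1..real n}"
      by (intro integrable_integral integrable_on_subinterval [OF integrable_continuous_interval [OF inverse_ln_continuous(2) [of "real n"]]]) (use assms in auto)
    fix t assume t: "t \<in> {real n - 1..real n}"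
    then have "t \<ge> 2" using assms by auto
    then have "ln t > 0" "ln t \<le> ln (real n)" using t by auto
    then show "1 / (ln (real n))\<^sup>2 \<le> 1 / (ln t)\<^sup>2" by (intro divide_left_mono power_mono mult_pos_pos) auto
  qed
  ultimately show ?thesis by (simp add: li_sq_def)
qed

text \<open>The errors of the single steps add up to a multiple of the sum of 1 / (ln j)^2, which is
  compared with \<open>li_sq\<close>. With about sqrt x levels below x this is of smaller order than
  sqrt x / ln x.\<close>

lemma li_minus_Sigma_sum:
  assumes l: "l \<ge> 1" and n: "n \<ge> 2"
  shows "li (L_seq l n) - Sigma_sum l n - (li (L_seq l 2) - Sigma_sum l 2) \<in> {0..16 * real l * (1 / (ln 2)\<^sup>2 + li_sq (real n - 1))}"
  using n
proof (induction n rule: dec_induct)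
  case base
  then show ?case using li_sq_nonneg [of 1] by simp
next
  case (step n)
  have "li (L_seq l (Suc n)) - li (L_seq l n) - (L_seq l (Suc n) - L_seq l n) / ln (L_seq l (Suc n)) \<in> {0..16 * real l / (ln (real n))\<^sup>2}"
    using step l by (intro li_diff_step) (auto simp: L_seq_Suc add_nonneg_nonneg)
  moreover have "(L_seq l (Suc n) - L_seq l n) / ln (L_seq l (Suc n)) = Sigma_sum l (Suc n) - Sigma_sum l n"
    using step by (simp add: Sigma_sum_Suc h_step_def)
  ultimately have d: "(li (L_seq l (Suc n)) - Sigma_sum l (Suc n)) - (li (L_seq l n) - Sigma_sum l n) \<in> {0..16 * real l / (ln (real n))\<^sup>2}"
    by simp
  \<comment> \<open>Comparing 1 / (ln n)^2 with the integral over [n - 1, n] requires n >= 3; the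
    step n = 2 is paid for by the constant 1 / (ln 2)^2.\<close>
  have "16 * real l * (1 / (ln 2)\<^sup>2 + li_sq (real n - 1)) + 16 * real l / (ln (real n))\<^sup>2 \<le> 16 * real l * (1 / (ln 2)\<^sup>2 + li_sq (real n)) \<or> n = 2"
  proof (cases "n = 2")
    case False
    then have "n \<ge> 3" using step by simp
    from mult_left_mono [OF inverse_ln_squared_le_li_sq [OF this], of "16 * real l"]
    show ?thesis by (simp add: algebra_simps)
  qed simp
  then show ?case
  proof
    assume "n = 2"
    then show ?case using d by (simp add: li_sq_def)
  next
    assume "16 * real l * (1 / (ln 2)\<^sup>2 + li_sq (real n - 1)) + 16 * real l / (ln (real n))\<^sup>2 \<le> 16 * real l * (1 / (ln 2)\<^sup>2 + li_sq (real n))"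
    then show ?case using d step.IH by simp
  qed
qed

text \<open>\<open>S_hat\<close> is linear between levels, so its distance from \<open>li\<close>
  consists of a constant from level 2, the errors of the full steps below x, and one unfinished
  step.\<close>

lemma S_hat_minus_li:
  assumes l: "l \<ge> 1"
  shows "((\<lambda>x. (S_hat l x - li x) * (ln x / sqrt x)) \<longlongrightarrow> 0) at_top"
proof -
  \<comment> \<open>The offset at level 2 and two copies of 16 l / (ln 2)^2, one from
    \<open>li_minus_Sigma_sum\<close> and one from the unfinished step.\<close>
  define D where "D = \<bar>li (L_seq l 2) - Sigma_sum l 2\<bar> + 32 * real l / (ln 2)\<^sup>2"
  show ?thesis
  proof (rule Lim_null_comparison)
    have "filterlim (\<lambda>x. 2 * sqrt x) at_top (at_top :: real filter)" by real_asymp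
    from filterlim_compose [OF li_sq_small this]
    have "((\<lambda>x. li_sq (2 * sqrt x) * ln (2 * sqrt x) / (2 * sqrt x)) \<longlongrightarrow> 0) at_top" .
    moreover have "((\<lambda>x::real. 2 * ln x / ln (2 * sqrt x)) \<longlongrightarrow> 4) at_top" by real_asymp
    ultimately have a1: "((\<lambda>x. li_sq (2 * sqrt x) * ln (2 * sqrt x) / (2 * sqrt x) * (2 * ln x / ln (2 * sqrt x))) \<longlongrightarrow> 0 * 4) at_top"
      by (intro tendsto_mult)
    have a2: "((\<lambda>x. D * (ln x / sqrt x)) \<longlongrightarrow> 0) at_top" by real_asymp
    from tendsto_add [OF a2 tendsto_mult_left [OF a1, of "16 * real l"]] show "((\<lambda>x. D * (ln x / sqrt x) + 16 * real l * (li_sq (2 * sqrt x) * ln (2 * sqrt x) / (2 * sqrt x) * (2 * ln x / ln (2 * sqrt x)))) \<longlongrightarrow> 0) at_top"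
      by (simp only: mult_zero_left mult_zero_right add_0)
    show "\<forall>\<^sub>F x in at_top. norm ((S_hat l x - li x) * (ln x / sqrt x)) \<le> D * (ln x / sqrt x) + 16 * real l * (li_sq (2 * sqrt x) * ln (2 * sqrt x) / (2 * sqrt x) * (2 * ln x / ln (2 * sqrt x)))"
      using eventually_gt_at_top [of "L_seq l 2"] eventually_ge_at_top [of 2]
    proof eventually_elim
      case (elim x)
      define m where "m = level l x - 1"
      have lev: "level l x \<ge> 2" "L_seq l m < x" "x \<le> L_seq l (level l x)"
        unfolding m_def using level_bounds [OF l elim(2)] by auto
      have "level l x \<noteq> 2" using lev elim by auto
      then have m: "m \<ge> 2" "level l x = Suc m" using lev by (auto simp: m_def)
      \<comment> \<open>The definition interpolates downwards from the upper level; since the step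
        is the difference of the two levels, the same line is described from the lower one.\<close>
      have "S_hat l x = Sigma_sum l m + (x - L_seq l m) / ln (L_seq l (Suc m))"
        using m by (simp add: S_hat_def Sigma_sum_Suc h_step_def diff_divide_distrib)
      then have "li x - S_hat l x = (li x - li (L_seq l m) - (x - L_seq l m) / ln (L_seq l (Suc m))) + (li (L_seq l m) - Sigma_sum l m)"
        by simp
      moreover have "li x - li (L_seq l m) - (x - L_seq l m) / ln (L_seq l (Suc m)) \<in> {0..16 * real l / (ln (real m))\<^sup>2}"
        using lev m by (intro li_diff_step l) auto
      moreover have "16 * real l / (ln (real m))\<^sup>2 \<le> 16 * real l / (ln 2)\<^sup>2"
        using m by (intro divide_left_mono power_mono mult_pos_pos) auto
      moreover have "li_sq (real m - 1) \<le> li_sq (2 * sqrt x)"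
      proof (rule li_sq_mono)
        \<comment> \<open>m^2 / 2 <= L_m < x gives m <= sqrt (2 x), relaxed to 2 sqrt x.\<close>
        have "(real m)\<^sup>2 / 2 \<le> x" using L_seq_ge(1) [OF l, of m] m lev by simp
        then have "(real m)\<^sup>2 \<le> (2 * sqrt x)\<^sup>2" using elim by (simp add: power_mult_distrib)
        then have "real m \<le> 2 * sqrt x" by (rule power2_le_imp_le) (use elim in simp)
        then show "real m - 1 \<le> 2 * sqrt x" by simp
      qed
      then have "16 * real l * (1 / (ln 2)\<^sup>2 + li_sq (real m - 1)) \<le> 16 * real l * (1 / (ln 2)\<^sup>2 + li_sq (2 * sqrt x))"
        by (intro mult_left_mono) auto
      moreover have "16 * real l * (1 / (ln 2)\<^sup>2 + li_sq (2 * sqrt x)) + 16 * real l / (ln 2)\<^sup>2 = 32 * real l / (ln 2)\<^sup>2 + 16 * real l * li_sq (2 * sqrt x)"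
        by (simp add: algebra_simps)
      moreover have "0 \<le> 16 * real l * (1 / (ln 2)\<^sup>2 + li_sq (2 * sqrt x))" using li_sq_nonneg by simp
      ultimately have "\<bar>li x - S_hat l x\<bar> \<le> D + 16 * real l * li_sq (2 * sqrt x)"
        using li_minus_Sigma_sum [OF l m(1)] unfolding D_def by auto
      then have "\<bar>S_hat l x - li x\<bar> * (ln x / sqrt x) \<le> (D + 16 * real l * li_sq (2 * sqrt x)) * (ln x / sqrt x)"
        using elim by (intro mult_right_mono) auto
      also have "\<dots> = D * (ln x / sqrt x) + 16 * real l * (li_sq (2 * sqrt x) * (ln x / sqrt x))" by (simp add: algebra_simps)
      also have "li_sq (2 * sqrt x) * (ln x / sqrt x) = li_sq (2 * sqrt x) * ln (2 * sqrt x) / (2 * sqrt x) * (2 * ln x / ln (2 * sqrt x))"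
      proof -
        have "1 \<le> sqrt x" using elim by simp
        then have "1 < 2 * sqrt x" by linarith
        then have "ln (2 * sqrt x) > 0" by (rule ln_gt_zero)
        then show ?thesis by simp
      qed
      finally show ?case using elim by (simp add: abs_mult)
    qed
  qed
qed

lemma q_scale_pos:
  assumes l: "l \<ge> 1" and x: "x \<ge> 2"
  shows "q_scale l x > 0"
proof -
  have "L_seq l (level l x) \<ge> real (level l x)" "level l x \<ge> 2"
    using L_seq_ge(2) [OF l, of "level l x"] level_bounds [OF l x] by auto
  then have "L_seq l (level l x) > 1" by linarith
  then show ?thesis using l by (auto simp: q_scale_def h_step_eq intro!: divide_pos_pos mult_pos_pos add_pos_nonneg)
qed

text \<open>From 2 l L_m = h^2 - (l^2 m + 1) and x between two consecutive levels, 2 l x differs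
  from h^2 by O(l h). The rate 1 / sqrt x matters: in \<open>bias_decomposition\<close> the ratio
  minus 1 multiplies a quantity known only to be o(sqrt x).\<close>

lemma q_scale_asymptotics:
  assumes l: "l \<ge> 1" and x: "x \<ge> 3"
  shows "\<bar>sqrt (2 * x) / (ln x * q_scale l x) - 1\<bar> * sqrt x \<le> 5 * real l * (1 + 3 * real l) + 3 * real l"
proof -
  define k where "k = real l"
  define m where "m = level l x - 1"
  define h where "h = 1 + k * real m"
  define N where "N = L_seq l (Suc m)"
  have k: "k \<ge> 1" using l by (simp add: k_def)
  have lev: "level l x = Suc m" "m \<ge> 1" "L_seq l m < x" "x \<le> N"
    using level_bounds [OF l, of x] x by (auto simp: m_def N_def)
  have N: "N = L_seq l m + h" by (simp add: N_def L_seq_Suc h_def k_def)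
  have km: "k * real m \<ge> 0" using k by simp
  have h1: "h \<ge> 1" using km by (simp add: h_def)
  have Lm: "2 * k * L_seq l m = h\<^sup>2 - (k\<^sup>2 * real m + 1)"
    by (simp add: L_seq_def h_def k_def power2_eq_square field_simps)
  have r: "k\<^sup>2 * real m + 1 \<le> k * h" using k by (simp add: h_def power2_eq_square algebra_simps)
  have kk: "k * k \<ge> 1 * 1" using k by (intro mult_mono) auto
  have up: "2 * k * x \<le> h\<^sup>2 + 2 * k * h"
  proof -
    have "2 * k * x \<le> 2 * k * N" using lev k by (intro mult_left_mono) auto
    also have "\<dots> = h\<^sup>2 - (k\<^sup>2 * real m + 1) + 2 * k * h" unfolding N using Lm by (simp add: algebra_simps)
    finally show ?thesis using km k by simp (smt (verit) mult_nonneg_nonneg of_nat_0_le_iff zero_le_power2)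
  qed
  have lo: "2 * k * x \<ge> h\<^sup>2 - k * h"
  proof -
    have "2 * k * x \<ge> 2 * k * L_seq l m" using lev k by (intro mult_left_mono) auto
    then show ?thesis using Lm r by simp
  qed
  \<comment> \<open>The ratio factors as a * b: \<open>a\<close> compares sqrt (2 l x) with the step
    h, and \<open>b\<close> compares ln N with ln x.\<close>
  define a where "a = sqrt (2 * k * x) / h"
  define b where "b = ln N / ln x"
  have lnx: "ln x \<ge> 1"
  proof -
    have "exp 1 \<le> x" using x exp_le by linarith
    then show ?thesis using x by (simp add: ln_ge_iff)
  qed
  have a0: "a \<ge> 0" using h1 k x by (simp add: a_def)
  have a2: "a\<^sup>2 = 2 * k * x / h\<^sup>2" using k x by (simp add: a_def power_divide)
  have "\<bar>a\<^sup>2 - 1\<bar> \<le> 2 * k / h"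
  proof -
    have "\<bar>2 * k * x - h\<^sup>2\<bar> \<le> 2 * k * h" using up lo mult_nonneg_nonneg [of k h] k h1 by (simp add: abs_le_iff)
    then have "\<bar>2 * k * x - h\<^sup>2\<bar> / h\<^sup>2 \<le> 2 * k * h / h\<^sup>2" by (intro divide_right_mono) auto
    moreover have "a\<^sup>2 - 1 = (2 * k * x - h\<^sup>2) / h\<^sup>2" using h1 by (simp add: a2 diff_divide_distrib)
    moreover have "2 * k * h / h\<^sup>2 = 2 * k / h" using h1 by (simp add: power2_eq_square)
    ultimately show ?thesis by (simp add: abs_divide)
  qed
  moreover have "\<bar>a - 1\<bar> \<le> \<bar>a\<^sup>2 - 1\<bar>"
  proof -
    have "a\<^sup>2 - 1 = (a - 1) * (a + 1)" by (simp add: power2_eq_square algebra_simps)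
    then have "\<bar>a\<^sup>2 - 1\<bar> = \<bar>a - 1\<bar> * (a + 1)" using a0 by (simp add: abs_mult)
    then show ?thesis using mult_left_mono [of 1 "a + 1" "\<bar>a - 1\<bar>"] a0 by simp
  qed
  ultimately have a1: "\<bar>a - 1\<bar> \<le> 2 * k / h" by simp
  have hx: "sqrt x \<le> 2 * h"
  proof -
    have "2 * k * x \<le> h\<^sup>2 + 2 * k * h" by (rule up)
    also have "\<dots> \<le> k * h\<^sup>2 + 2 * k * h\<^sup>2"
      using k h1 mult_right_mono [of 1 k "h\<^sup>2"] mult_left_mono [of h "h\<^sup>2" "2 * k"] by (intro add_mono) (auto simp: power2_eq_square)
    finally have "k * (2 * x) \<le> k * (3 * h\<^sup>2)" by (simp add: algebra_simps)
    then have "2 * x \<le> 3 * h\<^sup>2" using k by simp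
    then have "x \<le> 4 * h\<^sup>2" using zero_le_power2 [of h] by linarith
    then have "x \<le> (2 * h)\<^sup>2" by (simp add: power_mult_distrib)
    then show ?thesis using h1 by (intro real_le_lsqrt) auto
  qed
  have hx2: "h \<le> 3 * k * sqrt x"
  proof (rule ccontr)
    assume "\<not> h \<le> 3 * k * sqrt x"
    then have g: "h > 3 * k * sqrt x" by simp
    have s1: "sqrt x \<ge> 1" using x by simp
    then have "k * 1 \<le> k * sqrt x" using k by (intro mult_left_mono) auto
    then have "h - k \<ge> 2 * k * sqrt x" using g by simp
    then have "h * (h - k) > 3 * k * sqrt x * (2 * k * sqrt x)"
      using g k s1 by (intro mult_less_le_imp_less) auto
    also have "3 * k * sqrt x * (2 * k * sqrt x) = 6 * (k * k) * x" using x by simp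
    finally have "6 * (k * k) * x < 2 * k * x" using lo by (simp add: power2_eq_square algebra_simps)
    then have "6 * (k * k) < 2 * k" by (rule mult_right_less_imp_less) (use x in simp)
    then show False using k mult_left_mono [of 1 k k] by simp
  qed
  have xN: "x \<le> N" "N - x \<le> h" using lev N by auto
  have b1: "1 \<le> b" "b - 1 \<le> 3 * k / sqrt x"
  proof -
    show "1 \<le> b" using lnx xN x by (simp add: b_def)
    have "ln N - ln x \<le> (N - x) / x"
      using ln_le_minus_one [of "N / x"] x xN by (simp add: ln_div diff_divide_distrib)
    also have "\<dots> \<le> (3 * k * sqrt x) / x" using xN hx2 x by (intro divide_right_mono) auto
    also have "\<dots> = 3 * k / sqrt x"
      using x by (simp add: divide_simps)
    finally have "ln N - ln x \<le> 3 * k / sqrt x" .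
    moreover have "b - 1 = (ln N - ln x) / ln x" using lnx by (simp add: b_def diff_divide_distrib)
    moreover have "(ln N - ln x) / ln x \<le> (ln N - ln x) / 1"
      using lnx xN x by (intro divide_left_mono) auto
    ultimately show "b - 1 \<le> 3 * k / sqrt x" by simp
  qed
  have ab: "sqrt (2 * x) / (ln x * q_scale l x) = a * b"
  proof -
    have q: "q_scale l x = h / (sqrt k * ln N)"
      by (simp add: q_scale_def lev(1) h_step_eq h_def k_def N_def)
    show ?thesis unfolding q a_def b_def using k by (simp add: real_sqrt_mult mult_ac)
  qed
  have b2: "b \<le> 1 + 3 * k"
  proof -
    have "3 * k / sqrt x \<le> 3 * k / 1" using k x by (intro divide_left_mono) auto
    then show ?thesis using b1 by simp
  qed
  have "\<bar>a * b - 1\<bar> = \<bar>(a - 1) * b + (b - 1)\<bar>" by (simp add: algebra_simps)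
  also have "\<dots> \<le> \<bar>a - 1\<bar> * b + (b - 1)" using b1 by (intro order_trans [OF abs_triangle_ineq]) (auto simp: abs_mult)
  also have "\<dots> \<le> 2 * k / h * (1 + 3 * k) + 3 * k / sqrt x"
    using a1 b2 b1 k by (intro add_mono mult_mono) auto
  finally have "\<bar>a * b - 1\<bar> * sqrt x \<le> (2 * k / h * (1 + 3 * k) + 3 * k / sqrt x) * sqrt x"
    using x by (intro mult_right_mono) auto
  also have "\<dots> = 2 * k * (1 + 3 * k) * (sqrt x / h) + 3 * k" using x by (simp add: field_simps)
  also have "\<dots> \<le> 2 * k * (1 + 3 * k) * 2 + 3 * k"
    using hx h1 k by (intro add_mono mult_left_mono) (auto simp: pos_divide_le_eq)
  also have "\<dots> \<le> 5 * k * (1 + 3 * k) + 3 * k" using k kk by (simp add: algebra_simps)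
  finally show ?thesis unfolding ab k_def .
qed

subsection \<open>The logarithmic mean\<close>

text \<open>A Cesaro argument for the measure dx / x: the part up to a fixed \<open>X0\<close> is a
  constant divided by ln (X / 2), and beyond it f is within e / 2 of the limit.\<close>

lemma log_mean_integral_tendsto:
  assumes int: "\<And>X. (\<lambda>x. f x / x) integrable_on {2..X}" and lim: "(f \<longlongrightarrow> (a::real)) at_top"
  shows "((\<lambda>X. 1 / ln (X / 2) * integral {2..X} (\<lambda>x. f x / x)) \<longlongrightarrow> a) at_top"
proof -
  have inv: "((\<lambda>x. c / x) has_integral c * (ln y - ln x)) {x..y}" if "0 < x" "x \<le> y" for c x y :: real
    unfolding right_diff_distrib using that
    by (intro has_integral_antiderivative) (auto intro!: derivative_eq_intros)
  have "((\<lambda>X. 1 / ln (X / 2) * integral {2..X} (\<lambda>x. f x / x) - a) \<longlongrightarrow> 0) at_top"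
  proof (rule tendstoI)
    fix e :: real assume e: "e > 0"
    have "\<forall>\<^sub>F x in at_top. dist (f x) a < e / 2" using tendstoD [OF lim, of "e/2"] e by simp
    then obtain X1 where X1: "\<And>x. x \<ge> X1 \<Longrightarrow> dist (f x) a < e / 2" unfolding eventually_at_top_linorder by auto
    define X0 where "X0 = max X1 2"
    define I where "I = integral {2..X0} (\<lambda>x. f x / x) - a * (ln X0 - ln 2)"
    have "((\<lambda>X. \<bar>I\<bar> / ln (X / 2)) \<longlongrightarrow> 0) at_top" by real_asymp
    then have "\<forall>\<^sub>F X in at_top. \<bar>I\<bar> / ln (X / 2) < e / 2" by (rule order_tendstoD) (use e in simp)
    then show "\<forall>\<^sub>F X in at_top. dist (1 / ln (X / 2) * integral {2..X} (\<lambda>x. f x / x) - a) 0 < e"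
      using eventually_gt_at_top [of X0]
    proof eventually_elim
      case (elim X)
      have X: "X0 \<ge> 2" "X > 2" "X0 \<le> X" using elim by (auto simp: X0_def)
      have lX: "ln (X / 2) = ln X - ln 2" "ln (X / 2) > 0" using X by (auto simp: ln_div)
      have i1: "(\<lambda>x. f x / x) integrable_on {X0..X}"
        by (rule integrable_on_subinterval [OF int [of X]]) (use X in auto)
      have comb: "integral {2..X0} (\<lambda>x. f x / x) + integral {X0..X} (\<lambda>x. f x / x) = integral {2..X} (\<lambda>x. f x / x)"
        using X by (intro HK_combine int) auto
      have ia: "((\<lambda>x. a / x) has_integral a * (ln X - ln X0)) {X0..X}" using X by (intro inv) auto
      have d: "((\<lambda>x. f x / x - a / x) has_integral (integral {X0..X} (\<lambda>x. f x / x) - a * (ln X - ln X0))) {X0..X}"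
        by (intro has_integral_diff ia integrable_integral i1)
      have "norm (integral {X0..X} (\<lambda>x. f x / x - a / x)) \<le> integral {X0..X} (\<lambda>x. (e/2) / x)"
      proof (rule integral_norm_bound_integral)
        show "(\<lambda>x. f x / x - a / x) integrable_on {X0..X}" using d by (auto simp: integrable_on_def)
        show "(\<lambda>x. (e/2) / x) integrable_on {X0..X}" using inv [of X0 X "e/2"] X by (auto simp: integrable_on_def)
        fix x assume x: "x \<in> {X0..X}"
        have x0: "x > 0" "x \<ge> X1" using x X by (auto simp: X0_def)
        have "\<bar>f x - a\<bar> / x \<le> (e/2) / x" using X1 [OF x0(2)] x0 by (intro divide_right_mono) (auto simp: dist_real_def)
        then show "norm (f x / x - a / x) \<le> (e/2) / x" using x0 by (simp flip: diff_divide_distrib)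
      qed
      also have "\<dots> = (e/2) * (ln X - ln X0)" using inv [of X0 X "e/2"] X by (intro integral_unique) auto
      also have "\<dots> \<le> (e/2) * ln (X / 2)" unfolding lX(1) using X e by (intro mult_left_mono) auto
      finally have b: "\<bar>integral {X0..X} (\<lambda>x. f x / x) - a * (ln X - ln X0)\<bar> \<le> (e/2) * ln (X / 2)"
        using d by (simp add: integral_unique)
      have "integral {2..X} (\<lambda>x. f x / x) - a * ln (X / 2) = I + (integral {X0..X} (\<lambda>x. f x / x) - a * (ln X - ln X0))"
        unfolding I_def lX(1) using comb by (simp add: algebra_simps)
      then have "\<bar>integral {2..X} (\<lambda>x. f x / x) - a * ln (X / 2)\<bar> \<le> \<bar>I\<bar> + (e/2) * ln (X / 2)" using b by linarith
      then have "\<bar>integral {2..X} (\<lambda>x. f x / x) - a * ln (X / 2)\<bar> / ln (X / 2) \<le> \<bar>I\<bar> / ln (X / 2) + e / 2"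
        using lX(2) by (simp add: field_simps)
      moreover have "1 / ln (X / 2) * integral {2..X} (\<lambda>x. f x / x) - a = (integral {2..X} (\<lambda>x. f x / x) - a * ln (X / 2)) / ln (X / 2)"
        using lX(2) by (simp add: field_simps)
      moreover have "\<bar>(integral {2..X} (\<lambda>x. f x / x) - a * ln (X / 2)) / ln (X / 2)\<bar> = \<bar>integral {2..X} (\<lambda>x. f x / x) - a * ln (X / 2)\<bar> / ln (X / 2)"
        using lX(2) by (simp add: abs_divide)
      ultimately show ?case using elim unfolding dist_real_def diff_0_right by linarith
    qed
  qed
  then show ?thesis by (simp add: LIM_zero_iff)
qed

section \<open>Measurability and integrability of the bias\<close>

lemma prime_count_mono: "x \<le> y \<Longrightarrow> prime_count x \<le> prime_count y"
proof -
  assume "x \<le> y"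
  have "{p::nat. prime p \<and> real p \<le> y} \<subseteq> {..nat \<lfloor>y\<rfloor>}" by (auto simp: le_nat_iff le_floor_iff)
  then have "finite {p::nat. prime p \<and> real p \<le> y}" by (rule finite_subset) simp
  then show ?thesis unfolding prime_count_def using \<open>x \<le> y\<close> by (intro card_mono) auto
qed

lemma level_measurable: "level l \<in> borel \<rightarrow>\<^sub>M count_space UNIV"
proof -
  have "nu l \<in> borel_measurable borel" unfolding nu_def [abs_def] by measurable
  then have "(\<lambda>x. \<lceil>nu l x\<rceil>) \<in> borel \<rightarrow>\<^sub>M count_space UNIV" by measurable
  then show ?thesis unfolding level_def [abs_def] by measurable
qed

lemma level_mono:
  assumes "l \<ge> 1" "0 \<le> x" "x \<le> y"
  shows "level l x \<le> level l y"
proof -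
  have "8 * real l * x \<le> 8 * real l * y" using assms by (intro mult_left_mono) auto
  then have "nu l x \<le> nu l y" unfolding nu_def using assms
    by (intro divide_right_mono) auto
  then show ?thesis unfolding level_def by (intro nat_mono ceiling_mono)
qed

text \<open>For a fixed level the integrand is elementary apart from the monotone prime count.
  Levels are countable, which gives measurability, and finitely many occur up to X, which gives
  boundedness. The Lebesgue integral in \<open>log_mean\<close> can then be replaced by the gauge
  integral.\<close>

lemma bias_set_integrable:
  assumes l: "l \<ge> 1"
  shows "set_integrable lborel {2..X} (\<lambda>x. (S_approx l c x - real (prime_count x)) / q_scale l x / x)"
proof -
  define q where "q n = h_step l (n - 1) / (sqrt (real l) * ln (L_seq l n))" for n
  define d where "d n x = (L_seq l n - x) / ln (L_seq l n)" for n x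
  define D where "D n = (\<bar>L_seq l n\<bar> + \<bar>X\<bar>) / \<bar>ln (L_seq l n)\<bar>" for n
  define F where "F n x = (Sigma_sum l n - d n x - c * q n - real (prime_count x))
     / q n / x" for n x
  have eq: "(S_approx l c x - real (prime_count x)) / q_scale l x / x = F (level l x) x" for x
    by (simp add: F_def q_def d_def S_approx_def S_hat_def q_scale_def)
  have pm: "(\<lambda>x. real (prime_count x)) \<in> borel_measurable borel"
    by (intro borel_measurable_mono monoI of_nat_mono prime_count_mono)
  have meas: "(\<lambda>x. F (level l x) x) \<in> borel_measurable borel"
  proof (rule measurable_compose_countable [OF _ level_measurable])
    show "F n \<in> borel_measurable borel" for n
      unfolding F_def d_def using pm by measurable
  qed
  \<comment> \<open>A bound for the integrand on level n; summing these nonnegative bounds over all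
    levels up to that of X gives one constant.\<close>
  define G where "G n = (\<bar>Sigma_sum l n\<bar> + D n + \<bar>c * q n\<bar> + real (prime_count X))
     / \<bar>q n\<bar>" for n
  have G0: "G n \<ge> 0" for n unfolding G_def D_def by (intro divide_nonneg_nonneg add_nonneg_nonneg) auto
  have bound: "norm (F (level l x) x) \<le> (\<Sum>n\<le>level l X. G n)" if x: "x \<in> {2..X}" for x
  proof -
    define n where "n = level l x"
    have "norm (F n x) \<le> G n / 1"
      unfolding F_def real_norm_def abs_divide
    proof (rule frac_le)
      show "0 \<le> G n" by (rule G0)
      have "real (prime_count x) \<le> real (prime_count X)" using x by (intro of_nat_mono prime_count_mono) auto
      moreover have "\<bar>d n x\<bar> \<le> D n"
        unfolding d_def D_def abs_divide using x by (intro divide_right_mono) auto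
      ultimately have "\<bar>Sigma_sum l n - d n x - c * q n - real (prime_count x)\<bar>
        \<le> \<bar>Sigma_sum l n\<bar> + D n + \<bar>c * q n\<bar> + real (prime_count X)"
        by linarith
      then show "\<bar>Sigma_sum l n - d n x - c * q n - real (prime_count x)\<bar>
         / \<bar>q n\<bar> \<le> G n"
        unfolding G_def by (intro divide_right_mono) auto
    qed (use x in auto)
    also have "\<dots> = G n" by simp
    also have "\<dots> \<le> (\<Sum>n\<le>level l X. G n)"
      unfolding n_def using x by (intro member_le_sum G0 level_mono) (auto intro!: level_mono l)
    finally show ?thesis by (simp add: n_def)
  qed
  show ?thesis unfolding set_integrable_def eq
  proof (rule integrableI_bounded_set_indicator)
    show "AE x in lborel. x \<in> {2..X} \<longrightarrow> norm (F (level l x) x) \<le> (\<Sum>n\<le>level l X. G n)"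
      using bound by (intro AE_I2) auto
    show "emeasure lborel {2..X} < \<infinity>" by (simp add: emeasure_lborel_Icc_eq)
  qed (use meas in auto)
qed

section \<open>The limit of the logarithmic mean\<close>

context averaged_bound
begin

text \<open>The numerator passes through \<open>li\<close> and \<open>prime_power_pi\<close>: at
  scale sqrt x / ln x the distance of \<open>S_hat\<close> to \<open>li\<close> and
  \<open>psi_err_ln\<close> vanish, and the prime powers contribute 1. The term with x - psi x is
  kept on the left, since only its logarithmic mean is controlled.\<close>

lemma bias_decomposition:
  assumes l: "l \<ge> 1"
  shows "((\<lambda>x. (S_approx l c x - real (prime_count x)) / q_scale l x - (x - psi x) / sqrt x / sqrt 2) \<longlongrightarrow> 1 / sqrt 2 - c) at_top"
proof -
  \<comment> \<open>\<open>g\<close> is the error at scale sqrt x / ln x, and \<open>r\<close>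
    compares \<open>q_scale\<close> with sqrt (2 x) / ln x, so the bias is r x * g x / sqrt 2 -
    c.\<close>
  define g where "g x = (S_hat l x - real (prime_count x)) * (ln x / sqrt x)" for x
  define r where "r x = sqrt (2 * x) / (ln x * q_scale l x)" for x
  have "((\<lambda>x::real. 2 / ln 2 * (ln x / sqrt x)) \<longlongrightarrow> 0) at_top" by real_asymp
  then have "((\<lambda>x. (S_hat l x - li x) * (ln x / sqrt x) - 2 / ln 2 * (ln x / sqrt x) - psi_err_ln x * (ln x / sqrt x)
     + (prime_power_pi x - real (prime_count x)) * (ln x / sqrt x)) \<longlongrightarrow> 0 - 0 - 0 + 1) at_top"
    by (intro tendsto_intros S_hat_minus_li l psi_err_ln_small prime_power_pi_minus_prime_count)
  moreover have "\<forall>\<^sub>F x in at_top. (S_hat l x - li x) * (ln x / sqrt x) - 2 / ln 2 * (ln x / sqrt x) - psi_err_ln x * (ln x / sqrt x)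
     + (prime_power_pi x - real (prime_count x)) * (ln x / sqrt x) = g x - (x - psi x) / sqrt x"
    using eventually_ge_at_top [of 2]
  proof eventually_elim
    case (elim x)
    then have "ln x > 0" by simp
    then have e1: "(x - psi x) / sqrt x = (x - psi x) / ln x * (ln x / sqrt x)" by simp
    have e2: "S_hat l x - real (prime_count x) = (S_hat l x - li x) + ((x - psi x) / ln x - 2 / ln 2 - psi_err_ln x) + (prime_power_pi x - real (prime_count x))"
      using li_minus_prime_power_pi [OF elim] by simp
    show ?case unfolding g_def e1 e2 by (simp only: ring_distribs)
  qed
  ultimately have glim: "((\<lambda>x. g x - (x - psi x) / sqrt x) \<longlongrightarrow> 1) at_top" by (simp add: filterlim_cong)
  \<comment> \<open>By \<open>glim\<close> and the prime number theorem g x / sqrt x tends to 0,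
    while |r x - 1| * sqrt x is bounded by \<open>q_scale_asymptotics\<close>.\<close>
  have rg: "((\<lambda>x. (r x - 1) * g x) \<longlongrightarrow> 0) at_top"
  proof (rule Lim_null_comparison)
    define C where "C = 5 * real l * (1 + 3 * real l) + 3 * real l"
    have "((\<lambda>x::real. 1 / sqrt x) \<longlongrightarrow> 0) at_top" by real_asymp
    from tendsto_add [OF tendsto_mult [OF glim this] tendsto_diff [OF tendsto_const psi_asymptotics, of 1]]
    have "((\<lambda>x. (g x - (x - psi x) / sqrt x) * (1 / sqrt x) + (1 - psi x / x)) \<longlongrightarrow> 0) at_top" by simp
    then show "((\<lambda>x. C * \<bar>(g x - (x - psi x) / sqrt x) * (1 / sqrt x) + (1 - psi x / x)\<bar>) \<longlongrightarrow> 0) at_top"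
      by (intro tendsto_mult_right_zero tendsto_rabs_zero)
    show "\<forall>\<^sub>F x in at_top. norm ((r x - 1) * g x) \<le> C * \<bar>(g x - (x - psi x) / sqrt x) * (1 / sqrt x) + (1 - psi x / x)\<bar>"
      using eventually_ge_at_top [of 3]
    proof eventually_elim
      case (elim x)
      have s: "sqrt x > 0" "sqrt x * sqrt x = x" using elim by auto
      have "(g x - (x - psi x) / sqrt x) * (1 / sqrt x) = g x / sqrt x - (x - psi x) / (sqrt x * sqrt x)"
        by (simp add: diff_divide_distrib)
      also have "\<dots> = g x / sqrt x - (1 - psi x / x)" unfolding s(2) using elim by (simp add: diff_divide_distrib)
      finally have e: "(g x - (x - psi x) / sqrt x) * (1 / sqrt x) + (1 - psi x / x) = g x / sqrt x" by simp
      have "norm ((r x - 1) * g x) = \<bar>r x - 1\<bar> * sqrt x * \<bar>g x / sqrt x\<bar>"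
        using s(1) by (simp add: abs_mult abs_divide)
      also have "\<dots> \<le> C * \<bar>g x / sqrt x\<bar>"
        unfolding r_def C_def by (intro mult_right_mono q_scale_asymptotics l elim) auto
      finally show ?case unfolding e .
    qed
  qed
  have "((\<lambda>x. ((g x - (x - psi x) / sqrt x) + (r x - 1) * g x) / sqrt 2 - c) \<longlongrightarrow> (1 + 0) / sqrt 2 - c) at_top"
    by (intro tendsto_intros glim rg) auto
  moreover have "\<forall>\<^sub>F x in at_top. ((g x - (x - psi x) / sqrt x) + (r x - 1) * g x) / sqrt 2 - c = (S_approx l c x - real (prime_count x)) / q_scale l x - (x - psi x) / sqrt x / sqrt 2"
    using eventually_ge_at_top [of 2]
  proof eventually_elim
    case (elim x)
    have q: "q_scale l x > 0" by (rule q_scale_pos [OF l elim])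
    have lx: "ln x > 0" "sqrt x > 0" using elim by auto
    have "r x * g x / sqrt 2 = (S_hat l x - real (prime_count x)) / q_scale l x"
      unfolding r_def g_def using q lx by (simp add: real_sqrt_mult)
    moreover have "(S_approx l c x - real (prime_count x)) / q_scale l x = (S_hat l x - real (prime_count x)) / q_scale l x - c"
      using q by (simp add: S_approx_def diff_divide_distrib)
    moreover have "((g x - (x - psi x) / sqrt x) + (r x - 1) * g x) / sqrt 2 - c = r x * g x / sqrt 2 - (x - psi x) / sqrt x / sqrt 2 - c"
      by (simp add: algebra_simps diff_divide_distrib add_divide_distrib)
    ultimately show ?case by simp
  qed
  ultimately show ?thesis by (simp add: filterlim_cong)
qed

text \<open>The oscillating part integrates exactly to - (psi_err X - psi_err 2) / sqrt 2, which is
  o(ln X). What remains converges, so its logarithmic mean has the same limit.\<close>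

lemma mean_bias_tendsto:
  assumes l: "l \<ge> 1"
  shows "(mean_bias l c \<longlongrightarrow> 1 / sqrt 2 - c) at_top"
proof -
  define F where "F x = (S_approx l c x - real (prime_count x)) / q_scale l x" for x
  define E where "E x = F x - (x - psi x) / sqrt x / sqrt 2" for x
  have Fint: "(\<lambda>x. F x / x) integrable_on {2..X}" for X
    unfolding F_def by (rule set_borel_integral_eq_integral(1) [OF bias_set_integrable [OF l]])
  have mb: "mean_bias l c X = 1 / ln (X / 2) * integral {2..X} (\<lambda>x. F x / x)" for X
    unfolding mean_bias_def log_mean_def F_def
    by (subst set_borel_integral_eq_integral(2) [OF bias_set_integrable [OF l]]) simp
  have Rint: "((\<lambda>x. (x - psi x) / sqrt x / sqrt 2 / x) has_integral (- (psi_err X - psi_err 2) / sqrt 2)) {2..X}" if "X \<ge> 2" for X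
  proof -
    have "((\<lambda>x. (psi x - x) * (1 / (x * sqrt x)) * (- 1 / sqrt 2)) has_integral ((psi_err X - psi_err 2) * (- 1 / sqrt 2))) {2..X}"
      using that by (intro has_integral_mult_left psi_err_diff_has_integral) auto
    then show ?thesis by (rule has_integral_eq_rhs [OF has_integral_eq [rotated]]) (auto simp: field_simps)
  qed
  have Eint: "(\<lambda>x. E x / x) integrable_on {2..X}" for X
  proof (cases "X \<ge> 2")
    case True
    have "(\<lambda>x. F x / x - (x - psi x) / sqrt x / sqrt 2 / x) integrable_on {2..X}"
      using Rint [OF True] by (intro integrable_diff Fint) (auto simp: integrable_on_def)
    then show ?thesis by (simp add: E_def diff_divide_distrib)
  next
    case False
    then have "{2..X} = {}" by auto
    then show ?thesis by (simp only: integrable_on_empty)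
  qed
  have "(E \<longlongrightarrow> 1 / sqrt 2 - c) at_top"
    unfolding E_def [abs_def] F_def by (rule bias_decomposition [OF l])
  from log_mean_integral_tendsto [OF Eint this]
  have a: "((\<lambda>X. 1 / ln (X / 2) * integral {2..X} (\<lambda>x. E x / x)) \<longlongrightarrow> 1 / sqrt 2 - c) at_top" .
  have "((\<lambda>X::real. ln X / ln (X / 2)) \<longlongrightarrow> 1) at_top" by real_asymp
  moreover have "((\<lambda>X. psi_err 2 / ln (X / 2)) \<longlongrightarrow> 0) at_top" by real_asymp
  ultimately have "((\<lambda>X. (psi_err 2 / ln (X / 2) - psi_err X / ln X * (ln X / ln (X / 2))) / sqrt 2) \<longlongrightarrow> (0 - 0 * 1) / sqrt 2) at_top"
    by (intro tendsto_intros psi_err_small) auto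
  from tendsto_add [OF a this]
  have "((\<lambda>X. 1 / ln (X / 2) * integral {2..X} (\<lambda>x. E x / x) + (psi_err 2 / ln (X / 2) - psi_err X / ln X * (ln X / ln (X / 2))) / sqrt 2) \<longlongrightarrow> 1 / sqrt 2 - c) at_top"
    by simp
  moreover have "\<forall>\<^sub>F X in at_top. 1 / ln (X / 2) * integral {2..X} (\<lambda>x. E x / x) + (psi_err 2 / ln (X / 2) - psi_err X / ln X * (ln X / ln (X / 2))) / sqrt 2 = mean_bias l c X"
    using eventually_gt_at_top [of 2]
  proof eventually_elim
    case (elim X)
    have "ln (X / 2) > 0" "ln X > 0" using elim by auto
    have "integral {2..X} (\<lambda>x. E x / x) = integral {2..X} (\<lambda>x. F x / x - (x - psi x) / sqrt x / sqrt 2 / x)"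
      by (simp add: E_def diff_divide_distrib)
    also have "\<dots> = integral {2..X} (\<lambda>x. F x / x) - (- (psi_err X - psi_err 2) / sqrt 2)"
      using elim by (intro integral_unique has_integral_diff integrable_integral Fint Rint) auto
    finally have "integral {2..X} (\<lambda>x. E x / x) = integral {2..X} (\<lambda>x. F x / x) + (psi_err X - psi_err 2) / sqrt 2" by (simp add: diff_divide_distrib)
    moreover have "(psi_err 2 / ln (X / 2) - psi_err X / ln X * (ln X / ln (X / 2))) / sqrt 2 = 1 / ln (X / 2) * (- ((psi_err X - psi_err 2) / sqrt 2))"
      using \<open>ln X > 0\<close> by (simp add: diff_divide_distrib mult.commute)
    ultimately show ?case unfolding mb by (simp only: ring_distribs)
  qed
  ultimately show ?thesis by (simp add: filterlim_cong)
qed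

end

theorem theorem5p3:
  fixes l :: nat
  assumes RH: "riemann_hypothesis"
    and l: "l \<ge> 1"
  shows "(\<forall>c::real. (mean_bias l c \<longlongrightarrow> 1 / sqrt 2 - c) at_top)
    \<and> (\<forall>c::real. (mean_bias l c \<longlongrightarrow> 0) at_top \<longleftrightarrow> c = 1 / sqrt 2)
    \<and> (\<forall>c::real. is_arg_min (\<lambda>c. \<bar>limiting_bias l c\<bar>) (\<lambda>_. True) c \<longleftrightarrow> c = 1 / sqrt 2)"
proof -
  interpret averaged_bound
    by standard (rule psi_half_asymptotics [OF RH])
  have lim: "(mean_bias l c \<longlongrightarrow> 1 / sqrt 2 - c) at_top" for c
    by (rule mean_bias_tendsto [OF l])
  have zero: "(mean_bias l c \<longlongrightarrow> 0) at_top \<longleftrightarrow> c = 1 / sqrt 2" for c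
  proof
    assume "(mean_bias l c \<longlongrightarrow> 0) at_top"
    from tendsto_unique [OF _ this lim [of c]] show "c = 1 / sqrt 2" by simp
  next
    assume "c = 1 / sqrt 2"
    then show "(mean_bias l c \<longlongrightarrow> 0) at_top" using lim [of c] by simp
  qed
  \<comment> \<open>\<open>Lim\<close> is a definite description, so its value is known only through
    the convergence just proved.\<close>
  have lb: "limiting_bias l c = 1 / sqrt 2 - c" for c
    unfolding limiting_bias_def by (rule tendsto_Lim [OF _ lim]) simp
  have "is_arg_min (\<lambda>c. \<bar>limiting_bias l c\<bar>) (\<lambda>_. True) c \<longleftrightarrow> c = 1 / sqrt 2" for c
  proof
    assume "is_arg_min (\<lambda>c. \<bar>limiting_bias l c\<bar>) (\<lambda>_. True) c"
    then have "\<not> \<bar>limiting_bias l (1 / sqrt 2)\<bar> < \<bar>limiting_bias l c\<bar>"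
      by (auto simp: is_arg_min_def)
    then show "c = 1 / sqrt 2" by (simp add: lb)
  next
    assume "c = 1 / sqrt 2"
    then show "is_arg_min (\<lambda>c. \<bar>limiting_bias l c\<bar>) (\<lambda>_. True) c"
      by (simp add: is_arg_min_def lb)
  qed
  with lim zero show ?thesis by blast
qed

end
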